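(* Let $\mathcal{E}$ be a unital qubit channel with Stokes matrix $R$. Let $O_B^*\in SO(3)$ be a rotation matrix whose first two rows span the same subspace as the vectors $(R_{zz},R_{xz},R_{yz})$ and $(R_{zx},R_{xx},R_{yx})$ (the first two columns of $R$), and whose first row is a scalar multiple of $(R_{zz},R_{xz},R_{yz})$. Let $\mathcal{U}_B^*$ be the corresponding unitary channel, $\mathcal{E}^*=\mathcal{U}_B^*\circ\mathcal{E}$ with Stokes matrix $R^*=O_B^*R$, and $\omega^*=(R^*_{zz},R^*_{zx},R^*_{xz},R^*_{xx},t^*_z,t^*_x)$. Let $s_1^*\ge s_2^*$ be the singular values of the upper-left $2\times2$ submatrix $\begin{pmatrix}R^*_{zz}&R^*_{zx}\\R^*_{xz}&R^*_{xx}\end{pmatrix}$ of $R^*$. Then $$J_1(\mathcal{E})=\min_{\tilde{\mathcal{E}}\in\mathcal{P}_{ba}(\omega^* )}K(\tilde{\mathcal{E}})=1-h\Big(\frac{1+s_1^*}{2}\Big)-h\Big(\frac{1+s_2^*}{2}\Big).$$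
   Context: A qubit channel is described by its Stokes parameterization $(R,t)$: in Bloch coordinates $(\theta_z,\theta_x,\theta_y)$, $\theta_a=\mathrm{Tr}(\rho\sigma_a)$, it acts as $\theta\mapsto R\theta+t$ (indices ordered $z,x,y$); unital means $t=0$. Unitary channels are identified with the rotations in $SO(3)$ they induce on Bloch vectors (every rotation arises), so $\mathcal{U}_B\circ\mathcal{E}$ has Stokes matrix $O_BR$. For a qubit channel $\mathcal{F}$ with complementary (environment) channel $\mathcal{F}_E$, and $|0_z\rangle,|1_z\rangle$ the $\pm1$ eigenvectors of $\sigma_z$: $H_{\mathcal{F}}(X|E)=H(\rho_{XE})-H(\rho_E)$ (von Neumann, base 2) for $\rho_{XE}=\sum_x\frac12|x_z\rangle\langle x_z|\otimes\mathcal{F}_E(|x_z\rangle\langle x_z|)$; $H_{\mathcal{F}}(X|Y)$ is the conditional Shannon entropy for $P_{XY}(x,y)=\frac12\langle y_z|\mathcal{F}(|x_z\rangle\langle x_z|)|y_z\rangle$; $K(\mathcal{F})=H_{\mathcal{F}}(X|E)-H_{\mathcal{F}}(X|Y)$; $h$ is the binary entropy (base 2). $\mathcal{P}_{ba}(\omega)$ ($\omega\in\mathbb{R}^6$) is the set of all qubit channels with $(R_{zz},R_{zx},R_{xz},R_{xx},t_z,t_x)=\omega$ (other parameters arbitrary). $J_1(\mathcal{E})=\max_{\mathcal{U}_B}\min_{\tilde{\mathcal{E}}\in\mathcal{P}_{ba}(\omega')}K(\tilde{\mathcal{E}})$, maximum over all unitary qubit channels $\mathcal{U}_B$, where $\omega'$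 is the parameter vector $(R'_{zz},R'_{zx},R'_{xz},R'_{xx},t'_z,t'_x)$ of $\mathcal{E}'=\mathcal{U}_B\circ\mathcal{E}$. *)

theory Defs
  imports "Jordan_Normal_Form.Schur_Decomposition"
begin

definition mtrace :: "'a::comm_ring_1 mat \<Rightarrow> 'a" where
  "mtrace A = (\<Sum>i<dim_row A. A $$ (i,i))"

text \<open>Pauli matrices, indexed in the order z, x, y (indices 0, 1, 2).\<close>
definition pauli :: "nat \<Rightarrow> complex mat" where
  "pauli a = (if a = 0 then mat_of_rows_list 2 [[1, 0], [0, -1]]
              else if a = 1 then mat_of_rows_list 2 [[0, 1], [1, 0]]
              else mat_of_rows_list 2 [[0, -\<i>], [\<i>, 0]])"

definition zproj :: "nat \<Rightarrow> complex mat" where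
  "zproj x = mat 2 2 (\<lambda>(i,j). if i = x \<and> j = x then 1 else 0)"

definition msum :: "nat \<Rightarrow> complex mat list \<Rightarrow> complex mat" where
  "msum n Ms = foldr (+) Ms (0\<^sub>m n n)"

text \<open>A qubit channel (CPTP map on 2x2 matrices) given by a nonempty list of Kraus
 operators with sum K^dagger K = 1.\<close>
definition qubit_channel :: "complex mat list \<Rightarrow> bool" where
  "qubit_channel Ks \<longleftrightarrow> Ks \<noteq> [] \<and> (\<forall>K\<in>set Ks. K \<in> carrier_mat 2 2) \<and>
     msum 2 (map (\<lambda>K. mat_adjoint K * K) Ks) = 1\<^sub>m 2"

definition chan_apply :: "complex mat list \<Rightarrow> complex mat \<Rightarrow> complex mat" where
  "chan_apply Ks \<rho> = msum 2 (map (\<lambda>K. K * \<rho> * mat_adjoint K) Ks)"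

text \<open>Complementary (environment) channel from the Stinespring isometry
  V|psi> = sum_i K_i|psi> (x) |i>_E:  F_E(rho) = sum_{ij} Tr(K_i rho K_j^dagger) |i><j|.\<close>
definition chan_env :: "complex mat list \<Rightarrow> complex mat \<Rightarrow> complex mat" where
  "chan_env Ks \<rho> = mat (length Ks) (length Ks)
     (\<lambda>(i,j). mtrace (Ks ! i * \<rho> * mat_adjoint (Ks ! j)))"

definition stokes_R :: "complex mat list \<Rightarrow> real mat" where
  "stokes_R Ks = mat 3 3 (\<lambda>(a,b). Re (mtrace (pauli a * chan_apply Ks (pauli b))) / 2)"

definition stokes_t :: "complex mat list \<Rightarrow> real vec" where
  "stokes_t Ks = vec 3 (\<lambda>a. Re (mtrace (pauli a * chan_apply Ks (1\<^sub>m 2))) / 2)"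

definition unital :: "complex mat list \<Rightarrow> bool" where
  "unital Ks \<longleftrightarrow> stokes_t Ks = 0\<^sub>v 3"

definition omega_of :: "real mat \<Rightarrow> real vec \<Rightarrow> real list" where
  "omega_of R t = [R $$ (0,0), R $$ (0,1), R $$ (1,0), R $$ (1,1), t $ 0, t $ 1]"

definition P_ba :: "real list \<Rightarrow> complex mat list set" where
  "P_ba \<omega> = {F. qubit_channel F \<and> omega_of (stokes_R F) (stokes_t F) = \<omega>}"

definition SO3 :: "real mat set" where
  "SO3 = {Q. Q \<in> carrier_mat 3 3 \<and> Q * transpose_mat Q = 1\<^sub>m 3 \<and> det Q = 1}"

definition eta :: "real \<Rightarrow> real" where
  "eta p = (if p \<le> 0 then 0 else - p * log 2 p)"

definition bin_entropy :: "real \<Rightarrow> real" where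
  "bin_entropy p = eta p + eta (1 - p)"

definition vn_entropy :: "complex mat \<Rightarrow> real" where
  "vn_entropy A = (\<Sum>z\<in>{z. poly (char_poly A) z = 0}.
      real (order z (char_poly A)) * eta (Re z))"

text \<open>rho_XE = sum_x 1/2 |x_z><x_z| (x) F_E(|x_z><x_z|), with the X index as the
 outer (block) index.\<close>
definition rho_XE :: "complex mat list \<Rightarrow> complex mat" where
  "rho_XE Ks = (let n = length Ks in mat (2*n) (2*n)
     (\<lambda>(i,j). if i div n = j div n
        then (1/2) * chan_env Ks (zproj (i div n)) $$ (i mod n, j mod n) else 0))"

definition rho_E :: "complex mat list \<Rightarrow> complex mat" where
  "rho_E Ks = (1/2) \<cdot>\<^sub>m chan_env Ks (zproj 0) + (1/2) \<cdot>\<^sub>m chan_env Ks (zproj 1)"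

definition H_XE :: "complex mat list \<Rightarrow> real" where
  "H_XE Ks = vn_entropy (rho_XE Ks) - vn_entropy (rho_E Ks)"

definition P_XY :: "complex mat list \<Rightarrow> nat \<Rightarrow> nat \<Rightarrow> real" where
  "P_XY Ks x y = Re (chan_apply Ks (zproj x) $$ (y,y)) / 2"

definition H_XY :: "complex mat list \<Rightarrow> real" where
  "H_XY Ks = (\<Sum>x<2. \<Sum>y<2. eta (P_XY Ks x y)) - (\<Sum>y<2. eta (\<Sum>x<2. P_XY Ks x y))"

definition key_rate :: "complex mat list \<Rightarrow> real" where
  "key_rate Ks = H_XE Ks - H_XY Ks"

text \<open>J_1(E): maximum over rotations O_B in SO(3) (the unitary channels U_B, which act as
 (R,t) |-> (O_B R, O_B t)) of the minimum of K over P_ba(omega').\<close>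
definition J1 :: "complex mat list \<Rightarrow> real" where
  "J1 E = (SUP Q\<in>SO3. INF F\<in>P_ba (omega_of (Q * stokes_R E) (Q *\<^sub>v stokes_t E)). key_rate F)"

definition sing_max :: "real mat \<Rightarrow> real" where
  "sing_max M = sqrt (Max {k. eigenvalue (transpose_mat M * M) k})"

definition sing_min :: "real mat \<Rightarrow> real" where
  "sing_min M = sqrt (Min {k. eigenvalue (transpose_mat M * M) k})"

definition upper_left2 :: "real mat \<Rightarrow> real mat" where
  "upper_left2 R = mat 2 2 (\<lambda>(i,j). R $$ (i,j))"

end

theory Submission
  imports Defs "HOL-Real_Asymp.Real_Asymp"
begin

text \<open>
  Let \<open>C\<close> be the (conjugated) Choi state of a channel and \<open>\<Delta>\<close> the pinching that removes the blocks
  with distinct inputs \<open>x\<close>. Since \<open>A A\<^sup>*\<close> and \<open>A\<^sup>* A\<close> have the same nonzero spectrum,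
  \<open>H(X|E) = S(\<Delta> C) - S(C)\<close>, while \<open>H(X|Y)\<close> depends only on the diagonal of \<open>C\<close>.

  Upper bound: decompose the upper-left block \<open>M\<close> of the Stokes matrix as a multiple \<open>p\<close> of a rotation
  plus a multiple \<open>q\<close> of a reflection, so that the singular values are \<open>s\<^sub>1 = p + q\<close> and \<open>\<bar>s\<^sub>2\<bar>\<close> with
  \<open>s\<^sub>2 = p - q\<close>. The Bell-diagonal channel with weights \<open>(1 \<plusminus> s\<^sub>1)(1 \<plusminus> s\<^sub>2)/4\<close> has block \<open>M\<close>,
  and \<open>K \<le> 1 - h((1 + s\<^sub>1)/2) - h((1 + s\<^sub>2)/2)\<close> because passing to the diagonal does not decrease
  entropy. For every rotation the singular values are at most those of the first two columns of \<open>R\<close>,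
  which are the ones of the optimal rotation.

  Lower bound: let \<open>\<sigma>\<close> be that Bell-diagonal state for the optimal rotation. The entry \<open>R\<^sup>*\<^sub>x\<^sub>z\<close>
  vanishes, so \<open>\<Delta> \<sigma>\<close> is diagonal, and the monotonicity \<open>D(C || \<sigma>) \<ge> D(\<Delta> C || \<Delta> \<sigma>)\<close> is exactly
  the claim, because \<open>\<sigma>\<close> is a product in the Bell labels and \<open>log \<sigma>\<close> only involves the known correlations.
  If \<open>s\<^sub>1 = 1\<close> then \<open>\<sigma>\<close> is singular; therefore \<open>M\<close> is scaled by \<open>l < 1\<close>, and \<open>l\<close> tends to \<open>1\<close>.
\<close>

section \<open>Adjoints and the entropy of products\<close>

lemma dim_mat_adjoint [simp]:
  "dim_row (mat_adjoint A) = dim_col A" "dim_col (mat_adjoint A) = dim_row A"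
  by (simp_all add: mat_adjoint_def)

lemma mat_adjoint_carrier [simp]:
  "A \<in> carrier_mat n m \<Longrightarrow> mat_adjoint A \<in> carrier_mat m n"
  by (auto intro: carrier_matI)

lemma index_mat_adjoint [simp]:
  fixes A :: "complex mat"
  assumes "i < dim_col A" "j < dim_row A"
  shows "mat_adjoint A $$ (i, j) = cnj (A $$ (j, i))"
  using assms by (simp add: mat_adjoint_def mat_of_rows_index)

lemma mat_adjoint_adjoint:
  fixes A :: "complex mat"
  shows "mat_adjoint (mat_adjoint A) = A"
  by (rule eq_matI) auto

lemma mat_adjoint_mult:
  fixes A :: "complex mat"
  assumes "A \<in> carrier_mat n m" "B \<in> carrier_mat m k"
  shows "mat_adjoint (A * B) = mat_adjoint B * mat_adjoint A"
  by (rule eq_matI) (use assms in \<open>auto simp: scalar_prod_def intro!: sum.cong\<close>)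

section \<open>Sums over the roots of a polynomial, counted with multiplicity\<close>

definition root_sum :: "(complex \<Rightarrow> real) \<Rightarrow> complex poly \<Rightarrow> real" where
  "root_sum f p = (\<Sum>z\<in>{z. poly p z = 0}. real (order z p) * f z)"

lemma root_sum_superset:
  assumes "finite S" "{z. poly p z = 0} \<subseteq> S" "p \<noteq> 0"
  shows "root_sum f p = (\<Sum>z\<in>S. real (order z p) * f z)"
  unfolding root_sum_def using assms
  by (intro sum.mono_neutral_left) (auto simp: order_0I)

text \<open>Multiplicities add under products. Both sums are first extended to the common root set,
  where the additional points have order zero. This additivity lets entropies be computed from
  factorizations of characteristic polynomials.\<close>

lemma root_sum_mult:
  assumes "p \<noteq> 0" "q \<noteq> 0"
  shows "root_sum f (p * q) = root_sum f p + root_sum f q"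
proof -
  define S where "S = {z. poly (p * q) z = 0}"
  have S: "finite S" unfolding S_def using assms by (intro poly_roots_finite) auto
  have "root_sum f (p * q) = (\<Sum>z\<in>S. real (order z (p * q)) * f z)"
    by (simp add: root_sum_def S_def)
  also have "\<dots> = (\<Sum>z\<in>S. real (order z p) * f z) + (\<Sum>z\<in>S. real (order z q) * f z)"
    using assms by (simp add: order_mult distrib_right sum.distrib)
  also have "(\<Sum>z\<in>S. real (order z p) * f z) = root_sum f p"
    using S assms by (intro root_sum_superset [symmetric]) (auto simp: S_def)
  also have "(\<Sum>z\<in>S. real (order z q) * f z) = root_sum f q"
    using S assms by (intro root_sum_superset [symmetric]) (auto simp: S_def)
  finally show ?thesis .
qed

lemma root_sum_linear: "root_sum f [:- a, 1:] = f a"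
proof -
  have "{z. poly [:- a, 1:] z = 0} = {a}" by auto
  moreover have "order a [:- a, 1:] = 1" using order_power_n_n [of a 1] by simp
  ultimately show ?thesis by (simp add: root_sum_def)
qed

lemma root_sum_1: "root_sum f 1 = 0"
  by (simp add: root_sum_def)

lemma root_sum_prod_list:
  "root_sum f (\<Prod>a\<leftarrow>as. [:- a, 1:]) = (\<Sum>a\<leftarrow>as. f a)"
proof (induction as)
  case (Cons a as)
  have "(\<Prod>a\<leftarrow>as. [:- a, 1:]) \<noteq> (0 :: complex poly)"
    by (auto simp: prod_list_zero_iff)
  then show ?case using Cons by (simp add: root_sum_mult root_sum_linear del: mult_pCons_left)
qed (simp add: root_sum_1)

lemma vn_entropy_conv_root_sum: "vn_entropy A = root_sum (\<lambda>z. eta (Re z)) (char_poly A)"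
  by (simp add: vn_entropy_def root_sum_def)

lemma eta_0 [simp]: "eta 0 = 0"
  by (simp add: eta_def)

text \<open>Both sides equal X^m times the determinant of the block matrix \<open>M\<close> with
  blocks X, A, B, 1. The right factor \<open>L\<close> of determinant 1 leaves a block triangular
  matrix with diagonal blocks X - AB and 1; the left factor \<open>N\<close> of determinant X^m
  leaves the diagonal blocks X and X - BA.\<close>

lemma char_poly_mult_swap:
  fixes A :: "'a :: idom mat"
  assumes A: "A \<in> carrier_mat n m" and B: "B \<in> carrier_mat m n"
  shows "[:0, 1:] ^ m * char_poly (A * B) = [:0, 1:] ^ n * char_poly (B * A)"
proof -
  let ?X = "[:0, 1:] :: 'a poly"
  let ?c = "map_mat (\<lambda>a. [:a:])"
  define A' B' where "A' = ?c A" "B' = ?c B"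
  have A': "A' \<in> carrier_mat n m" and B': "B' \<in> carrier_mat m n"
    using A B by (auto simp: A'_B'_def)
  have AB: "A' * B' = ?c (A * B)" and BA: "B' * A' = ?c (B * A)"
    using A B by (simp_all add: A'_B'_def map_poly_mult(1))
  have uminus_c: "map_mat (\<lambda>a. [:-a:]) C = - ?c C" for C :: "'a mat"
    by (rule eq_matI) auto
  have cAB: "char_poly (A * B) = det (?X \<cdot>\<^sub>m 1\<^sub>m n + - (A' * B'))"
    using A B by (simp add: char_poly_def char_poly_matrix_def uminus_c AB)
  have cBA: "char_poly (B * A) = det (?X \<cdot>\<^sub>m 1\<^sub>m m + - (B' * A'))"
    using A B by (simp add: char_poly_def char_poly_matrix_def uminus_c BA)
  define M where "M = four_block_mat (?X \<cdot>\<^sub>m 1\<^sub>m n) A' B' (1\<^sub>m m)"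
  define L where "L = four_block_mat (1\<^sub>m n) (0\<^sub>m n m) (- B') (1\<^sub>m m)"
  define N where "N = four_block_mat (1\<^sub>m n) (0\<^sub>m n m) (- B') (?X \<cdot>\<^sub>m 1\<^sub>m m)"
  have carr: "M \<in> carrier_mat (n + m) (n + m)" "L \<in> carrier_mat (n + m) (n + m)"
    "N \<in> carrier_mat (n + m) (n + m)"
    by (simp_all add: M_def L_def N_def)
  have M_L: "M * L = four_block_mat (?X \<cdot>\<^sub>m 1\<^sub>m n + - (A' * B')) A' (0\<^sub>m m n) (1\<^sub>m m)"
    unfolding M_def L_def
    by (subst mult_four_block_mat [of _ n n _ m _ m], use A' B' in auto)
  have N_M: "N * M = four_block_mat (?X \<cdot>\<^sub>m 1\<^sub>m n) A' (0\<^sub>m m n) (?X \<cdot>\<^sub>m 1\<^sub>m m + - (B' * A'))"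
  proof -
    have 1: "- B' * (?X \<cdot>\<^sub>m 1\<^sub>m n) + ?X \<cdot>\<^sub>m 1\<^sub>m m * B' = 0\<^sub>m m n"
      by (rule eq_matI, use B' in \<open>auto simp: mult_smult_assoc_mat [of _ m m] mult_smult_distrib [of _ m n]\<close>)
    have 2: "- B' * A' + ?X \<cdot>\<^sub>m 1\<^sub>m m * 1\<^sub>m m = ?X \<cdot>\<^sub>m 1\<^sub>m m + - (B' * A')"
      using A' B' by (subst comm_add_mat [of _ m m]) auto
    show ?thesis unfolding N_def M_def
      by (subst mult_four_block_mat [of _ n n _ m _ m], use A' B' 1 2 in auto)
  qed
  have "det M = char_poly (A * B)"
  proof -
    have "det (M * L) = det M * det L" using carr by (intro det_mult) auto
    moreover have "det L = 1" unfolding L_def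
      by (subst det_four_block_mat_upper_right_zero [of _ n _ m], use B' in auto)
    moreover have "det (M * L) = char_poly (A * B)" unfolding M_L cAB
      by (subst det_four_block_mat_lower_left_zero [of _ n _ m], use A' B' in auto)
    ultimately show ?thesis by simp
  qed
  moreover have "det (N * M) = det N * det M" using carr by (intro det_mult) auto
  moreover have "det N = ?X ^ m" unfolding N_def
    by (subst det_four_block_mat_upper_right_zero [of _ n _ m], use B' in auto)
  moreover have "det (N * M) = ?X ^ n * char_poly (B * A)" unfolding N_M cBA
    by (subst det_four_block_mat_lower_left_zero [of _ n _ m], use A' B' in auto)
  ultimately show ?thesis by simp
qed

text \<open>The two characteristic polynomials agree up to powers of X, whose only root 0
  contributes \<open>eta 0 = 0\<close>.\<close>

lemma vn_entropy_mult_swap: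
  assumes A: "A \<in> carrier_mat n m" and B: "B \<in> carrier_mat m n"
  shows "vn_entropy (A * B) = vn_entropy (B * A)"
proof -
  let ?f = "\<lambda>z. eta (Re z)"
  have pow: "root_sum ?f ([:0, 1:] ^ k) = 0" for k
  proof (induction k)
    case (Suc k)
    then show ?case using root_sum_linear [of ?f 0]
      by (simp add: root_sum_mult del: mult_pCons_left)
  qed (simp add: root_sum_1)
  have nz: "char_poly (A * B) \<noteq> 0" "char_poly (B * A) \<noteq> 0"
    using degree_monic_char_poly [of "A * B" n] degree_monic_char_poly [of "B * A" m] A B
    by auto
  have "root_sum ?f ([:0, 1:] ^ m * char_poly (A * B)) = root_sum ?f ([:0, 1:] ^ n * char_poly (B * A))"
    by (simp only: char_poly_mult_swap [OF A B])
  then show ?thesis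
    using nz by (simp add: root_sum_mult pow vn_entropy_conv_root_sum)
qed

section \<open>Diagonalization of Hermitian matrices\<close>

text \<open>Extend \<open>v\<close> to a basis, orthogonalize, and divide every vector by its
  length. The last step is the reason why the first column is only a multiple of
  \<open>v\<close>.\<close>

lemma unitary_completion:
  fixes v :: "complex vec"
  assumes v: "v \<in> carrier_vec n" and v0: "v \<noteq> 0\<^sub>v n"
  obtains W c where "W \<in> carrier_mat n n" "mat_adjoint W * W = 1\<^sub>m n" "col W 0 = c \<cdot>\<^sub>v v"
proof -
  interpret cof_vec_space n "TYPE(complex)" .
  define b where "b = basis_completion v"
  define ws where "ws = gram_schmidt n b"
  have n: "n > 0" using v v0 by (cases n) auto
  from basis_completion [OF v v0, folded b_def]
  have b: "distinct b" "\<not> lin_dep (set b)" "set b \<subseteq> carrier_vec n" "hd b = v" "length b = n"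
    by auto
  then obtain vs where bv: "b = v # vs" using n by (cases b) auto
  have ws: "set ws \<subseteq> carrier_vec n" "corthogonal ws" "length ws = n"
    using gram_schmidt_result [OF b(3) b(1) b(2) refl, folded ws_def] b(5) by auto
  have hd: "ws ! 0 = v"
    using gram_schmidt_hd [OF v, of vs, folded bv ws_def] ws(3) n
    by (metis hd_conv_nth length_greater_0_conv)
  have wsc: "ws ! i \<in> carrier_vec n" if "i < n" for i using ws that by auto
  define N where "N i = (\<Sum>k<n. (cmod (ws ! i $ k))\<^sup>2)" for i
  have sp: "ws ! i \<bullet>c ws ! j = (\<Sum>k<n. ws ! i $ k * cnj (ws ! j $ k))"
    if "i < n" "j < n" for i j
    using wsc [OF that(1)] wsc [OF that(2)] by (simp add: scalar_prod_def atLeast0LessThan)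
  have NN: "ws ! i \<bullet>c ws ! i = of_real (N i)" if "i < n" for i
    unfolding sp [OF that that] N_def by (simp add: complex_norm_square del: of_real_power)
  have Npos: "N i > 0" if "i < n" for i
  proof -
    have "ws ! i \<bullet>c ws ! i \<noteq> 0" using corthogonalD [OF ws(2), of i i] ws(3) that by auto
    then have "N i \<noteq> 0" using NN [OF that] by auto
    moreover have "N i \<ge> 0" unfolding N_def by (intro sum_nonneg) auto
    ultimately show ?thesis by simp
  qed
  define W where "W = mat n n (\<lambda>(k, i). ws ! i $ k / of_real (sqrt (N i)))"
  have W: "W \<in> carrier_mat n n" by (simp add: W_def)
  have "mat_adjoint W * W = 1\<^sub>m n"
  proof (rule eq_matI)
    fix i j assume "i < dim_row (1\<^sub>m n :: complex mat)" "j < dim_col (1\<^sub>m n :: complex mat)"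
    then have ij: "i < n" "j < n" by auto
    have "(mat_adjoint W * W) $$ (i, j)
        = (\<Sum>k<n. cnj (ws ! i $ k) / of_real (sqrt (N i)) * (ws ! j $ k / of_real (sqrt (N j))))"
      using ij by (simp add: W_def scalar_prod_def atLeast0LessThan)
    also have "\<dots> = (\<Sum>k<n. ws ! j $ k * cnj (ws ! i $ k)) / (of_real (sqrt (N i)) * of_real (sqrt (N j)))"
      by (simp add: sum_divide_distrib mult.commute)
    also have "\<dots> = (ws ! j \<bullet>c ws ! i) / (of_real (sqrt (N i)) * of_real (sqrt (N j)))"
      using sp ij by simp
    also have "\<dots> = (if i = j then 1 else 0)"
    proof (cases "i = j")
      case True
      have "complex_of_real (sqrt (N i)) * of_real (sqrt (N i)) = of_real (N i)"
        using Npos [OF ij(1)] by (simp flip: of_real_mult)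
      then show ?thesis using True NN [OF ij(1)] Npos [OF ij(1)] by simp
    next
      case False
      then show ?thesis using corthogonalD [OF ws(2), of j i] ws(3) ij by auto
    qed
    finally show "(mat_adjoint W * W) $$ (i, j) = 1\<^sub>m n $$ (i, j)"
      using ij by simp
  qed (use W in auto)
  moreover have "col W 0 = (1 / of_real (sqrt (N 0))) \<cdot>\<^sub>v v"
    by (rule eq_vecI) (use n v in \<open>auto simp: W_def hd\<close>)
  ultimately show ?thesis using that W by blast
qed

definition real_diag :: "nat \<Rightarrow> (nat \<Rightarrow> real) \<Rightarrow> complex mat" where
  "real_diag n r = mat n n (\<lambda>(i, j). if i = j then of_real (r i) else 0)"

lemma real_diag_carrier [simp]: "real_diag n r \<in> carrier_mat n n"
  by (simp add: real_diag_def)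

lemma mat_adjoint_four_block:
  fixes A :: "complex mat"
  assumes "A \<in> carrier_mat n n" "D \<in> carrier_mat m m"
  shows "mat_adjoint (four_block_mat A (0\<^sub>m n m) (0\<^sub>m m n) D)
    = four_block_mat (mat_adjoint A) (0\<^sub>m n m) (0\<^sub>m m n) (mat_adjoint D)"
  by (rule eq_matI) (use assms in auto)

text \<open>Deflation: a unitary whose first column is an eigenvector turns \<open>A\<close> into a
  Hermitian block diagonal matrix with a first block of size 1, and the induction hypothesis
  diagonalizes the other block.\<close>

theorem hermitian_diagonalization:
  fixes A :: "complex mat"
  assumes "A \<in> carrier_mat n n" "mat_adjoint A = A"
  shows "\<exists>U\<in>carrier_mat n n. \<exists>r. mat_adjoint U * U = 1\<^sub>m n \<and> A = U * real_diag n r * mat_adjoint U"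
  using assms
proof (induction n arbitrary: A)
  case 0
  have "mat_adjoint (1\<^sub>m 0) * 1\<^sub>m 0 = (1\<^sub>m 0 :: complex mat)"
    "A = 1\<^sub>m 0 * real_diag 0 (\<lambda>_. 0) * mat_adjoint (1\<^sub>m 0)"
    by (rule eq_matI; use 0 in auto)+
  then show ?case by (intro bexI [of _ "1\<^sub>m 0"] exI [of _ "\<lambda>_. 0"] conjI) auto
next
  case (Suc n A)
  note A = Suc.prems(1)
  obtain as where as: "char_poly A = (\<Prod>a\<leftarrow>as. [:- a, 1:])" "length as = Suc n"
    using char_poly_factorized [OF A] by blast
  then obtain e as' where "as = e # as'" by (cases as) auto
  then have "poly (char_poly A) e = 0" using as by simp
  then have "eigenvalue A e" using eigenvalue_root_char_poly [OF A] by simp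
  then obtain v where v: "v \<in> carrier_vec (Suc n)" "v \<noteq> 0\<^sub>v (Suc n)" "A *\<^sub>v v = e \<cdot>\<^sub>v v"
    using A unfolding eigenvalue_def eigenvector_def by auto
  obtain W c where W: "W \<in> carrier_mat (Suc n) (Suc n)" "mat_adjoint W * W = 1\<^sub>m (Suc n)"
    and W0: "col W 0 = c \<cdot>\<^sub>v v"
    using unitary_completion [OF v(1,2)] by blast
  have Wa: "mat_adjoint W \<in> carrier_mat (Suc n) (Suc n)" using W by simp
  have WW: "W * mat_adjoint W = 1\<^sub>m (Suc n)"
    using mat_mult_left_right_inverse [OF Wa W(1) W(2)] .
  define A' where "A' = mat_adjoint W * (A * W)"
  have A': "A' \<in> carrier_mat (Suc n) (Suc n)" unfolding A'_def by (rule mult_carrier_mat [OF Wa mult_carrier_mat [OF A W(1)]])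
  have herm: "mat_adjoint A' = A'"
  proof -
    have "mat_adjoint A' = mat_adjoint (A * W) * mat_adjoint (mat_adjoint W)"
      unfolding A'_def by (rule mat_adjoint_mult) (use A W Wa in auto)
    also have "\<dots> = mat_adjoint W * A * W"
      using mat_adjoint_mult [OF A W(1)] Suc.prems(2) by (simp add: mat_adjoint_adjoint)
    also have "\<dots> = A'" unfolding A'_def using A W Wa by (intro assoc_mult_mat) auto
    finally show ?thesis .
  qed
  have "col A' 0 = mat_adjoint W *\<^sub>v (A *\<^sub>v col W 0)"
    unfolding A'_def
    using col_mult2 [OF Wa mult_carrier_mat [OF A W(1)], of 0] col_mult2 [OF A W(1), of 0] by simp
  also have "A *\<^sub>v col W 0 = e \<cdot>\<^sub>v col W 0"
    unfolding W0 using v A by (simp add: mult_mat_vec smult_smult_assoc mult.commute)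
  also have "mat_adjoint W *\<^sub>v (e \<cdot>\<^sub>v col W 0) = e \<cdot>\<^sub>v (mat_adjoint W *\<^sub>v col W 0)"
    using W Wa by (intro mult_mat_vec) auto
  also have "mat_adjoint W *\<^sub>v col W 0 = col (mat_adjoint W * W) 0"
    using col_mult2 [OF Wa W(1), of 0] by simp
  finally have col0: "col A' 0 = e \<cdot>\<^sub>v col (1\<^sub>m (Suc n)) 0" using W(2) by simp
  have i0: "A' $$ (i, 0) = (if i = 0 then e else 0)" if "i < Suc n" for i
  proof -
    have "A' $$ (i, 0) = col A' 0 $ i" using A' that by simp
    then show ?thesis unfolding col0 using that by simp
  qed
  \<comment> \<open>Hermiticity carries the zeros of the first column over to the first row and
    makes the eigenvalue real.\<close>
  have 0: "A' $$ (0, i) = (if i = 0 then e else 0)" "cnj e = e" if "i < Suc n" for i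
  proof -
    have h: "A' $$ (0, i) = cnj (A' $$ (i, 0))" if "i < Suc n" for i
      using arg_cong [OF herm, of "\<lambda>M. M $$ (0, i)"] A' that by simp
    have "e = cnj e" using h [of 0] i0 [of 0] by simp
    then show "cnj e = e" by simp
    then show "A' $$ (0, i) = (if i = 0 then e else 0)" using h [OF that] i0 [OF that] by auto
  qed
  define A3 where "A3 = mat n n (\<lambda>(i, j). A' $$ (Suc i, Suc j))"
  have A3: "A3 \<in> carrier_mat n n" by (simp add: A3_def)
  have "mat_adjoint A3 = A3"
  proof (rule eq_matI)
    fix i j assume "i < dim_row A3" "j < dim_col A3"
    then have ij: "i < n" "j < n" using A3 by auto
    have "A' $$ (Suc i, Suc j) = cnj (A' $$ (Suc j, Suc i))"
      using arg_cong [OF herm, of "\<lambda>M. M $$ (Suc i, Suc j)"] A' ij by simp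
    then show "mat_adjoint A3 $$ (i, j) = A3 $$ (i, j)" using ij by (simp add: A3_def)
  qed (use A3 in auto)
  with Suc.IH [OF A3] obtain U3 r where U3: "U3 \<in> carrier_mat n n" "mat_adjoint U3 * U3 = 1\<^sub>m n"
    and A3U: "A3 = U3 * real_diag n r * mat_adjoint U3" by blast
  define r' where "r' i = (if i = 0 then Re e else r (i - 1))" for i
  have ere: "of_real (Re e) = e" using 0(2) [of 0] by (simp add: complex_eq_iff)
  \<comment> \<open>Block diagonal matrices with a block \<open>a\<close> of size 1 and a block
    \<open>B\<close>; products and adjoints are taken blockwise.\<close>
  let ?b = "\<lambda>a B. four_block_mat (mat 1 1 (\<lambda>_. a)) (0\<^sub>m 1 n) (0\<^sub>m n 1) (B :: complex mat)"
  have bm: "?b a B * ?b a' B' = ?b (a * a') (B * B')"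
    if "B \<in> carrier_mat n n" "B' \<in> carrier_mat n n" for a a' B B'
    by (subst mult_four_block_mat [of _ 1 1 _ n _ n], use that in \<open>auto simp: scalar_prod_def intro!: arg_cong2 [where f = "\<lambda>x y. four_block_mat x _ _ y"]\<close>)
  have ba: "mat_adjoint (?b a B) = ?b (cnj a) (mat_adjoint B)" if "B \<in> carrier_mat n n" for a B
  proof -
    have "mat_adjoint (mat 1 1 (\<lambda>_. a)) = mat 1 1 (\<lambda>_. cnj a)" by (rule eq_matI) auto
    then show ?thesis using that by (simp add: mat_adjoint_four_block)
  qed
  have A'b: "A' = ?b e A3"
    by (rule eq_matI) (use A' i0 0 in \<open>auto simp: A3_def\<close>)
  have Db: "real_diag (Suc n) r' = ?b e (real_diag n r)"
    by (rule eq_matI) (auto simp: real_diag_def r'_def ere)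
  have 1: "?b 1 (1\<^sub>m n) = 1\<^sub>m (Suc n)"
    by (rule eq_matI) auto
  define V where "V = ?b 1 U3"
  have V: "V \<in> carrier_mat (Suc n) (Suc n)"
    using four_block_carrier_mat [of "mat 1 1 (\<lambda>_. 1)" 1 1 U3 n n] U3 by (simp add: V_def)
  have Va: "mat_adjoint V = ?b 1 (mat_adjoint U3)" unfolding V_def using ba [OF U3(1), of 1] by simp
  have VV: "mat_adjoint V * V = 1\<^sub>m (Suc n)"
    unfolding Va unfolding V_def bm [OF mat_adjoint_carrier [OF U3(1)] U3(1)] U3(2)
    using 1 by simp
  have VDV: "A' = V * real_diag (Suc n) r' * mat_adjoint V"
    unfolding Va unfolding V_def Db A'b A3U bm [OF U3(1) real_diag_carrier]
    bm [OF mult_carrier_mat [OF U3(1) real_diag_carrier] mat_adjoint_carrier [OF U3(1)]] by simp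
  define U where "U = W * V"
  have U: "U \<in> carrier_mat (Suc n) (Suc n)" using W V by (simp add: U_def)
  have Ua: "mat_adjoint U = mat_adjoint V * mat_adjoint W"
    unfolding U_def using W V by (intro mat_adjoint_mult) auto
  let ?C = "carrier_mat (Suc n) (Suc n)"
  have Vac: "mat_adjoint V \<in> ?C" using V by simp
  let ?D = "real_diag (Suc n) r'"
  have D: "?D \<in> ?C" by simp
  have "mat_adjoint U * U = mat_adjoint V * (mat_adjoint W * (W * V))"
    unfolding Ua unfolding U_def using W V Wa Vac by (intro assoc_mult_mat) auto
  also have "mat_adjoint W * (W * V) = mat_adjoint W * W * V"
    using W V Wa by (intro assoc_mult_mat [symmetric]) auto
  finally have UU: "mat_adjoint U * U = 1\<^sub>m (Suc n)" using W V VV by simp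
  have "U * ?D * mat_adjoint U = W * V * ?D * (mat_adjoint V * mat_adjoint W)"
    unfolding Ua unfolding U_def ..
  also have "\<dots> = W * (V * ?D * mat_adjoint V) * mat_adjoint W"
    by (simp add: assoc_mult_mat [of _ "Suc n" "Suc n" _ "Suc n" _ "Suc n"] mult_carrier_mat [of _ "Suc n" "Suc n" _ "Suc n"] W(1) V Wa Vac D)
  also have "\<dots> = W * (mat_adjoint W * (A * W)) * mat_adjoint W"
    by (simp only: VDV [symmetric] A'_def)
  also have "\<dots> = (W * mat_adjoint W) * A * (W * mat_adjoint W)"
    by (simp add: assoc_mult_mat [of _ "Suc n" "Suc n" _ "Suc n" _ "Suc n"] mult_carrier_mat [of _ "Suc n" "Suc n" _ "Suc n"] W(1) A Wa)
  also have "\<dots> = A" using A WW by simp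
  finally show ?case using U UU by metis
qed

section \<open>Spectral representations in coordinates\<close>

lemma mult_if_zero:
  "(x :: 'a :: mult_zero) * (if P then y else 0) = (if P then x * y else 0)"
  by simp

text \<open>\<open>u a i\<close> is coordinate \<open>a\<close> of vector \<open>i\<close>.
  Orthonormality of the columns and of the rows are both recorded, so that completeness is at hand
  whenever sums are exchanged.\<close>

definition orthonormal_basis :: "nat \<Rightarrow> (nat \<Rightarrow> nat \<Rightarrow> complex) \<Rightarrow> bool" where
  "orthonormal_basis n u \<longleftrightarrow>
     (\<forall>i<n. \<forall>j<n. (\<Sum>a<n. cnj (u a i) * u a j) = (if i = j then 1 else 0)) \<and>
     (\<forall>a<n. \<forall>b<n. (\<Sum>i<n. u a i * cnj (u b i)) = (if a = b then 1 else 0))"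

text \<open>States are functions of two indices instead of matrices, and only their values below
  \<open>n\<close> matter; the entropy arguments then become exchanges of finite sums. The
  eigenvalues \<open>r\<close> may have either sign here.\<close>

definition spectral_rep ::
  "nat \<Rightarrow> (nat \<Rightarrow> nat \<Rightarrow> complex) \<Rightarrow> (nat \<Rightarrow> nat \<Rightarrow> complex) \<Rightarrow> (nat \<Rightarrow> real) \<Rightarrow> bool" where
  "spectral_rep n \<rho> u r \<longleftrightarrow> orthonormal_basis n u \<and>
     (\<forall>a<n. \<forall>b<n. \<rho> a b = (\<Sum>i<n. of_real (r i) * u a i * cnj (u b i)))"

lemma orthonormal_basis_cols:
  "orthonormal_basis n u \<Longrightarrow> i < n \<Longrightarrow> j < n \<Longrightarrow>
    (\<Sum>a<n. cnj (u a i) * u a j) = (if i = j then 1 else 0)"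
  by (simp add: orthonormal_basis_def)

lemma orthonormal_basis_rows:
  "orthonormal_basis n u \<Longrightarrow> a < n \<Longrightarrow> b < n \<Longrightarrow>
    (\<Sum>i<n. u a i * cnj (u b i)) = (if a = b then 1 else 0)"
  by (simp add: orthonormal_basis_def)

lemma orthonormal_basis_norm_cols:
  assumes "orthonormal_basis n u" "i < n"
  shows "(\<Sum>a<n. (cmod (u a i))\<^sup>2) = 1"
proof -
  have "complex_of_real (\<Sum>a<n. (cmod (u a i))\<^sup>2) = (\<Sum>a<n. cnj (u a i) * u a i)"
    by (simp add: complex_norm_square mult.commute del: of_real_power)
  then show ?thesis using orthonormal_basis_cols [OF assms assms(2)]
    by (metis of_real_eq_1_iff)
qed

lemma orthonormal_basis_norm_rows:
  assumes "orthonormal_basis n u" "a < n"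
  shows "(\<Sum>i<n. (cmod (u a i))\<^sup>2) = 1"
proof -
  have "complex_of_real (\<Sum>i<n. (cmod (u a i))\<^sup>2) = (\<Sum>i<n. u a i * cnj (u a i))"
    by (simp add: complex_norm_square del: of_real_power)
  then show ?thesis using orthonormal_basis_rows [OF assms assms(2)]
    by (metis of_real_eq_1_iff)
qed

lemma orthonormal_basis_cnj: "orthonormal_basis n u \<Longrightarrow> orthonormal_basis n (\<lambda>a i. cnj (u a i))"
  unfolding orthonormal_basis_def
proof (elim conjE, intro conjI allI impI)
  fix i j assume h: "\<forall>i<n. \<forall>j<n. (\<Sum>a<n. cnj (u a i) * u a j) = (if i = j then 1 else 0)"
    and ij: "i < n" "j < n"
  show "(\<Sum>a<n. cnj (cnj (u a i)) * cnj (u a j)) = (if i = j then 1 else 0)"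
    using h [rule_format, OF ij(2,1)] by (auto simp: mult.commute split: if_splits)
next
  fix a b assume h: "\<forall>a<n. \<forall>b<n. (\<Sum>i<n. u a i * cnj (u b i)) = (if a = b then 1 else 0)"
    and ab: "a < n" "b < n"
  show "(\<Sum>i<n. cnj (u a i) * cnj (cnj (u b i))) = (if a = b then 1 else 0)"
    using h [rule_format, OF ab(2,1)] by (auto simp: mult.commute split: if_splits)
qed

text \<open>Completeness of the basis collapses the double sum over \<open>a\<close> and
  \<open>b\<close> to its diagonal.\<close>

lemma parseval:
  assumes "orthonormal_basis n u"
  shows "(\<Sum>i<n. (\<Sum>a<n. x a * u a i) * cnj (\<Sum>b<n. y b * u b i)) = (\<Sum>a<n. x a * cnj (y a))"
proof -
  have "(\<Sum>i<n. (\<Sum>a<n. x a * u a i) * cnj (\<Sum>b<n. y b * u b i))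
      = (\<Sum>i<n. \<Sum>a<n. \<Sum>b<n. x a * cnj (y b) * (u a i * cnj (u b i)))"
    by (simp add: sum_product mult_ac)
  also have "\<dots> = (\<Sum>a<n. \<Sum>b<n. \<Sum>i<n. x a * cnj (y b) * (u a i * cnj (u b i)))"
    by (subst sum.swap, rule sum.cong [OF refl], rule sum.swap)
  also have "\<dots> = (\<Sum>a<n. \<Sum>b<n. x a * cnj (y b) * (if a = b then 1 else 0))"
    by (intro sum.cong refl) (simp add: orthonormal_basis_rows [OF assms] flip: sum_distrib_left)
  also have "\<dots> = (\<Sum>a<n. x a * cnj (y a))"
    by (intro sum.cong refl) (simp add: mult_if_zero)
  finally show ?thesis .
qed

lemma parseval_norm:
  assumes "orthonormal_basis n u"
  shows "(\<Sum>i<n. (cmod (\<Sum>a<n. x a * u a i))\<^sup>2) = (\<Sum>a<n. (cmod (x a))\<^sup>2)"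
proof -
  have "complex_of_real (\<Sum>i<n. (cmod (\<Sum>a<n. x a * u a i))\<^sup>2) = of_real (\<Sum>a<n. (cmod (x a))\<^sup>2)"
    using parseval [OF assms, of x x] by (simp only: of_real_sum complex_norm_square)
  then show ?thesis by (simp only: of_real_eq_iff)
qed

lemma spectral_rep_diag:
  assumes "spectral_rep n \<rho> u r" "a < n"
  shows "Re (\<rho> a a) = (\<Sum>i<n. r i * (cmod (u a i))\<^sup>2)"
proof -
  have "\<rho> a a = (\<Sum>i<n. of_real (r i) * (u a i * cnj (u a i)))"
    using assms by (simp add: spectral_rep_def mult.assoc)
  also have "\<dots> = of_real (\<Sum>i<n. r i * (cmod (u a i))\<^sup>2)"
    by (simp add: complex_norm_square del: of_real_power)
  finally show ?thesis by simp
qed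

lemma spectral_rep_trace:
  assumes "spectral_rep n \<rho> u r"
  shows "(\<Sum>a<n. Re (\<rho> a a)) = (\<Sum>i<n. r i)"
proof -
  have "(\<Sum>a<n. Re (\<rho> a a)) = (\<Sum>a<n. \<Sum>i<n. r i * (cmod (u a i))\<^sup>2)"
    using spectral_rep_diag [OF assms] by simp
  also have "\<dots> = (\<Sum>i<n. r i * (\<Sum>a<n. (cmod (u a i))\<^sup>2))"
    by (subst sum.swap) (simp add: sum_distrib_left)
  also have "\<dots> = (\<Sum>i<n. r i)"
    using assms by (intro sum.cong refl) (simp add: orthonormal_basis_norm_cols spectral_rep_def)
  finally show ?thesis .
qed

lemma spectral_rep_quadratic_form:
  assumes "spectral_rep n \<rho> u r"
  shows "(\<Sum>a<n. \<Sum>b<n. cnj (x a) * \<rho> a b * x b) = of_real (\<Sum>i<n. r i * (cmod (\<Sum>a<n. cnj (x a) * u a i))\<^sup>2)"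
proof -
  have "(\<Sum>a<n. \<Sum>b<n. cnj (x a) * \<rho> a b * x b)
      = (\<Sum>a<n. \<Sum>b<n. \<Sum>i<n. of_real (r i) * (cnj (x a) * u a i * (x b * cnj (u b i))))"
    using assms by (intro sum.cong refl)
      (simp add: spectral_rep_def sum_distrib_left sum_distrib_right mult_ac)
  also have "\<dots> = (\<Sum>a<n. \<Sum>i<n. \<Sum>b<n. of_real (r i) * (cnj (x a) * u a i * (x b * cnj (u b i))))"
    by (rule sum.cong [OF refl], rule sum.swap)
  also have "\<dots> = (\<Sum>i<n. \<Sum>a<n. \<Sum>b<n. of_real (r i) * (cnj (x a) * u a i * (x b * cnj (u b i))))"
    by (rule sum.swap)
  also have "\<dots> = (\<Sum>i<n. of_real (r i) * ((\<Sum>a<n. cnj (x a) * u a i) * cnj (\<Sum>a<n. cnj (x a) * u a i)))"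
    unfolding cnj_sum complex_cnj_mult complex_cnj_cnj sum_product
    unfolding sum_distrib_left ..
  also have "\<dots> = of_real (\<Sum>i<n. r i * (cmod (\<Sum>a<n. cnj (x a) * u a i))\<^sup>2)"
    by (simp add: complex_norm_square del: of_real_power)
  finally show ?thesis .
qed

lemma spectral_rep_eigenvalue:
  assumes rep: "spectral_rep n \<rho> u r" and i: "i < n"
  shows "(\<Sum>a<n. \<Sum>b<n. cnj (u a i) * \<rho> a b * u b i) = of_real (r i)"
proof -
  have u: "orthonormal_basis n u" using rep by (simp add: spectral_rep_def)
  have "(\<Sum>k<n. r k * (cmod (\<Sum>a<n. cnj (u a i) * u a k))\<^sup>2) = (\<Sum>k<n. r k * (if i = k then 1 else 0))"
    using orthonormal_basis_cols [OF u i] by (intro sum.cong refl) simp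
  also have "\<dots> = r i" using i by (simp add: mult_if_zero)
  finally show ?thesis
    unfolding spectral_rep_quadratic_form [OF rep] by simp
qed

section \<open>Entropy, eigenvalues and diagonal entries\<close>

lemma vn_entropy_real_diag: "vn_entropy (real_diag n r) = (\<Sum>i<n. eta (r i))"
proof -
  have "char_poly (real_diag n r) = (\<Prod>a\<leftarrow>diag_mat (real_diag n r). [:- a, 1:])"
    by (rule char_poly_upper_triangular [of _ n]) (auto simp: real_diag_def)
  also have "diag_mat (real_diag n r) = map (\<lambda>i. of_real (r i)) [0..<n]"
    by (auto simp: diag_mat_def real_diag_def)
  finally show ?thesis
    unfolding vn_entropy_conv_root_sum
    by (simp only: root_sum_prod_list) (simp add: o_def interv_sum_list_conv_sum_set_nat atLeast0LessThan)
qed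

lemma hermitian_spectral_rep:
  assumes A: "A \<in> carrier_mat n n" "mat_adjoint A = A"
  obtains u r where "spectral_rep n (\<lambda>a b. A $$ (a, b)) u r" "vn_entropy A = (\<Sum>i<n. eta (r i))"
proof -
  obtain U r where U: "U \<in> carrier_mat n n" "mat_adjoint U * U = 1\<^sub>m n"
    and AU: "A = U * real_diag n r * mat_adjoint U"
    using hermitian_diagonalization [OF A] by blast
  have Ua: "mat_adjoint U \<in> carrier_mat n n" using U by simp
  have UU: "U * mat_adjoint U = 1\<^sub>m n" using mat_mult_left_right_inverse [OF Ua U(1) U(2)] .
  define u where "u a i = U $$ (a, i)" for a i
  have "orthonormal_basis n u" unfolding orthonormal_basis_def
  proof (intro conjI allI impI)
    fix i j assume ij: "i < n" "j < n"
    have "(mat_adjoint U * U) $$ (i, j) = (\<Sum>a<n. cnj (u a i) * u a j)"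
      using U(1) ij by (simp add: u_def scalar_prod_def atLeast0LessThan)
    then show "(\<Sum>a<n. cnj (u a i) * u a j) = (if i = j then 1 else 0)" using U(2) ij by simp
  next
    fix a b assume ab: "a < n" "b < n"
    have "(U * mat_adjoint U) $$ (a, b) = (\<Sum>i<n. u a i * cnj (u b i))"
      using U(1) ab by (simp add: u_def scalar_prod_def atLeast0LessThan)
    then show "(\<Sum>i<n. u a i * cnj (u b i)) = (if a = b then 1 else 0)" using UU ab by simp
  qed
  moreover have "A $$ (a, b) = (\<Sum>i<n. of_real (r i) * u a i * cnj (u b i))" if ab: "a < n" "b < n" for a b
  proof -
    have UD: "(U * real_diag n r) $$ (a, i) = u a i * of_real (r i)" if i: "i < n" for i
    proof -
      have "(U * real_diag n r) $$ (a, i) = (\<Sum>k<n. u a k * (if k = i then of_real (r k) else 0))"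
        using U(1) ab i by (simp add: u_def scalar_prod_def atLeast0LessThan real_diag_def)
      also have "\<dots> = u a i * of_real (r i)"
        using i by (simp add: mult_if_zero)
      finally show ?thesis .
    qed
    have UDc: "U * real_diag n r \<in> carrier_mat n n"
      using mult_carrier_mat [OF U(1) real_diag_carrier] .
    have "A $$ (a, b) = (\<Sum>i<n. (U * real_diag n r) $$ (a, i) * mat_adjoint U $$ (i, b))"
      unfolding AU using U(1) ab UDc by (simp add: scalar_prod_def atLeast0LessThan real_diag_def)
    also have "\<dots> = (\<Sum>i<n. of_real (r i) * u a i * cnj (u b i))"
      using UD U(1) ab by (intro sum.cong refl) (simp add: u_def)
    finally show ?thesis .
  qed
  ultimately have "spectral_rep n (\<lambda>a b. A $$ (a, b)) u r" by (simp add: spectral_rep_def)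
  moreover have "vn_entropy A = (\<Sum>i<n. eta (r i))"
  proof -
    have "similar_mat A (real_diag n r)"
      unfolding similar_mat_def
    proof (intro exI)
      show "similar_mat_wit A (real_diag n r) U (mat_adjoint U)"
        by (rule similar_mat_witI [of _ _ n]) (use A U UU AU in auto)
    qed
    then have "vn_entropy A = vn_entropy (real_diag n r)"
      by (simp add: vn_entropy_conv_root_sum char_poly_similar)
    then show ?thesis by (simp add: vn_entropy_real_diag)
  qed
  ultimately show ?thesis using that by blast
qed

text \<open>The tangent of the concave function \<open>eta\<close> at \<open>s\<close>, from ln x
  \<le> x - 1. Summed over two distributions of equal mass, the last term cancels and Gibbs'
  inequality remains.\<close>

lemma eta_le_cross:
  assumes "r \<ge> 0" "s > 0"
  shows "eta r \<le> - r * log 2 s + (s - r) / ln 2"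
proof (cases "r = 0")
  case False
  then have r: "r > 0" using assms by simp
  have "ln (s / r) \<le> s / r - 1" using assms r by (intro ln_le_minus_one) simp
  then have "r * (ln s - ln r) \<le> s - r"
    using assms r by (simp add: ln_div field_simps)
  then have "- r * ln r \<le> - r * ln s + (s - r)" by (simp add: algebra_simps)
  then have "- r * ln r / ln 2 \<le> (- r * ln s + (s - r)) / ln 2"
    by (intro divide_right_mono) auto
  then show ?thesis using r by (simp add: eta_def log_def add_divide_distrib diff_divide_distrib)
qed (use assms in simp)

text \<open>Each diagonal entry is an average of the eigenvalues with the doubly stochastic weights
  |u a i|^2, and \<open>eta\<close> is concave. Jensen's inequality is applied through the tangent
  at the average \<open>d\<close>.\<close>

lemma sum_eta_eigenvalues_le_diag:
  assumes rep: "spectral_rep n \<rho> u r" and r: "\<And>i. i < n \<Longrightarrow> r i \<ge> 0"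
  shows "(\<Sum>i<n. eta (r i)) \<le> (\<Sum>a<n. eta (Re (\<rho> a a)))"
proof -
  have u: "orthonormal_basis n u" using rep by (simp add: spectral_rep_def)
  have "(\<Sum>i<n. (cmod (u a i))\<^sup>2 * eta (r i)) \<le> eta (Re (\<rho> a a))" if a: "a < n" for a
  proof -
    define d where "d = (\<Sum>i<n. r i * (cmod (u a i))\<^sup>2)"
    have d: "Re (\<rho> a a) = d" unfolding d_def by (rule spectral_rep_diag [OF rep a])
    have nn: "\<forall>i\<in>{..<n}. r i * (cmod (u a i))\<^sup>2 \<ge> 0" using r by simp
    show ?thesis
    proof (cases "d = 0")
      \<comment> \<open>At 0 there is no tangent. There every eigenvalue of nonzero weight is 0, so
        all terms vanish.\<close>
      case True
      then have "\<forall>i\<in>{..<n}. r i * (cmod (u a i))\<^sup>2 = 0"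
        using sum_nonneg_eq_0_iff [of "{..<n}" "\<lambda>i. r i * (cmod (u a i))\<^sup>2"] nn d_def by simp
      then have "\<forall>i\<in>{..<n}. (cmod (u a i))\<^sup>2 * eta (r i) = 0" by (metis eta_0 mult_eq_0_iff)
      then show ?thesis using True d by (simp add: sum.neutral)
    next
      case False
      moreover have "d \<ge> 0" unfolding d_def using nn by (intro sum_nonneg) auto
      ultimately have dpos: "d > 0" by simp
      have "(\<Sum>i<n. (cmod (u a i))\<^sup>2 * eta (r i))
          \<le> (\<Sum>i<n. (cmod (u a i))\<^sup>2 * (- r i * log 2 d + (d - r i) / ln 2))"
        using eta_le_cross [OF r dpos] by (intro sum_mono mult_left_mono) auto
      also have "\<dots> = (\<Sum>i<n. - log 2 d * (r i * (cmod (u a i))\<^sup>2)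
          + (d / ln 2 * (cmod (u a i))\<^sup>2 - (r i * (cmod (u a i))\<^sup>2) / ln 2))"
        by (intro sum.cong refl) (simp add: algebra_simps diff_divide_distrib)
      also have "\<dots> = - log 2 d * d + (d / ln 2 * (\<Sum>i<n. (cmod (u a i))\<^sup>2) - d / ln 2)"
        unfolding sum.distrib sum_subtractf sum_distrib_left [symmetric] sum_divide_distrib [symmetric]
          d_def [symmetric] ..
      also have "\<dots> = eta d" using dpos orthonormal_basis_norm_rows [OF u a] by (simp add: eta_def)
      finally show ?thesis using d by simp
    qed
  qed
  then have "(\<Sum>a<n. \<Sum>i<n. (cmod (u a i))\<^sup>2 * eta (r i)) \<le> (\<Sum>a<n. eta (Re (\<rho> a a)))"
    by (intro sum_mono) auto
  moreover have "(\<Sum>a<n. \<Sum>i<n. (cmod (u a i))\<^sup>2 * eta (r i)) = (\<Sum>i<n. (\<Sum>a<n. (cmod (u a i))\<^sup>2) * eta (r i))"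
    by (subst sum.swap) (simp add: sum_distrib_right)
  moreover have "\<dots> = (\<Sum>i<n. eta (r i))"
    using orthonormal_basis_norm_cols [OF u] by (intro sum.cong refl) simp
  ultimately show ?thesis by simp
qed

section \<open>Relative entropy under pinching\<close>

text \<open>The Cauchy-Schwarz inequality reduces the claim to moduli; then the square is completed
  in |y|.\<close>

lemma complete_square_bound:
  fixes G y :: complex
  assumes r: "r \<ge> 0" and d: "d > 0"
  shows "2 * (r * Re (G * cnj y)) - d * (cmod y)\<^sup>2 \<le> (cmod G)\<^sup>2 * r\<^sup>2 / d"
proof -
  have "Re (G * cnj y) \<le> cmod G * cmod y"
    using complex_Re_le_cmod [of "G * cnj y"] by (simp add: norm_mult)
  then have "2 * (r * Re (G * cnj y)) \<le> 2 * (r * (cmod G * cmod y))"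
    using r by (simp add: mult_left_mono)
  moreover have "0 \<le> (d * cmod y - r * cmod G)\<^sup>2 / d" using d by simp
  then have "0 \<le> d * (cmod y)\<^sup>2 - 2 * (r * (cmod G * cmod y)) + (cmod G)\<^sup>2 * r\<^sup>2 / d"
    using d by (simp add: power2_eq_square field_simps)
  ultimately show ?thesis by linarith
qed

text \<open>The right-hand side is the maximum over \<open>Y\<close> of the left-hand side, i.e. the quadratic form of the
  inverse of \<open>Y \<mapsto> \<sigma> Y + t Y \<rho>\<close> at \<open>\<rho>\<close>. The left-hand side is linear in \<open>(\<rho>, \<sigma>)\<close>, so the maximizer
  for the pinched pair can be tested against the original pair.\<close>
lemma resolvent_form_upper:
  assumes rho: "spectral_rep n \<rho> u r" and r: "\<And>i. i < n \<Longrightarrow> r i \<ge> 0"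
    and sigma: "spectral_rep n \<sigma> w s" and s: "\<And>j. j < n \<Longrightarrow> s j > 0" and t: "t \<ge> 0"
  shows "2 * Re (\<Sum>a<n. \<Sum>b<n. cnj (Y a b) * \<rho> a b)
      - Re (\<Sum>c<n. \<Sum>a<n. \<Sum>b<n. cnj (Y a c) * \<sigma> a b * Y b c)
      - t * Re (\<Sum>a<n. \<Sum>b<n. \<Sum>c<n. Y a b * \<rho> b c * cnj (Y a c))
    \<le> (\<Sum>j<n. \<Sum>i<n. (cmod (\<Sum>a<n. u a i * cnj (w a j)))\<^sup>2 * (r i)\<^sup>2 / (s j + t * r i))"
proof -
  have u: "orthonormal_basis n u" and w: "orthonormal_basis n w"
    using rho sigma by (auto simp: spectral_rep_def)
  note w' = orthonormal_basis_cnj [OF w]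
  \<comment> \<open>\<open>y j i\<close> is the matrix element of \<open>Y\<close> between
    eigenvector \<open>j\<close> of \<sigma> and eigenvector \<open>i\<close> of \<rho>, and
    \<open>G j i\<close> is the overlap of these vectors. \<open>x\<close> and \<open>z\<close> are
    the intermediate stages in which only one index has been transformed.\<close>
  define x where "x j c = (\<Sum>a<n. Y a c * cnj (w a j))" for j c
  define z where "z a i = (\<Sum>b<n. Y a b * u b i)" for a i
  define y where "y j i = (\<Sum>a<n. z a i * cnj (w a j))" for j i
  define G where "G j i = (\<Sum>a<n. u a i * cnj (w a j))" for j i
  have yx: "y j i = (\<Sum>c<n. x j c * u c i)" for i j
    unfolding y_def z_def x_def sum_distrib_right
    by (subst sum.swap) (simp add: mult_ac)
  have Px: "(\<Sum>c<n. (cmod (x j c))\<^sup>2) = (\<Sum>i<n. (cmod (y j i))\<^sup>2)" for j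
    unfolding yx by (rule parseval_norm [OF u, symmetric])
  have Pz: "(\<Sum>a<n. (cmod (z a i))\<^sup>2) = (\<Sum>j<n. (cmod (y j i))\<^sup>2)" for i
    unfolding y_def by (rule parseval_norm [OF w', symmetric])
  have PG: "(\<Sum>a<n. u a i * cnj (z a i)) = (\<Sum>j<n. G j i * cnj (y j i))" for i
    unfolding y_def G_def by (rule parseval [OF w', symmetric])
  have "(\<Sum>a<n. \<Sum>b<n. cnj (Y a b) * \<rho> a b)
      = (\<Sum>a<n. \<Sum>b<n. \<Sum>i<n. of_real (r i) * (u a i * (cnj (Y a b) * cnj (u b i))))"
    using rho by (intro sum.cong refl) (simp add: spectral_rep_def sum_distrib_left mult_ac)
  also have "\<dots> = (\<Sum>a<n. \<Sum>i<n. \<Sum>b<n. of_real (r i) * (u a i * (cnj (Y a b) * cnj (u b i))))"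
    by (rule sum.cong [OF refl], rule sum.swap)
  also have "\<dots> = (\<Sum>i<n. \<Sum>a<n. \<Sum>b<n. of_real (r i) * (u a i * (cnj (Y a b) * cnj (u b i))))"
    by (rule sum.swap)
  also have "\<dots> = (\<Sum>i<n. of_real (r i) * (\<Sum>a<n. u a i * cnj (z a i)))"
    by (simp add: z_def sum_distrib_left)
  also have "\<dots> = (\<Sum>i<n. of_real (r i) * (\<Sum>j<n. G j i * cnj (y j i)))"
    by (simp only: PG)
  finally have "(\<Sum>a<n. \<Sum>b<n. cnj (Y a b) * \<rho> a b) = (\<Sum>i<n. of_real (r i) * (\<Sum>j<n. G j i * cnj (y j i)))" .
  moreover have "Re (of_real c * z) = c * Re z" for c z by simp
  ultimately have "Re (\<Sum>a<n. \<Sum>b<n. cnj (Y a b) * \<rho> a b) = (\<Sum>i<n. \<Sum>j<n. r i * Re (G j i * cnj (y j i)))"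
    by (simp only: Re_sum sum_distrib_left)
  then have T1: "Re (\<Sum>a<n. \<Sum>b<n. cnj (Y a b) * \<rho> a b) = (\<Sum>j<n. \<Sum>i<n. r i * Re (G j i * cnj (y j i)))"
    by (subst sum.swap)
  have cm: "cmod (\<Sum>a<n. cnj (Y a c) * w a j) = cmod (x j c)" for j c
  proof -
    have "(\<Sum>a<n. cnj (Y a c) * w a j) = cnj (x j c)" by (simp add: x_def)
    then show ?thesis by (simp only: complex_mod_cnj)
  qed
  have "Re (\<Sum>c<n. \<Sum>a<n. \<Sum>b<n. cnj (Y a c) * \<sigma> a b * Y b c) = (\<Sum>c<n. \<Sum>j<n. s j * (cmod (x j c))\<^sup>2)"
    by (simp only: spectral_rep_quadratic_form [OF sigma] cm Re_sum Re_complex_of_real)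
  also have "\<dots> = (\<Sum>j<n. s j * (\<Sum>c<n. (cmod (x j c))\<^sup>2))"
    by (subst sum.swap) (simp add: sum_distrib_left)
  finally have T2: "Re (\<Sum>c<n. \<Sum>a<n. \<Sum>b<n. cnj (Y a c) * \<sigma> a b * Y b c)
      = (\<Sum>j<n. \<Sum>i<n. s j * (cmod (y j i))\<^sup>2)"
    by (simp add: Px sum_distrib_left)
  have "(\<Sum>b<n. \<Sum>c<n. Y a b * \<rho> b c * cnj (Y a c)) = of_real (\<Sum>i<n. r i * (cmod (z a i))\<^sup>2)" for a
    using spectral_rep_quadratic_form [OF rho, of "\<lambda>b. cnj (Y a b)"] by (simp add: z_def)
  then have "Re (\<Sum>a<n. \<Sum>b<n. \<Sum>c<n. Y a b * \<rho> b c * cnj (Y a c)) = (\<Sum>a<n. \<Sum>i<n. r i * (cmod (z a i))\<^sup>2)"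
    by (simp only: Re_sum Re_complex_of_real)
  also have "\<dots> = (\<Sum>i<n. r i * (\<Sum>a<n. (cmod (z a i))\<^sup>2))"
    by (subst sum.swap) (simp add: sum_distrib_left)
  also have "\<dots> = (\<Sum>i<n. \<Sum>j<n. r i * (cmod (y j i))\<^sup>2)" by (simp add: Pz sum_distrib_left)
  also have "\<dots> = (\<Sum>j<n. \<Sum>i<n. r i * (cmod (y j i))\<^sup>2)" by (rule sum.swap)
  finally have T3: "Re (\<Sum>a<n. \<Sum>b<n. \<Sum>c<n. Y a b * \<rho> b c * cnj (Y a c))
      = (\<Sum>j<n. \<Sum>i<n. r i * (cmod (y j i))\<^sup>2)" .
  \<comment> \<open>In the coordinates \<open>y\<close> the form decouples into one completion of
    the square for each pair \<open>j\<close>, \<open>i\<close>, with coefficient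
    \<open>s j + t * r i\<close>.\<close>
  have "2 * (\<Sum>j<n. \<Sum>i<n. r i * Re (G j i * cnj (y j i))) - (\<Sum>j<n. \<Sum>i<n. s j * (cmod (y j i))\<^sup>2)
      - t * (\<Sum>j<n. \<Sum>i<n. r i * (cmod (y j i))\<^sup>2)
    = (\<Sum>j<n. \<Sum>i<n. 2 * (r i * Re (G j i * cnj (y j i))) - (s j + t * r i) * (cmod (y j i))\<^sup>2)"
    by (simp add: sum_distrib_left sum_subtractf sum.distrib algebra_simps del: times_complex.sel)
  also have "\<dots> \<le> (\<Sum>j<n. \<Sum>i<n. (cmod (G j i))\<^sup>2 * (r i)\<^sup>2 / (s j + t * r i))"
  proof (intro sum_mono)
    fix j i assume "j \<in> {..<n}" "i \<in> {..<n}"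
    then have "r i \<ge> 0" "s j + t * r i > 0" using r s t by (auto intro: add_pos_nonneg)
    then show "2 * (r i * Re (G j i * cnj (y j i))) - (s j + t * r i) * (cmod (y j i))\<^sup>2
        \<le> (cmod (G j i))\<^sup>2 * (r i)\<^sup>2 / (s j + t * r i)"
      by (rule complete_square_bound)
  qed
  finally show ?thesis unfolding T1 T2 T3 G_def .
qed

text \<open>The blocks of \<sigma> are diagonal, so the standard basis is an eigenbasis of the
  pinched \<sigma> with eigenvalues \<open>s'\<close>. The left-hand side is therefore the resolvent
  form of the pinched pair.\<close>

lemma resolvent_form_pinching:
  assumes rho: "spectral_rep n \<rho> u r" and r: "\<And>i. i < n \<Longrightarrow> r i \<ge> 0"
    and sigma: "spectral_rep n \<sigma> w s" and s: "\<And>j. j < n \<Longrightarrow> s j > 0" and t: "t \<ge> 0"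
    and rho': "spectral_rep n \<rho>' u' r'" and r': "\<And>i. i < n \<Longrightarrow> r' i \<ge> 0"
    and pinch: "\<And>a b. a < n \<Longrightarrow> b < n \<Longrightarrow> \<rho>' a b = (if blk a = blk b then \<rho> a b else 0)"
    and diag: "\<And>a b. a < n \<Longrightarrow> b < n \<Longrightarrow> blk a = blk b \<Longrightarrow> \<sigma> a b = (if a = b then of_real (s' a) else 0)"
    and s': "\<And>a. a < n \<Longrightarrow> s' a > 0"
  shows "(\<Sum>a<n. \<Sum>i<n. (cmod (u' a i))\<^sup>2 * (r' i)\<^sup>2 / (s' a + t * r' i))
    \<le> (\<Sum>j<n. \<Sum>i<n. (cmod (\<Sum>a<n. u a i * cnj (w a j)))\<^sup>2 * (r i)\<^sup>2 / (s j + t * r i))"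
proof -
  have u': "orthonormal_basis n u'" using rho' by (auto simp: spectral_rep_def)
  \<comment> \<open>\<open>X\<close> solves \<sigma>' X + t X \<rho>' = \<rho>', where \<sigma>' is
    the diagonal matrix of \<open>s'\<close>. This is the stationarity condition of the form for the
    pinched pair.\<close>
  define f where "f a i = r' i / (s' a + t * r' i)" for a i
  define X where "X a b = (\<Sum>i<n. of_real (f a i) * u' a i * cnj (u' b i))" for a b
  \<comment> \<open>The eigenvectors \<open>u'\<close> may mix blocks that share an eigenvalue, so
    the blocks of \<open>X\<close> are cut out explicitly. A block diagonal test matrix cannot tell
    \<rho> and \<sigma> from their pinchings.\<close>
  define Y where "Y a b = (if blk a = blk b then X a b else 0)" for a b
  have den: "s' a + t * r' i > 0" if "a < n" "i < n" for a i
    using s' [OF that(1)] r' [OF that(2)] t by (simp add: add_pos_nonneg)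
  have XR: "(\<Sum>b<n. X a b * \<rho>' b c) = (\<Sum>i<n. of_real (f a i * r' i) * u' a i * cnj (u' c i))"
    if ac: "a < n" "c < n" for a c
  proof -
    have "(\<Sum>b<n. X a b * \<rho>' b c) = (\<Sum>b<n. \<Sum>i<n. \<Sum>k<n.
        (of_real (f a i) * u' a i * (of_real (r' k) * cnj (u' c k))) * (cnj (u' b i) * u' b k))"
    proof (rule sum.cong [OF refl])
      fix b assume "b \<in> {..<n}"
      then have "\<rho>' b c = (\<Sum>k<n. of_real (r' k) * u' b k * cnj (u' c k))"
        using rho' ac by (simp add: spectral_rep_def)
      then show "X a b * \<rho>' b c = (\<Sum>i<n. \<Sum>k<n.
          (of_real (f a i) * u' a i * (of_real (r' k) * cnj (u' c k))) * (cnj (u' b i) * u' b k))"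
        unfolding X_def by (simp only: sum_product) (intro sum.cong refl, simp add: mult_ac)
    qed
    also have "\<dots> = (\<Sum>i<n. \<Sum>b<n. \<Sum>k<n.
        (of_real (f a i) * u' a i * (of_real (r' k) * cnj (u' c k))) * (cnj (u' b i) * u' b k))"
      by (rule sum.swap)
    also have "\<dots> = (\<Sum>i<n. \<Sum>k<n. \<Sum>b<n.
        (of_real (f a i) * u' a i * (of_real (r' k) * cnj (u' c k))) * (cnj (u' b i) * u' b k))"
      by (rule sum.cong [OF refl], rule sum.swap)
    also have "\<dots> = (\<Sum>i<n. \<Sum>k<n.
        (of_real (f a i) * u' a i * (of_real (r' k) * cnj (u' c k))) * (if i = k then 1 else 0))"
      by (intro sum.cong refl) (simp add: orthonormal_basis_cols [OF u'] flip: sum_distrib_left)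
    also have "\<dots> = (\<Sum>i<n. of_real (f a i * r' i) * u' a i * cnj (u' c i))"
      by (intro sum.cong refl) (simp add: mult_if_zero mult_ac)
    finally show ?thesis .
  qed
  have eq: "of_real (s' a) * X a c + of_real t * (\<Sum>b<n. X a b * \<rho>' b c) = \<rho>' a c"
    if ac: "a < n" "c < n" for a c
  proof -
    have "of_real (s' a) * X a c + of_real t * (\<Sum>b<n. X a b * \<rho>' b c)
        = (\<Sum>i<n. of_real (f a i * (s' a + t * r' i)) * u' a i * cnj (u' c i))"
      unfolding XR [OF ac] unfolding X_def sum_distrib_left sum.distrib [symmetric]
      by (intro sum.cong refl) (simp add: algebra_simps)
    also have "\<dots> = (\<Sum>i<n. of_real (r' i) * u' a i * cnj (u' c i))"
    proof (intro sum.cong refl)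
      fix i assume "i \<in> {..<n}"
      then have "f a i * (s' a + t * r' i) = r' i" using den [OF ac(1), of i] by (simp add: f_def)
      then show "of_real (f a i * (s' a + t * r' i)) * u' a i * cnj (u' c i)
          = of_real (r' i) * u' a i * cnj (u' c i)" by simp
    qed
    also have "\<dots> = \<rho>' a c" using rho' ac by (simp add: spectral_rep_def)
    finally show ?thesis .
  qed
  define T where "T = (\<Sum>a<n. \<Sum>b<n. cnj (Y a b) * \<rho> a b)"
  have T': "T = (\<Sum>a<n. \<Sum>b<n. cnj (Y a b) * \<rho>' a b)"
    unfolding T_def using pinch by (intro sum.cong refl) (auto simp: Y_def)
  have TX: "T = (\<Sum>a<n. \<Sum>b<n. cnj (X a b) * \<rho>' a b)"
    unfolding T_def using pinch by (intro sum.cong refl) (auto simp: Y_def)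
  have S2: "(\<Sum>c<n. \<Sum>a<n. \<Sum>b<n. cnj (Y a c) * \<sigma> a b * Y b c)
      = (\<Sum>a<n. \<Sum>c<n. cnj (Y a c) * (of_real (s' a) * X a c))"
  proof -
    have "(\<Sum>c<n. \<Sum>a<n. \<Sum>b<n. cnj (Y a c) * \<sigma> a b * Y b c)
        = (\<Sum>c<n. \<Sum>a<n. \<Sum>b<n. if b = a then cnj (Y a c) * (of_real (s' a) * X a c) else 0)"
    proof (intro sum.cong refl)
      fix a b c assume "a \<in> {..<n}" "b \<in> {..<n}" "c \<in> {..<n}"
      then show "cnj (Y a c) * \<sigma> a b * Y b c = (if b = a then cnj (Y a c) * (of_real (s' a) * X a c) else 0)"
        using diag [of a b] by (auto simp: Y_def)
    qed
    also have "\<dots> = (\<Sum>c<n. \<Sum>a<n. cnj (Y a c) * (of_real (s' a) * X a c))"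
      by (intro sum.cong refl) simp
    also have "\<dots> = (\<Sum>a<n. \<Sum>c<n. cnj (Y a c) * (of_real (s' a) * X a c))" by (rule sum.swap)
    finally show ?thesis .
  qed
  have S3: "(\<Sum>a<n. \<Sum>b<n. \<Sum>c<n. Y a b * \<rho> b c * cnj (Y a c))
      = (\<Sum>a<n. \<Sum>c<n. cnj (Y a c) * (\<Sum>b<n. X a b * \<rho>' b c))"
  proof -
    have "(\<Sum>a<n. \<Sum>b<n. \<Sum>c<n. Y a b * \<rho> b c * cnj (Y a c))
        = (\<Sum>a<n. \<Sum>b<n. \<Sum>c<n. cnj (Y a c) * (X a b * \<rho>' b c))"
      using pinch by (intro sum.cong refl) (auto simp: Y_def)
    also have "\<dots> = (\<Sum>a<n. \<Sum>c<n. \<Sum>b<n. cnj (Y a c) * (X a b * \<rho>' b c))"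
      by (rule sum.cong [OF refl], rule sum.swap)
    finally show ?thesis by (simp add: sum_distrib_left)
  qed
  have "(\<Sum>c<n. \<Sum>a<n. \<Sum>b<n. cnj (Y a c) * \<sigma> a b * Y b c)
      + of_real t * (\<Sum>a<n. \<Sum>b<n. \<Sum>c<n. Y a b * \<rho> b c * cnj (Y a c))
    = (\<Sum>a<n. \<Sum>c<n. cnj (Y a c) * (of_real (s' a) * X a c + of_real t * (\<Sum>b<n. X a b * \<rho>' b c)))"
    unfolding S2 S3 distrib_left sum.distrib
    by (simp add: sum_distrib_left mult.left_commute)
  also have "\<dots> = T" unfolding T' by (intro sum.cong refl) (simp add: eq)
  finally have sum_T: "(\<Sum>c<n. \<Sum>a<n. \<Sum>b<n. cnj (Y a c) * \<sigma> a b * Y b c)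
      + of_real t * (\<Sum>a<n. \<Sum>b<n. \<Sum>c<n. Y a b * \<rho> b c * cnj (Y a c)) = T" .
  have Re_add: "Re (x + of_real t * y) = Re x + t * Re y" for x y by simp
  have "Re (\<Sum>c<n. \<Sum>a<n. \<Sum>b<n. cnj (Y a c) * \<sigma> a b * Y b c)
      + t * Re (\<Sum>a<n. \<Sum>b<n. \<Sum>c<n. Y a b * \<rho> b c * cnj (Y a c)) = Re T"
    unfolding Re_add [symmetric] sum_T ..
  \<comment> \<open>At the stationary point the quadratic part equals the linear part, so twice the
    linear part minus the quadratic part is \<open>Re T\<close> itself.\<close>
  then have "Re T \<le> (\<Sum>j<n. \<Sum>i<n. (cmod (\<Sum>a<n. u a i * cnj (w a j)))\<^sup>2 * (r i)\<^sup>2 / (s j + t * r i))"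
    using resolvent_form_upper [OF rho r sigma s t, of Y] unfolding T_def by linarith
  moreover have "T = of_real (\<Sum>a<n. \<Sum>i<n. (cmod (u' a i))\<^sup>2 * (r' i)\<^sup>2 / (s' a + t * r' i))"
  proof -
    have "T = (\<Sum>a<n. cnj (\<Sum>b<n. X a b * \<rho>' b a))"
      unfolding TX cnj_sum
    proof (intro sum.cong refl)
      fix a b assume "a \<in> {..<n}" "b \<in> {..<n}"
      then have "\<rho>' a b = cnj (\<rho>' b a)" using rho' by (simp add: spectral_rep_def mult_ac)
      then show "cnj (X a b) * \<rho>' a b = cnj (X a b * \<rho>' b a)" by simp
    qed
    also have "\<dots> = (\<Sum>a<n. cnj (of_real (\<Sum>i<n. (cmod (u' a i))\<^sup>2 * (r' i)\<^sup>2 / (s' a + t * r' i))))"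
    proof (intro sum.cong refl arg_cong [where f = cnj])
      fix a assume a: "a \<in> {..<n}"
      have "(\<Sum>b<n. X a b * \<rho>' b a) = (\<Sum>i<n. of_real (f a i * r' i) * (u' a i * cnj (u' a i)))"
        using XR [of a a] a by (simp add: mult_ac)
      also have "\<dots> = (\<Sum>i<n. of_real (f a i * r' i * (cmod (u' a i))\<^sup>2))"
        by (simp only: complex_norm_square of_real_mult)
      also have "\<dots> = of_real (\<Sum>i<n. (cmod (u' a i))\<^sup>2 * (r' i)\<^sup>2 / (s' a + t * r' i))"
        by (simp add: f_def power2_eq_square mult_ac)
      finally show "(\<Sum>b<n. X a b * \<rho>' b a) = of_real (\<Sum>i<n. (cmod (u' a i))\<^sup>2 * (r' i)\<^sup>2 / (s' a + t * r' i))" .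
    qed
    finally show ?thesis by simp
  qed
  ultimately show ?thesis by simp
qed

text \<open>Subtracting ln T removes the divergence of the logarithm. For r = 0 the argument does
  not grow with T, but the factor r makes both sides vanish.\<close>

lemma tendsto_weighted_ln:
  assumes "r \<ge> (0 :: real)" "s > 0"
  shows "((\<lambda>T. r * (ln (s + T * r) - ln T)) \<longlongrightarrow> r * ln r) at_top"
proof (cases "r = 0")
  case False
  then have "r > 0" using assms by simp
  have "((\<lambda>T. ln (s + T * r) - ln T) \<longlongrightarrow> ln r) at_top" using \<open>r > 0\<close> \<open>s > 0\<close> by real_asymp
  then show ?thesis by (intro tendsto_mult tendsto_const)
qed simp

lemma eta_conv_ln: "r \<ge> 0 \<Longrightarrow> r * ln r = - ln 2 * eta r"
  by (cases "r = 0") (auto simp: eta_def log_def)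

text \<open>This is \<open>D(\<rho> || \<sigma>) \<ge> D(\<rho>' || \<sigma>')\<close> for the pinched states. With \<open>Q t\<close> the resolvent form,
  \<open>D(\<rho> || \<sigma>)\<close> is the integral of \<open>Q t - tr \<rho> / (1 + t)\<close> over \<open>t \<ge> 0\<close>; the truncated integral is
  \<open>\<Phi> T - \<Phi> 0\<close> in the proof.\<close>
theorem pinching_relative_entropy:
  assumes rho: "spectral_rep n \<rho> u r" and r: "\<And>i. i < n \<Longrightarrow> r i \<ge> 0"
    and sigma: "spectral_rep n \<sigma> w s" and s: "\<And>j. j < n \<Longrightarrow> s j > 0"
    and rho': "spectral_rep n \<rho>' u' r'" and r': "\<And>i. i < n \<Longrightarrow> r' i \<ge> 0"
    and pinch: "\<And>a b. a < n \<Longrightarrow> b < n \<Longrightarrow> \<rho>' a b = (if blk a = blk b then \<rho> a b else 0)"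
    and diag: "\<And>a b. a < n \<Longrightarrow> b < n \<Longrightarrow> blk a = blk b \<Longrightarrow> \<sigma> a b = (if a = b then of_real (s' a) else 0)"
    and s': "\<And>a. a < n \<Longrightarrow> s' a > 0"
  shows "(\<Sum>j<n. Re (\<Sum>a<n. \<Sum>b<n. cnj (w a j) * \<rho> a b * w b j) * log 2 (s j))
       - (\<Sum>a<n. Re (\<rho> a a) * log 2 (s' a))
     \<le> (\<Sum>i<n. eta (r' i)) - (\<Sum>i<n. eta (r i))"
proof -
  have u: "orthonormal_basis n u" and u': "orthonormal_basis n u'" and w: "orthonormal_basis n w"
    using rho rho' sigma by (auto simp: spectral_rep_def)
  \<comment> \<open>\<open>g\<close> holds the squared overlaps of the eigenbases of \<rho> and
    \<sigma>, and \<open>g'\<close> those of the eigenbasis of \<rho>' with the standard basis.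
    Their sums over the first index are 1.\<close>
  define g where "g j i = (cmod (\<Sum>a<n. u a i * cnj (w a j)))\<^sup>2" for i j
  define g' where "g' a i = (cmod (u' a i))\<^sup>2" for a i
  define \<mu> where "\<mu> j = (\<Sum>i<n. r i * g j i)" for j
  define d where "d a = (\<Sum>i<n. r' i * g' a i)" for a
  have g1: "(\<Sum>j<n. g j i) = 1" if "i < n" for i
    unfolding g_def parseval_norm [OF orthonormal_basis_cnj [OF w]]
    using orthonormal_basis_norm_cols [OF u that] .
  have g'1: "(\<Sum>a<n. g' a i) = 1" if "i < n" for i
    unfolding g'_def using orthonormal_basis_norm_cols [OF u' that] .
  have mu: "Re (\<Sum>a<n. \<Sum>b<n. cnj (w a j) * \<rho> a b * w b j) = \<mu> j" for j
    unfolding spectral_rep_quadratic_form [OF rho] \<mu>_def g_def by (simp add: mult.commute)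
  have d: "Re (\<rho> a a) = d a" if "a < n" for a
    using spectral_rep_diag [OF rho' that] pinch [OF that that] by (simp add: d_def g'_def)
  have tr: "(\<Sum>i<n. r i) = (\<Sum>i<n. r' i)"
    using spectral_rep_trace [OF rho] spectral_rep_trace [OF rho'] pinch by simp
  \<comment> \<open>An antiderivative of the difference of the two resolvent forms: the derivative
    of r ln (s + T r) in T is r^2 / (s + T r).\<close>
  define \<Phi> where "\<Phi> T = (\<Sum>j<n. \<Sum>i<n. g j i * (r i * ln (s j + T * r i)))
      - (\<Sum>a<n. \<Sum>i<n. g' a i * (r' i * ln (s' a + T * r' i)))" for T
  have mono: "\<Phi> 0 \<le> \<Phi> T" if T: "T \<ge> 0" for T
  proof (rule DERIV_nonneg_imp_nondecreasing [OF T])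
    fix t :: real assume t: "0 \<le> t" "t \<le> T"
    have p: "s j + t * r i > 0" if "j < n" "i < n" for i j
      using s [OF that(1)] r [OF that(2)] t by (simp add: add_pos_nonneg)
    have p': "s' j + t * r' i > 0" if "j < n" "i < n" for i j
      using s' [OF that(1)] r' [OF that(2)] t by (simp add: add_pos_nonneg)
    have ln_deriv: "((\<lambda>T. ln (c + T * q)) has_real_derivative q / (c + t * q)) (at t)"
      if "c + t * q > 0" for c q
      using that by (auto intro!: derivative_eq_intros)
    have "(\<Phi> has_real_derivative
        (\<Sum>j<n. \<Sum>i<n. g j i * (r i * (r i / (s j + t * r i))))
        - (\<Sum>a<n. \<Sum>i<n. g' a i * (r' i * (r' i / (s' a + t * r' i))))) (at t)"
      unfolding \<Phi>_def using p p'
      by (intro DERIV_diff DERIV_sum DERIV_cmult ln_deriv) auto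
    moreover have "(\<Sum>a<n. \<Sum>i<n. g' a i * (r' i * (r' i / (s' a + t * r' i))))
        \<le> (\<Sum>j<n. \<Sum>i<n. g j i * (r i * (r i / (s j + t * r i))))"
    proof -
      have "(\<Sum>a<n. \<Sum>i<n. g' a i * (r' i)\<^sup>2 / (s' a + t * r' i))
          \<le> (\<Sum>j<n. \<Sum>i<n. g j i * (r i)\<^sup>2 / (s j + t * r i))"
        unfolding g_def g'_def
        by (rule resolvent_form_pinching [where blk = blk, OF rho r sigma s t(1) rho' r' pinch diag s'])
      then show ?thesis by (simp add: power2_eq_square)
    qed
    ultimately show "\<exists>y. (\<Phi> has_real_derivative y) (at t) \<and> y \<ge> 0"
      by (intro exI conjI) auto
  qed
  have Phi0: "\<Phi> 0 = (\<Sum>j<n. \<mu> j * ln (s j)) - (\<Sum>a<n. d a * ln (s' a))"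
    by (simp add: \<Phi>_def \<mu>_def d_def sum_distrib_left sum_distrib_right mult_ac)
  have norm_sum: "(\<Sum>j<n. \<Sum>i<n. g j i * (r i * c)) = (\<Sum>i<n. r i) * c" for c
  proof -
    have "(\<Sum>j<n. \<Sum>i<n. g j i * (r i * c)) = (\<Sum>i<n. (\<Sum>j<n. g j i) * (r i * c))"
      by (subst sum.swap) (simp add: sum_distrib_right)
    then show ?thesis using g1 by (simp add: sum_distrib_right)
  qed
  have norm_sum': "(\<Sum>j<n. \<Sum>i<n. g' j i * (r' i * c)) = (\<Sum>i<n. r' i) * c" for c
  proof -
    have "(\<Sum>j<n. \<Sum>i<n. g' j i * (r' i * c)) = (\<Sum>i<n. (\<Sum>j<n. g' j i) * (r' i * c))"
      by (subst sum.swap) (simp add: sum_distrib_right)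
    then show ?thesis using g'1 by (simp add: sum_distrib_right)
  qed
  \<comment> \<open>Both double sums have the same total mass, namely the common trace. Hence ln T
    may be subtracted from every logarithm without changing the difference, and each term acquires a
    finite limit.\<close>
  define \<Psi> where "\<Psi> T = (\<Sum>j<n. \<Sum>i<n. g j i * (r i * (ln (s j + T * r i) - ln T)))
      - (\<Sum>a<n. \<Sum>i<n. g' a i * (r' i * (ln (s' a + T * r' i) - ln T)))" for T
  have "\<Psi> T = \<Phi> T" for T
    unfolding \<Psi>_def \<Phi>_def right_diff_distrib sum_subtractf norm_sum norm_sum' tr by simp
  then have Phi_eq: "\<Phi> = \<Psi>" by auto
  have "(\<Psi> \<longlongrightarrow> (\<Sum>j<n. \<Sum>i<n. g j i * (r i * ln (r i))) - (\<Sum>a<n. \<Sum>i<n. g' a i * (r' i * ln (r' i)))) at_top"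
    unfolding \<Psi>_def
    by (intro tendsto_diff tendsto_sum tendsto_mult_left [OF tendsto_weighted_ln]) (auto intro: r r' s s')
  then have lim: "\<Phi> 0 \<le> (\<Sum>j<n. \<Sum>i<n. g j i * (r i * ln (r i))) - (\<Sum>a<n. \<Sum>i<n. g' a i * (r' i * ln (r' i)))"
    unfolding Phi_eq [symmetric]
  proof (rule tendsto_lowerbound)
    show "\<forall>\<^sub>F T in at_top. \<Phi> 0 \<le> \<Phi> T"
      using eventually_ge_at_top [of 0] by eventually_elim (rule mono)
  qed simp
  have "(\<Sum>j<n. \<Sum>i<n. g j i * (r i * ln (r i))) = (\<Sum>i<n. (\<Sum>j<n. g j i) * (r i * ln (r i)))"
    by (subst sum.swap) (simp add: sum_distrib_right)
  also have "\<dots> = - ln 2 * (\<Sum>i<n. eta (r i))"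
    using g1 r by (simp add: eta_conv_ln sum_distrib_left)
  finally have e1: "(\<Sum>j<n. \<Sum>i<n. g j i * (r i * ln (r i))) = - ln 2 * (\<Sum>i<n. eta (r i))" .
  have "(\<Sum>j<n. \<Sum>i<n. g' j i * (r' i * ln (r' i))) = (\<Sum>i<n. (\<Sum>j<n. g' j i) * (r' i * ln (r' i)))"
    by (subst sum.swap) (simp add: sum_distrib_right)
  also have "\<dots> = - ln 2 * (\<Sum>i<n. eta (r' i))"
    using g'1 r' by (simp add: eta_conv_ln sum_distrib_left)
  finally have e2: "(\<Sum>j<n. \<Sum>i<n. g' j i * (r' i * ln (r' i))) = - ln 2 * (\<Sum>i<n. eta (r' i))" .
  have "(\<Sum>j<n. \<mu> j * ln (s j)) - (\<Sum>a<n. d a * ln (s' a)) \<le> ((\<Sum>i<n. eta (r' i)) - (\<Sum>i<n. eta (r i))) * ln 2"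
    using lim unfolding Phi0 e1 e2 by (simp add: algebra_simps)
  then have "((\<Sum>j<n. \<mu> j * ln (s j)) - (\<Sum>a<n. d a * ln (s' a))) / ln 2 \<le> (\<Sum>i<n. eta (r' i)) - (\<Sum>i<n. eta (r i))"
    by (simp add: pos_divide_le_eq)
  moreover have "(\<Sum>a<n. Re (\<rho> a a) * log 2 (s' a)) = (\<Sum>a<n. d a * log 2 (s' a))"
    using d by simp
  ultimately show ?thesis
    unfolding mu by (simp add: log_def diff_divide_distrib sum_divide_distrib)
qed

section \<open>The Choi state of a channel\<close>

lemma sum_lessThan_2: "(\<Sum>a<2. f a) = f 0 + f (1 :: nat)" for f :: "nat \<Rightarrow> 'a :: comm_monoid_add"
  by (simp add: numeral_2_eq_2)

lemma sum_lessThan_3: "(\<Sum>a<3. f a) = f 0 + f 1 + f (2 :: nat)"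
  for f :: "nat \<Rightarrow> 'a :: comm_monoid_add"
  by (simp add: eval_nat_numeral add.assoc)

lemma sum_lessThan_4: "(\<Sum>a<4. f a) = f 0 + f 1 + f 2 + f (3 :: nat)"
  for f :: "nat \<Rightarrow> 'a :: comm_monoid_add"
  by (simp add: eval_nat_numeral add.assoc)

text \<open>The two products of \<open>V\<close> with its adjoint have equal entropy, so the one of
  size \<open>m\<close> is handled through the Gram matrix of size \<open>n\<close>. Its eigenvalues
  are squared lengths of images under \<open>V\<close>, hence nonnegative.\<close>

lemma gram_spectral_rep:
  fixes V :: "complex mat"
  assumes V: "V \<in> carrier_mat m n"
  obtains u r where "spectral_rep n (\<lambda>a b. (mat_adjoint V * V) $$ (a, b)) u r"
    "\<And>i. i < n \<Longrightarrow> r i \<ge> 0" "vn_entropy (V * mat_adjoint V) = (\<Sum>i<n. eta (r i))"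
proof -
  let ?A = "mat_adjoint V * V"
  have A: "?A \<in> carrier_mat n n" using V by (metis mat_adjoint_carrier mult_carrier_mat)
  have "mat_adjoint ?A = ?A"
    using mat_adjoint_mult [OF mat_adjoint_carrier [OF V] V] by (simp add: mat_adjoint_adjoint)
  then obtain u r where rep: "spectral_rep n (\<lambda>a b. ?A $$ (a, b)) u r"
    and vn: "vn_entropy ?A = (\<Sum>i<n. eta (r i))"
    using hermitian_spectral_rep [OF A] by blast
  have "r i \<ge> 0" if i: "i < n" for i
  proof -
    have "of_real (r i) = (\<Sum>a<n. \<Sum>b<n. cnj (u a i) * ?A $$ (a, b) * u b i)"
      using spectral_rep_eigenvalue [OF rep i] by simp
    also have "\<dots> = (\<Sum>a<n. \<Sum>b<n. \<Sum>k<m. cnj (V $$ (k, a) * u a i) * (V $$ (k, b) * u b i))"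
    proof (intro sum.cong refl)
      fix a b assume "a \<in> {..<n}" "b \<in> {..<n}"
      then have "?A $$ (a, b) = (\<Sum>k<m. cnj (V $$ (k, a)) * V $$ (k, b))"
        using V by (simp add: scalar_prod_def atLeast0LessThan)
      then show "cnj (u a i) * ?A $$ (a, b) * u b i
          = (\<Sum>k<m. cnj (V $$ (k, a) * u a i) * (V $$ (k, b) * u b i))"
        by (simp add: sum_distrib_left sum_distrib_right mult_ac)
    qed
    also have "\<dots> = (\<Sum>a<n. \<Sum>k<m. \<Sum>b<n. cnj (V $$ (k, a) * u a i) * (V $$ (k, b) * u b i))"
      by (rule sum.cong [OF refl], rule sum.swap)
    also have "\<dots> = (\<Sum>k<m. \<Sum>a<n. \<Sum>b<n. cnj (V $$ (k, a) * u a i) * (V $$ (k, b) * u b i))"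
      by (rule sum.swap)
    also have "\<dots> = (\<Sum>k<m. cnj (\<Sum>a<n. V $$ (k, a) * u a i) * (\<Sum>b<n. V $$ (k, b) * u b i))"
      unfolding cnj_sum sum_product ..
    also have "\<dots> = of_real (\<Sum>k<m. (cmod (\<Sum>a<n. V $$ (k, a) * u a i))\<^sup>2)"
      by (simp only: of_real_sum complex_norm_square mult.commute)
    finally have "r i = (\<Sum>k<m. (cmod (\<Sum>a<n. V $$ (k, a) * u a i))\<^sup>2)"
      by (simp only: of_real_eq_iff)
    then show ?thesis by (simp add: sum_nonneg)
  qed
  moreover have "vn_entropy (V * mat_adjoint V) = (\<Sum>i<n. eta (r i))"
    using vn vn_entropy_mult_swap [OF V mat_adjoint_carrier [OF V]] by simp
  ultimately show ?thesis using that rep by blast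
qed

section \<open>Choi matrices and the entropies of the environment\<close>

definition kraus_vec :: "complex mat \<Rightarrow> nat \<Rightarrow> complex" where
  "kraus_vec K a = K $$ (a mod 2, a div 2)"

text \<open>The complex conjugate of the Choi state; index \<open>2 * x + b\<close> stands for input \<open>x\<close> and output \<open>b\<close>.\<close>
definition choi :: "complex mat list \<Rightarrow> nat \<Rightarrow> nat \<Rightarrow> complex" where
  "choi Ks a b = (\<Sum>i<length Ks. cnj (kraus_vec (Ks ! i) a) * kraus_vec (Ks ! i) b) / 2"

text \<open>\<open>a div 2\<close> is the input label, so this is the pinching \<Delta> of the Choi
  state. It shares its nonzero spectrum with \<open>rho_XE\<close>.\<close>

definition pinched_choi :: "complex mat list \<Rightarrow> nat \<Rightarrow> nat \<Rightarrow> complex" where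
  "pinched_choi Ks a b = (if a div 2 = b div 2 then choi Ks a b else 0)"

lemma msum_map_carrier [simp]:
  assumes "\<And>K. K \<in> set Ks \<Longrightarrow> f K \<in> carrier_mat n n"
  shows "msum n (map f Ks) \<in> carrier_mat n n"
  using assms by (induction Ks) (auto simp: msum_def)

lemma index_msum_map:
  assumes "\<And>K. K \<in> set Ks \<Longrightarrow> f K \<in> carrier_mat n n" "i < n" "j < n"
  shows "msum n (map f Ks) $$ (i, j) = (\<Sum>k<length Ks. f (Ks ! k) $$ (i, j))"
  using assms(1)
proof (induction Ks)
  case Nil
  then show ?case using assms by (simp add: msum_def)
next
  case (Cons K Ks)
  have "msum n (map f (K # Ks)) = f K + msum n (map f Ks)" by (simp add: msum_def)
  moreover have "msum n (map f Ks) \<in> carrier_mat n n" using Cons.prems by simp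
  ultimately have "msum n (map f (K # Ks)) $$ (i, j) = f K $$ (i, j) + msum n (map f Ks) $$ (i, j)"
    using assms by simp
  then show ?case using Cons by (simp add: sum.lessThan_Suc_shift del: sum.lessThan_Suc)
qed

lemma index_mult_mat_2:
  assumes "A \<in> carrier_mat 2 2" "B \<in> carrier_mat 2 2" "i < 2" "j < 2"
  shows "(A * B) $$ (i, j) = A $$ (i, 0) * B $$ (0, j) + A $$ (i, 1) * B $$ (1, j)"
  using assms by (simp add: scalar_prod_def atLeast0LessThan sum_lessThan_2)

lemma index_kraus_conj:
  assumes K: "K \<in> carrier_mat 2 2" "L \<in> carrier_mat 2 2" and \<rho>: "\<rho> \<in> carrier_mat 2 2"
    and ij: "i < 2" "j < 2"
  shows "(K * \<rho> * mat_adjoint L) $$ (i, j)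
    = (\<Sum>x<2. \<Sum>y<2. \<rho> $$ (x, y) * (cnj (L $$ (j, y)) * K $$ (i, x)))"
proof -
  have "K * \<rho> \<in> carrier_mat 2 2" using K \<rho> by (intro mult_carrier_mat)
  then have "(K * \<rho> * mat_adjoint L) $$ (i, j)
      = (K * \<rho>) $$ (i, 0) * mat_adjoint L $$ (0, j) + (K * \<rho>) $$ (i, 1) * mat_adjoint L $$ (1, j)"
    by (rule index_mult_mat_2 [OF _ mat_adjoint_carrier [OF K(2)] ij])
  moreover have "(K * \<rho>) $$ (i, x) = K $$ (i, 0) * \<rho> $$ (0, x) + K $$ (i, 1) * \<rho> $$ (1, x)" if "x < 2" for x
    by (rule index_mult_mat_2 [OF K(1) \<rho> ij(1) that])
  ultimately show ?thesis
    using K ij by (simp add: sum_lessThan_2 algebra_simps del: index_mult_mat)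
qed

lemma kraus_conj_carrier:
  fixes K :: "complex mat"
  assumes "K \<in> carrier_mat 2 2" "\<rho> \<in> carrier_mat 2 2"
  shows "K * \<rho> * mat_adjoint K \<in> carrier_mat 2 2"
  by (rule mult_carrier_mat [OF mult_carrier_mat [OF assms] mat_adjoint_carrier [OF assms(1)]])

text \<open>The output index pair appears in reversed order because \<open>choi\<close> is the
  conjugate of the Choi state; the factor 2 undoes its normalization.\<close>

lemma index_chan_apply:
  assumes Ks: "\<forall>K\<in>set Ks. K \<in> carrier_mat 2 2" and \<rho>: "\<rho> \<in> carrier_mat 2 2" and ij: "i < 2" "j < 2"
  shows "chan_apply Ks \<rho> $$ (i, j) = (\<Sum>x<2. \<Sum>y<2. \<rho> $$ (x, y) * (2 * choi Ks (2 * y + j) (2 * x + i)))"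
proof -
  have c: "K * \<rho> * mat_adjoint K \<in> carrier_mat 2 2" if "K \<in> set Ks" for K
    using Ks \<rho> that by (intro kraus_conj_carrier) auto
  have "chan_apply Ks \<rho> $$ (i, j) = (\<Sum>k<length Ks. (Ks ! k * \<rho> * mat_adjoint (Ks ! k)) $$ (i, j))"
    unfolding chan_apply_def by (rule index_msum_map [OF c ij])
  also have "\<dots> = (\<Sum>k<length Ks. \<Sum>x<2. \<Sum>y<2. \<rho> $$ (x, y) * (cnj ((Ks ! k) $$ (j, y)) * (Ks ! k) $$ (i, x)))"
    using Ks \<rho> ij by (intro sum.cong refl index_kraus_conj) auto
  also have "\<dots> = (\<Sum>x<2. \<Sum>y<2. \<Sum>k<length Ks. \<rho> $$ (x, y) * (cnj ((Ks ! k) $$ (j, y)) * (Ks ! k) $$ (i, x)))"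
    by (subst sum.swap, rule sum.cong [OF refl], rule sum.swap)
  also have "\<dots> = (\<Sum>x<2. \<Sum>y<2. \<rho> $$ (x, y) * (2 * choi Ks (2 * y + j) (2 * x + i)))"
    using ij by (simp add: choi_def kraus_vec_def flip: sum_distrib_left)
  finally show ?thesis .
qed

lemma chan_apply_carrier:
  assumes "\<forall>K\<in>set Ks. K \<in> carrier_mat 2 2" "\<rho> \<in> carrier_mat 2 2"
  shows "chan_apply Ks \<rho> \<in> carrier_mat 2 2"
  unfolding chan_apply_def using assms by (intro msum_map_carrier kraus_conj_carrier) auto

lemma index_kraus_normalization:
  assumes Ks: "\<forall>K\<in>set Ks. K \<in> carrier_mat 2 2" and xy: "x < 2" "y < 2"
  shows "msum 2 (map (\<lambda>K. mat_adjoint K * K) Ks) $$ (x, y)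
    = 2 * (choi Ks (2 * x) (2 * y) + choi Ks (2 * x + 1) (2 * y + 1))"
proof -
  have "msum 2 (map (\<lambda>K. mat_adjoint K * K) Ks) $$ (x, y)
      = (\<Sum>k<length Ks. (mat_adjoint (Ks ! k) * (Ks ! k)) $$ (x, y))"
    using Ks xy by (intro index_msum_map mult_carrier_mat [OF mat_adjoint_carrier]) auto
  also have "\<dots> = (\<Sum>k<length Ks. cnj (kraus_vec (Ks ! k) (2 * x)) * kraus_vec (Ks ! k) (2 * y)
      + cnj (kraus_vec (Ks ! k) (2 * x + 1)) * kraus_vec (Ks ! k) (2 * y + 1))"
  proof (rule sum.cong [OF refl])
    fix k assume "k \<in> {..<length Ks}"
    then have "Ks ! k \<in> carrier_mat 2 2" using Ks by auto
    then show "(mat_adjoint (Ks ! k) * (Ks ! k)) $$ (x, y)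
      = cnj (kraus_vec (Ks ! k) (2 * x)) * kraus_vec (Ks ! k) (2 * y)
      + cnj (kraus_vec (Ks ! k) (2 * x + 1)) * kraus_vec (Ks ! k) (2 * y + 1)"
      using xy index_mult_mat_2 [of "mat_adjoint (Ks ! k)" "Ks ! k" x y] by (simp add: kraus_vec_def)
  qed
  finally show ?thesis by (simp add: choi_def sum.distrib flip: add_divide_distrib)
qed

text \<open>The Kraus normalization says that the partial trace over the output is maximally
  mixed.\<close>

lemma choi_trace_preserving:
  assumes "qubit_channel Ks" "x < 2" "y < 2"
  shows "choi Ks (2 * x) (2 * y) + choi Ks (2 * x + 1) (2 * y + 1) = (if x = y then 1 / 2 else 0)"
proof -
  have halve: "2 * z = (if P then 1 else 0) \<Longrightarrow> z = (if P then 1 / 2 else 0)" for z :: complex and P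
    by (auto simp: field_simps split: if_splits)
  show ?thesis
    by (rule halve, subst index_kraus_normalization [symmetric]) (use assms in \<open>auto simp: qubit_channel_def\<close>)
qed

lemma index_chan_env_zproj:
  assumes Ks: "\<forall>K\<in>set Ks. K \<in> carrier_mat 2 2" and ij: "i < length Ks" "j < length Ks" and x: "x < 2"
  shows "chan_env Ks (zproj x) $$ (i, j)
    = (\<Sum>b<2. kraus_vec (Ks ! i) (2 * x + b) * cnj (kraus_vec (Ks ! j) (2 * x + b)))"
proof -
  have K: "Ks ! i \<in> carrier_mat 2 2" "Ks ! j \<in> carrier_mat 2 2" using Ks ij by auto
  have z: "zproj x \<in> carrier_mat 2 2" by (simp add: zproj_def)
  have "chan_env Ks (zproj x) $$ (i, j) = (\<Sum>b<2. (Ks ! i * zproj x * mat_adjoint (Ks ! j)) $$ (b, b))"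
    using ij K z by (simp add: chan_env_def mtrace_def)
  also have "\<dots> = (\<Sum>b<2. kraus_vec (Ks ! i) (2 * x + b) * cnj (kraus_vec (Ks ! j) (2 * x + b)))"
  proof (rule sum.cong [OF refl])
    fix b :: nat assume "b \<in> {..<2}"
    then have b: "b < 2" by simp
    have "(Ks ! i * zproj x * mat_adjoint (Ks ! j)) $$ (b, b)
        = (\<Sum>y<2. \<Sum>y'<2. zproj x $$ (y, y') * (cnj (Ks ! j $$ (b, y')) * Ks ! i $$ (b, y)))"
      by (rule index_kraus_conj [OF K z b b])
    also have "\<dots> = cnj (Ks ! j $$ (b, x)) * Ks ! i $$ (b, x)"
      using x by (auto simp: sum_lessThan_2 zproj_def less_2_cases_iff)
    finally show "(Ks ! i * zproj x * mat_adjoint (Ks ! j)) $$ (b, b)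
        = kraus_vec (Ks ! i) (2 * x + b) * cnj (kraus_vec (Ks ! j) (2 * x + b))"
      using b by (simp add: kraus_vec_def mult.commute)
  qed
  finally show ?thesis .
qed

lemma of_real_sqrt2_sq: "complex_of_real (sqrt 2) * complex_of_real (sqrt 2) = 2"
  by (simp flip: of_real_mult)

lemma rho_E_carrier: "rho_E Ks \<in> carrier_mat (length Ks) (length Ks)"
  by (simp add: rho_E_def chan_env_def)

lemma index_rho_E:
  assumes Ks: "\<forall>K\<in>set Ks. K \<in> carrier_mat 2 2" and ij: "i < length Ks" "j < length Ks"
  shows "rho_E Ks $$ (i, j) = (\<Sum>a<4. kraus_vec (Ks ! i) a * cnj (kraus_vec (Ks ! j) a) / 2)"
proof -
  have d: "dim_row (chan_env Ks M) = length Ks" "dim_col (chan_env Ks M) = length Ks" for M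
    by (auto simp: chan_env_def)
  show ?thesis
    unfolding rho_E_def using ij
    by (simp add: d index_chan_env_zproj [OF Ks] sum_lessThan_2 sum_lessThan_4 add_divide_distrib
        flip: numeral_2_eq_2 numeral_3_eq_3)
qed

text \<open>The rows of \<open>V\<close> are the Kraus vectors divided by sqrt 2. Its two products
  with its adjoint are the Choi state and \<open>rho_E\<close>, so an environment of any dimension
  is reduced to a matrix of size 4.\<close>

lemma rho_E_spectral_rep:
  assumes Ks: "\<forall>K\<in>set Ks. K \<in> carrier_mat 2 2"
  obtains u r where "spectral_rep 4 (choi Ks) u r" "\<And>i. i < 4 \<Longrightarrow> r i \<ge> 0"
    "vn_entropy (rho_E Ks) = (\<Sum>i<4. eta (r i))"
proof -
  define V where "V = mat (length Ks) 4 (\<lambda>(i, a). kraus_vec (Ks ! i) a / of_real (sqrt 2))"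
  have V: "V \<in> carrier_mat (length Ks) 4" by (simp add: V_def)
  have "(mat_adjoint V * V) $$ (a, b) = choi Ks a b" if "a < 4" "b < 4" for a b
    using that V by (simp add: V_def scalar_prod_def atLeast0LessThan choi_def sum_divide_distrib of_real_sqrt2_sq)
  moreover have "V * mat_adjoint V = rho_E Ks"
  proof (rule eq_matI)
    fix i j assume "i < dim_row (rho_E Ks)" "j < dim_col (rho_E Ks)"
    then have ij: "i < length Ks" "j < length Ks" using rho_E_carrier [of Ks] by auto
    then show "(V * mat_adjoint V) $$ (i, j) = rho_E Ks $$ (i, j)"
      by (simp add: V_def scalar_prod_def atLeast0LessThan of_real_sqrt2_sq index_rho_E [OF Ks])
  qed (use rho_E_carrier [of Ks] in \<open>auto simp: V_def\<close>)
  ultimately show ?thesis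
    using gram_spectral_rep [OF V] that by (auto simp: spectral_rep_def)
qed

lemma sum_lessThan_double: "(\<Sum>I<2 * n. f I) = (\<Sum>x<2. \<Sum>i<n. f (x * n + i))"
  for f :: "nat \<Rightarrow> 'a :: comm_monoid_add"
proof -
  have "(\<Sum>I<2 * n. f I) = (\<Sum>x<2. sum f {x * n..<x * n + n})"
    by (rule sum.nat_group [symmetric])
  also have "\<dots> = (\<Sum>x<2. \<Sum>i<n. f (x * n + i))"
  proof (rule sum.cong [OF refl])
    fix x :: nat
    show "sum f {x * n..<x * n + n} = (\<Sum>i<n. f (x * n + i))"
      using sum.shift_bounds_nat_ivl [of f 0 "x * n" n] by (simp add: atLeast0LessThan add.commute)
  qed
  finally show ?thesis .
qed

lemma rho_XE_spectral_rep:
  assumes Ks: "\<forall>K\<in>set Ks. K \<in> carrier_mat 2 2"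
  obtains u r where "spectral_rep 4 (pinched_choi Ks) u r" "\<And>i. i < 4 \<Longrightarrow> r i \<ge> 0"
    "vn_entropy (rho_XE Ks) = (\<Sum>i<4. eta (r i))"
proof -
  define n where "n = length Ks"
  \<comment> \<open>Row block \<open>x\<close> of \<open>W\<close> contains the scaled Kraus vectors
    with the columns of the other input set to zero. As no row sees both inputs, the Gram matrix is
    pinched.\<close>
  define W where "W = mat (2 * n) 4 (\<lambda>(I, a).
    if I div n = a div 2 then kraus_vec (Ks ! (I mod n)) a / of_real (sqrt 2) else 0)"
  have W: "W \<in> carrier_mat (2 * n) 4" by (simp add: W_def)
  have "(mat_adjoint W * W) $$ (a, b) = pinched_choi Ks a b" if ab: "a < 4" "b < 4" for a b
  proof -
    have "(mat_adjoint W * W) $$ (a, b) = (\<Sum>I<2 * n. cnj (W $$ (I, a)) * W $$ (I, b))"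
      using ab W by (simp add: scalar_prod_def atLeast0LessThan)
    also have "\<dots> = (\<Sum>x<2. \<Sum>i<n. cnj (W $$ (x * n + i, a)) * W $$ (x * n + i, b))"
      by (rule sum_lessThan_double)
    also have "\<dots> = (\<Sum>x<2. \<Sum>i<n. if x = a div 2 \<and> x = b div 2
        then cnj (kraus_vec (Ks ! i) a) * kraus_vec (Ks ! i) b / 2 else 0)"
    proof (intro sum.cong refl)
      fix x i assume "x \<in> {..<2 :: nat}" "i \<in> {..<n}"
      then have xi: "x < 2" "i < n" by auto
      then have "x * n + i < 2 * n" by (auto simp: less_2_cases_iff)
      then show "cnj (W $$ (x * n + i, a)) * W $$ (x * n + i, b) = (if x = a div 2 \<and> x = b div 2
        then cnj (kraus_vec (Ks ! i) a) * kraus_vec (Ks ! i) b / 2 else 0)"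
        using xi ab by (auto simp: W_def of_real_sqrt2_sq)
    qed
    also have "\<dots> = pinched_choi Ks a b"
    proof -
      have "a div 2 < 2" "b div 2 < 2" using ab by auto
      then show ?thesis
        by (auto simp: sum_lessThan_2 pinched_choi_def choi_def n_def sum_divide_distrib less_2_cases_iff)
    qed
    finally show ?thesis .
  qed
  moreover have "W * mat_adjoint W = rho_XE Ks"
  proof (rule eq_matI)
    fix I J assume "I < dim_row (rho_XE Ks)" "J < dim_col (rho_XE Ks)"
    then have IJ: "I < 2 * n" "J < 2 * n" by (auto simp: rho_XE_def n_def Let_def)
    then have n: "n > 0" by (cases n) auto
    have q: "I div n < 2" "J div n < 2" "I mod n < n" "J mod n < n"
      using IJ n by (auto simp: less_mult_imp_div_less)
    have "(W * mat_adjoint W) $$ (I, J) = (\<Sum>a<4. W $$ (I, a) * cnj (W $$ (J, a)))"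
      using IJ W by (simp add: scalar_prod_def atLeast0LessThan)
    also have "\<dots> = (\<Sum>a<4. if I div n = a div 2 \<and> J div n = a div 2
        then kraus_vec (Ks ! (I mod n)) a * cnj (kraus_vec (Ks ! (J mod n)) a) / 2 else 0)"
      using IJ by (intro sum.cong refl) (auto simp: W_def of_real_sqrt2_sq)
    also have "\<dots> = (if I div n = J div n
        then 1 / 2 * (\<Sum>b<2. kraus_vec (Ks ! (I mod n)) (2 * (I div n) + b) * cnj (kraus_vec (Ks ! (J mod n)) (2 * (I div n) + b)))
        else 0)"
      using q by (auto simp: sum_lessThan_2 sum_lessThan_4 less_2_cases_iff add_divide_distrib)
    also have "\<dots> = rho_XE Ks $$ (I, J)"
      using IJ q index_chan_env_zproj [OF Ks, of "I mod n" "J mod n" "I div n"]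
      by (cases "I div n = J div n") (simp_all add: rho_XE_def Let_def flip: n_def)
    finally show "(W * mat_adjoint W) $$ (I, J) = rho_XE Ks $$ (I, J)" .
  qed (auto simp: W_def rho_XE_def Let_def n_def)
  ultimately show ?thesis
    using gram_spectral_rep [OF W] that by (auto simp: spectral_rep_def)
qed

section \<open>Stokes parameters and key rate in terms of Choi entries\<close>

lemma choi_cnj: "choi Ks b a = cnj (choi Ks a b)"
  by (simp add: choi_def mult.commute)

lemma pauli_carrier [simp]: "pauli a \<in> carrier_mat 2 2"
  by (auto simp: pauli_def mat_of_rows_list_def intro!: carrier_matI)

lemma index_pauli:
  "pauli 0 $$ (0, 0) = 1" "pauli 0 $$ (0, 1) = 0" "pauli 0 $$ (1, 0) = 0" "pauli 0 $$ (1, 1) = -1"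
  "pauli 1 $$ (0, 0) = 0" "pauli 1 $$ (0, 1) = 1" "pauli 1 $$ (1, 0) = 1" "pauli 1 $$ (1, 1) = 0"
  "pauli 2 $$ (0, 0) = 0" "pauli 2 $$ (0, 1) = - \<i>" "pauli 2 $$ (1, 0) = \<i>" "pauli 2 $$ (1, 1) = 0"
  by (simp_all add: pauli_def mat_of_rows_list_def)

lemma mtrace_mult_2:
  assumes "A \<in> carrier_mat 2 2" "B \<in> carrier_mat 2 2"
  shows "mtrace (A * B) = A $$ (0, 0) * B $$ (0, 0) + A $$ (0, 1) * B $$ (1, 0)
    + (A $$ (1, 0) * B $$ (0, 1) + A $$ (1, 1) * B $$ (1, 1))"
proof -
  have "A * B \<in> carrier_mat 2 2" using assms by (rule mult_carrier_mat)
  then have "mtrace (A * B) = (A * B) $$ (0, 0) + (A * B) $$ (1, 1)"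
    unfolding mtrace_def carrier_matD(1) [OF \<open>A * B \<in> carrier_mat 2 2\<close>] sum_lessThan_2 by simp
  then show ?thesis
    using index_mult_mat_2 [OF assms, of 0 0] index_mult_mat_2 [OF assms, of 1 1] by simp
qed

context
  fixes Ks :: "complex mat list"
  assumes Ks: "\<forall>K\<in>set Ks. K \<in> carrier_mat 2 2"
begin

private lemma mtrace_pauli:
  assumes "\<rho> \<in> carrier_mat 2 2"
  shows "mtrace (pauli a * chan_apply Ks \<rho>)
    = (\<Sum>i<2. \<Sum>j<2. pauli a $$ (i, j) * (\<Sum>x<2. \<Sum>y<2. \<rho> $$ (x, y) * (2 * choi Ks (2 * y + i) (2 * x + j))))"
  unfolding mtrace_mult_2 [OF pauli_carrier chan_apply_carrier [OF Ks assms]]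
  by (simp add: index_chan_apply [OF Ks assms] sum_lessThan_2 del: One_nat_def add_2_eq_Suc add_2_eq_Suc')

lemma stokes_R_choi:
  "stokes_R Ks $$ (0, 0) = Re (choi Ks 0 0) - Re (choi Ks 1 1) - Re (choi Ks 2 2) + Re (choi Ks 3 3)"
  "stokes_R Ks $$ (0, 1) = 2 * (Re (choi Ks 0 2) - Re (choi Ks 1 3))"
  "stokes_R Ks $$ (1, 0) = 2 * (Re (choi Ks 0 1) - Re (choi Ks 2 3))"
  "stokes_R Ks $$ (1, 1) = 2 * (Re (choi Ks 0 3) + Re (choi Ks 1 2))"
  "stokes_R Ks $$ (2, 0) = 2 * (Im (choi Ks 0 1) - Im (choi Ks 2 3))"
  "stokes_R Ks $$ (2, 1) = 2 * (Im (choi Ks 0 3) - Im (choi Ks 1 2))"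
  using choi_cnj [of Ks 1 0] choi_cnj [of Ks 2 0] choi_cnj [of Ks 3 0] choi_cnj [of Ks 2 1]
    choi_cnj [of Ks 3 1] choi_cnj [of Ks 3 2]
  by (simp_all add: stokes_R_def mtrace_pauli sum_lessThan_2 index_pauli del: One_nat_def add_2_eq_Suc add_2_eq_Suc')

lemma stokes_t_choi:
  "stokes_t Ks $ 0 = Re (choi Ks 0 0) - Re (choi Ks 1 1) + Re (choi Ks 2 2) - Re (choi Ks 3 3)"
  "stokes_t Ks $ 1 = 2 * (Re (choi Ks 0 1) + Re (choi Ks 2 3))"
  using choi_cnj [of Ks 1 0] choi_cnj [of Ks 2 0] choi_cnj [of Ks 3 0] choi_cnj [of Ks 2 1]
    choi_cnj [of Ks 3 1] choi_cnj [of Ks 3 2]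
  by (simp_all add: stokes_t_def mtrace_pauli sum_lessThan_2 index_pauli del: One_nat_def add_2_eq_Suc add_2_eq_Suc')

lemma P_XY_choi:
  assumes "x < 2" "y < 2"
  shows "P_XY Ks x y = Re (choi Ks (2 * x + y) (2 * x + y))"
proof -
  have z: "zproj x \<in> carrier_mat 2 2" by (simp add: zproj_def)
  have "chan_apply Ks (zproj x) $$ (y, y) = 2 * choi Ks (2 * x + y) (2 * x + y)"
    unfolding index_chan_apply [OF Ks z assms(2,2)]
    using assms(1) by (auto simp: sum_lessThan_2 zproj_def less_2_cases_iff)
  then show ?thesis by (simp add: P_XY_def)
qed

end

text \<open>Trace preservation fixes the diagonal sum for each input, while \<open>R_zz\<close> and
  the vanishing \<open>t_z\<close> supply two more linear equations. So H(X|Y) is determined by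
  \<open>R_zz\<close>.\<close>

lemma choi_diag:
  assumes chan: "qubit_channel Ks" and tz: "stokes_t Ks $ 0 = 0"
  shows "Re (choi Ks 0 0) = (1 + stokes_R Ks $$ (0, 0)) / 4" "Re (choi Ks 1 1) = (1 - stokes_R Ks $$ (0, 0)) / 4"
    "Re (choi Ks 2 2) = (1 - stokes_R Ks $$ (0, 0)) / 4" "Re (choi Ks 3 3) = (1 + stokes_R Ks $$ (0, 0)) / 4"
proof -
  have Ks: "\<forall>K\<in>set Ks. K \<in> carrier_mat 2 2" using chan by (simp add: qubit_channel_def)
  have "choi Ks 0 0 + choi Ks 1 1 = 1 / 2" "choi Ks 2 2 + choi Ks 3 3 = 1 / 2"
    using choi_trace_preserving [OF chan, of 0 0] choi_trace_preserving [OF chan, of 1 1]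
    by (simp_all del: One_nat_def add_2_eq_Suc add_2_eq_Suc')
  then have "Re (choi Ks 0 0) + Re (choi Ks 1 1) = 1 / 2" "Re (choi Ks 2 2) + Re (choi Ks 3 3) = 1 / 2"
    by (auto simp: complex_eq_iff)
  with tz show "Re (choi Ks 0 0) = (1 + stokes_R Ks $$ (0, 0)) / 4" "Re (choi Ks 1 1) = (1 - stokes_R Ks $$ (0, 0)) / 4"
    "Re (choi Ks 2 2) = (1 - stokes_R Ks $$ (0, 0)) / 4" "Re (choi Ks 3 3) = (1 + stokes_R Ks $$ (0, 0)) / 4"
    unfolding stokes_R_choi(1) [OF Ks] stokes_t_choi(1) [OF Ks] by (simp_all add: field_simps)
qed

text \<open>As \<open>t_z\<close> vanishes, Y is uniform and contributes one bit; the joint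
  distribution of X and Y is the diagonal of the Choi state.\<close>

lemma key_rate_choi:
  assumes chan: "qubit_channel Ks" and tz: "stokes_t Ks $ 0 = 0"
  shows "key_rate Ks = vn_entropy (rho_XE Ks) - vn_entropy (rho_E Ks) - (\<Sum>a<4. eta (Re (choi Ks a a))) + 1"
proof -
  have Ks: "\<forall>K\<in>set Ks. K \<in> carrier_mat 2 2" using chan by (simp add: qubit_channel_def)
  note P = P_XY_choi [OF Ks]
  have half: "eta (1 / 2) = 1 / 2" by (simp add: eta_def log_divide)
  have P_Y: "(\<Sum>x<2. P_XY Ks x 0) = 1 / 2" "(\<Sum>x<2. P_XY Ks x 1) = 1 / 2"
    using P [of 0 0] P [of 0 1] P [of 1 0] P [of 1 1] choi_diag [OF chan tz]
    by (simp_all add: sum_lessThan_2 field_simps del: One_nat_def add_2_eq_Suc add_2_eq_Suc')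
  have "(\<Sum>y<2. eta (\<Sum>x<2. P_XY Ks x y)) = 1"
    unfolding sum_lessThan_2 [of "\<lambda>y. eta (\<Sum>x<2. P_XY Ks x y)"] P_Y half by simp
  moreover have "(\<Sum>x<2. \<Sum>y<2. eta (P_XY Ks x y)) = (\<Sum>a<4. eta (Re (choi Ks a a)))"
    using P [of 0 0] P [of 0 1] P [of 1 0] P [of 1 1]
    by (simp add: sum_lessThan_2 sum_lessThan_4 del: One_nat_def add_2_eq_Suc add_2_eq_Suc')
  ultimately show ?thesis by (simp add: key_rate_def H_XE_def H_XY_def)
qed

lemma eta_nonneg: "0 \<le> p \<Longrightarrow> p \<le> 1 \<Longrightarrow> eta p \<ge> 0"
  by (auto simp: eta_def mult_nonneg_nonpos)

lemma choi_trace: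
  assumes "qubit_channel Ks"
  shows "(\<Sum>a<4. Re (choi Ks a a)) = 1"
proof -
  have "choi Ks 0 0 + choi Ks 1 1 = 1 / 2" "choi Ks 2 2 + choi Ks 3 3 = 1 / 2"
    using choi_trace_preserving [OF assms, of 0 0] choi_trace_preserving [OF assms, of 1 1]
    by (simp_all del: One_nat_def add_2_eq_Suc add_2_eq_Suc')
  then have "Re (choi Ks 0 0) + Re (choi Ks 1 1) = 1 / 2" "Re (choi Ks 2 2) + Re (choi Ks 3 3) = 1 / 2"
    by (auto simp: complex_eq_iff)
  then show ?thesis by (simp add: sum_lessThan_4)
qed

text \<open>A crude estimate: the entropy of \<open>rho_XE\<close> is nonnegative, and that of
  \<open>rho_E\<close> is at most the diagonal entropy. It serves to bound the infimum of the key
  rate from below.\<close>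

lemma key_rate_lower_bound:
  assumes chan: "qubit_channel Ks" and tz: "stokes_t Ks $ 0 = 0"
  shows "key_rate Ks \<ge> 1 - 2 * (\<Sum>a<4. eta (Re (choi Ks a a)))"
proof -
  have Ks: "\<forall>K\<in>set Ks. K \<in> carrier_mat 2 2" using chan by (simp add: qubit_channel_def)
  obtain u r where rep: "spectral_rep 4 (choi Ks) u r" "\<And>i. i < 4 \<Longrightarrow> r i \<ge> 0"
    and E: "vn_entropy (rho_E Ks) = (\<Sum>i<4. eta (r i))"
    using rho_E_spectral_rep [OF Ks] by blast
  obtain u' r' where rep': "spectral_rep 4 (pinched_choi Ks) u' r'" and r': "\<And>i. i < 4 \<Longrightarrow> r' i \<ge> 0"
    and XE: "vn_entropy (rho_XE Ks) = (\<Sum>i<4. eta (r' i))"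
    using rho_XE_spectral_rep [OF Ks] by blast
  have "(\<Sum>i<4. r' i) = 1"
    using spectral_rep_trace [OF rep'] choi_trace [OF chan] by (simp add: pinched_choi_def)
  then have "r' i \<le> 1" if "i < 4" for i
    using member_le_sum [of i "{..<4}" r'] r' that by auto
  then have "vn_entropy (rho_XE Ks) \<ge> 0"
    unfolding XE using r' by (intro sum_nonneg eta_nonneg) auto
  moreover have "vn_entropy (rho_E Ks) \<le> (\<Sum>a<4. eta (Re (choi Ks a a)))"
    unfolding E by (rule sum_eta_eigenvalues_le_diag [OF rep])
  ultimately show ?thesis using key_rate_choi [OF assms] by simp
qed

section \<open>Bell-diagonal states\<close>

lemma less_4_cases: "i < 4 \<Longrightarrow> i = 0 \<or> i = 1 \<or> i = 2 \<or> i = (3 :: nat)"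
  by auto

text \<open>Flattened rotations (rows 0 and 1) and reflections (rows 2 and 3) of the plane: a rotated Bell basis.\<close>
definition bell :: "complex \<Rightarrow> complex \<Rightarrow> nat \<Rightarrow> nat \<Rightarrow> real" where
  "bell g d j a =
    (if j = 0 then [Re g, Im g, - Im g, Re g]
     else if j = 1 then [- Im g, Re g, - Re g, - Im g]
     else if j = 2 then [Re d, Im d, Im d, - Re d]
     else [- Im d, Re d, Re d, Im d]) ! a"

text \<open>The distribution of two independent signs with means \<open>s\<close> and
  \<open>t\<close>. The indices 0, 1, 2, 3 stand for the sign pairs ++, --, +-, -+.\<close>

definition bell_weight :: "real \<Rightarrow> real \<Rightarrow> nat \<Rightarrow> real" where
  "bell_weight s t j =
    (if j = 0 then (1 + s) * (1 + t)
     else if j = 1 then (1 - s) * (1 - t)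
     else if j = 2 then (1 + s) * (1 - t)
     else (1 - s) * (1 + t)) / 4"

definition bell_basis :: "complex \<Rightarrow> complex \<Rightarrow> nat \<Rightarrow> nat \<Rightarrow> complex" where
  "bell_basis g d a j = of_real (bell g d j a / sqrt 2)"

definition bell_state :: "complex \<Rightarrow> complex \<Rightarrow> real \<Rightarrow> real \<Rightarrow> nat \<Rightarrow> nat \<Rightarrow> real" where
  "bell_state g d s t a b = (\<Sum>j<4. bell_weight s t j * (bell g d j a * bell g d j b)) / 2"

text \<open>The matrix \<open>((m00, m01), (m10, m11))\<close> is \<open>p\<close> times the rotation by twice the angle of \<open>g\<close> plus
  \<open>q\<close> times the reflection given by twice the angle of \<open>d\<close>; its singular values are \<open>p + q\<close> and
  \<open>\<bar>p - q\<bar>\<close>.\<close>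
definition rot_refl_split ::
  "real \<Rightarrow> real \<Rightarrow> real \<Rightarrow> real \<Rightarrow> real \<Rightarrow> real \<Rightarrow> complex \<Rightarrow> complex \<Rightarrow> bool" where
  "rot_refl_split m00 m01 m10 m11 p q g d \<longleftrightarrow> 0 \<le> p \<and> 0 \<le> q \<and> cmod g = 1 \<and> cmod d = 1 \<and>
     of_real p * g\<^sup>2 = Complex ((m00 + m11) / 2) ((m10 - m01) / 2) \<and>
     of_real q * d\<^sup>2 = Complex ((m00 - m11) / 2) ((m10 + m01) / 2)"

lemma cmod_1_sq: "cmod g = 1 \<Longrightarrow> Re g * Re g + Im g * Im g = 1"
  using cmod_power2 [of g] by (simp add: power2_eq_square)

lemma bell_cols:
  assumes "cmod g = 1" "cmod d = 1" "i < 4" "j < 4"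
  shows "(\<Sum>a<4. bell g d i a * bell g d j a) = (if i = j then 2 else 0)"
  using less_4_cases [OF assms(3)] less_4_cases [OF assms(4)] cmod_1_sq [OF assms(1)] cmod_1_sq [OF assms(2)]
  by (elim disjE) (simp_all add: sum_lessThan_4 bell_def)

lemma bell_rows:
  assumes "cmod g = 1" "cmod d = 1" "a < 4" "b < 4"
  shows "(\<Sum>j<4. bell g d j a * bell g d j b) = (if a = b then 2 else 0)"
  using less_4_cases [OF assms(3)] less_4_cases [OF assms(4)] cmod_1_sq [OF assms(1)] cmod_1_sq [OF assms(2)]
  by (elim disjE) (simp_all add: sum_lessThan_4 bell_def)

lemma bell_basis_mult: "bell_basis g d a i * bell_basis g d b j = of_real (bell g d i a * bell g d j b / 2)"
  by (simp add: bell_basis_def of_real_sqrt2_sq)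

lemma cnj_bell_basis [simp]: "cnj (bell_basis g d a i) = bell_basis g d a i"
  by (simp add: bell_basis_def)

lemma orthonormal_bell_basis:
  assumes "cmod g = 1" "cmod d = 1"
  shows "orthonormal_basis 4 (bell_basis g d)"
  unfolding orthonormal_basis_def cnj_bell_basis bell_basis_mult of_real_sum [symmetric]
    sum_divide_distrib [symmetric]
  using bell_cols [OF assms] bell_rows [OF assms] by simp

lemma spectral_rep_bell_state:
  assumes "cmod g = 1" "cmod d = 1"
  shows "spectral_rep 4 (\<lambda>a b. of_real (bell_state g d s t a b)) (bell_basis g d) (bell_weight s t)"
  unfolding spectral_rep_def cnj_bell_basis mult.assoc bell_basis_mult
  using orthonormal_bell_basis [OF assms]
  by (simp add: bell_state_def sum_divide_distrib)

section \<open>Bell-diagonal states with prescribed correlations\<close>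

context
  fixes m00 m01 m10 m11 p q :: real and g d :: complex
  assumes split: "rot_refl_split m00 m01 m10 m11 p q g d"
begin

lemma rot_refl_split_norm: "cmod g = 1" "cmod d = 1" "p \<ge> 0" "q \<ge> 0"
  using split by (simp_all add: rot_refl_split_def)

lemma rot_refl_split_entries:
  "p * (Re g * Re g - Im g * Im g) = (m00 + m11) / 2" "p * (2 * (Re g * Im g)) = (m10 - m01) / 2"
  "q * (Re d * Re d - Im d * Im d) = (m00 - m11) / 2" "q * (2 * (Re d * Im d)) = (m10 + m01) / 2"
  using split by (simp_all add: rot_refl_split_def complex_eq_iff power2_eq_square algebra_simps)

text \<open>\<open>m00\<close> is p cos \<alpha> + q cos \<beta>, where \<alpha> and \<beta> are
  twice the angles of \<open>g\<close> and \<open>d\<close>.\<close>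

lemma rot_refl_split_bound: "\<bar>m00\<bar> \<le> p + q"
proof -
  have "\<bar>Re g * Re g - Im g * Im g\<bar> \<le> 1" "\<bar>Re d * Re d - Im d * Im d\<bar> \<le> 1"
    using cmod_1_sq [OF rot_refl_split_norm(1)] cmod_1_sq [OF rot_refl_split_norm(2)]
      zero_le_square [of "Re g"] zero_le_square [of "Im g"] zero_le_square [of "Re d"] zero_le_square [of "Im d"]
    by linarith+
  then have "\<bar>p * (Re g * Re g - Im g * Im g)\<bar> \<le> p" "\<bar>q * (Re d * Re d - Im d * Im d)\<bar> \<le> q"
    using rot_refl_split_norm(3,4) by (simp_all add: abs_mult mult_left_le)
  then show ?thesis unfolding rot_refl_split_entries abs_le_iff by (auto simp: field_simps)
qed

text \<open>The rotation part of the block enters with the difference \<open>l * p\<close> of the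
  weights 0 and 1, the reflection part with the difference \<open>l * q\<close> of the weights 2 and
  3. So the state has the block of the matrix scaled by \<open>l\<close>: \<open>l = 1\<close>
  serves the upper bound, and \<open>0 < l < 1\<close> gives a reference state of full rank when p +
  q \<le> 1.\<close>

lemma bell_state_entries:
  fixes l :: real
  defines "C \<equiv> bell_state g d (l * (p + q)) (l * (p - q))"
  shows "C 0 0 = (1 + l * m00) / 4" "C 1 1 = (1 - l * m00) / 4" "C 2 2 = (1 - l * m00) / 4" "C 3 3 = (1 + l * m00) / 4"
    "C 0 1 = l * m10 / 4" "C 1 0 = l * m10 / 4" "C 2 3 = - l * m10 / 4" "C 3 2 = - l * m10 / 4"
    "C 0 2 - C 1 3 = l * m01 / 2" "C 0 3 + C 1 2 = l * m11 / 2"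
proof -
  define w where "w = bell_weight (l * (p + q)) (l * (p - q))"
  have G: "Re g * Re g = 1 - Im g * Im g" and D: "Re d * Re d = 1 - Im d * Im d"
    using cmod_1_sq [OF rot_refl_split_norm(1)] cmod_1_sq [OF rot_refl_split_norm(2)] by linarith+
  have w: "w 0 - w 1 = l * p" "w 2 - w 3 = l * q" "w 0 + w 1 + w 2 + w 3 = 1"
    by (simp_all add: w_def bell_weight_def field_simps)
  have C: "C a b = (w 0 * (bell g d 0 a * bell g d 0 b) + w 1 * (bell g d 1 a * bell g d 1 b)
      + w 2 * (bell g d 2 a * bell g d 2 b) + w 3 * (bell g d 3 a * bell g d 3 b)) / 2" for a b
    by (simp add: C_def bell_state_def sum_lessThan_4 w_def)
  have w0: "w 0 = w 1 + l * p" and w2: "w 2 = w 3 + l * q" and w1: "w 1 = (1 - l * p - l * q) / 2 - w 3"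
    using w by (auto simp: field_simps)
  have e1: "m00 = p * (1 - 2 * (Im g * Im g)) + q * (1 - 2 * (Im d * Im d))"
    and e2: "m11 = p * (1 - 2 * (Im g * Im g)) - q * (1 - 2 * (Im d * Im d))"
    and e3: "m10 = p * (2 * (Re g * Im g)) + q * (2 * (Re d * Im d))"
    and e4: "m01 = q * (2 * (Re d * Im d)) - p * (2 * (Re g * Im g))"
    using rot_refl_split_entries G D by (simp_all add: field_simps)
  show "C 0 0 = (1 + l * m00) / 4" "C 1 1 = (1 - l * m00) / 4" "C 2 2 = (1 - l * m00) / 4" "C 3 3 = (1 + l * m00) / 4"
    "C 0 1 = l * m10 / 4" "C 1 0 = l * m10 / 4" "C 2 3 = - l * m10 / 4" "C 3 2 = - l * m10 / 4"
    "C 0 2 - C 1 3 = l * m01 / 2" "C 0 3 + C 1 2 = l * m11 / 2"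
    unfolding C e1 e2 e3 e4 w0 w2 w1 by (simp_all add: bell_def G D field_simps)
qed

end

section \<open>The lower bound\<close>

text \<open>The argument of the logarithm is (1 - l) / 2 + l c / 2, hence at least l c / 2, whose
  logarithm splits into a sum.\<close>

lemma eta_scaled_cross:
  assumes "c \<ge> 0" "c \<le> 2" "0 < l" "l < 1"
  shows "c / 2 * log 2 ((1 + l * (c - 1)) / 2) \<ge> - eta (c / 2) + c / 2 * log 2 l"
proof (cases "c = 0")
  case False
  then have c: "c > 0" using assms by simp
  have "log 2 (l * (c / 2)) \<le> log 2 ((1 + l * (c - 1)) / 2)"
    using c assms by (intro log_mono) (auto simp: field_simps)
  moreover have "log 2 (l * (c / 2)) = log 2 l + log 2 (c / 2)"
    using c assms by (simp add: log_mult_pos del: times_divide_eq_right)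
  ultimately have "c / 2 * (log 2 l + log 2 (c / 2)) \<le> c / 2 * log 2 ((1 + l * (c - 1)) / 2)"
    using c by (intro mult_left_mono) auto
  then show ?thesis using c by (simp add: eta_def algebra_simps)
qed simp

text \<open>Shrinking the bias of the reference distribution by \<open>l\<close> costs at most - log
  l in cross entropy, since the two probabilities sum to 1.\<close>

lemma bin_entropy_scaled_cross:
  assumes "\<bar>s\<bar> \<le> 1" "0 < l" "l < 1"
  shows "(1 + s) / 2 * log 2 ((1 + l * s) / 2) + (1 - s) / 2 * log 2 ((1 - l * s) / 2)
    \<ge> - bin_entropy ((1 + s) / 2) + log 2 l"
proof -
  have "1 - (1 + s) / 2 = (1 - s) / 2" by (simp add: field_simps)
  then have "bin_entropy ((1 + s) / 2) = eta ((1 + s) / 2) + eta ((1 - s) / 2)"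
    by (simp only: bin_entropy_def)
  moreover have "(1 + s) / 2 * log 2 l + (1 - s) / 2 * log 2 l = log 2 l"
    by (simp add: field_simps)
  ultimately show ?thesis
    using eta_scaled_cross [of "1 + s" l] eta_scaled_cross [of "1 - s" l] assms
    by (simp add: abs_le_iff)
qed

lemma choi_quadratic_bell:
  "Re (\<Sum>a<4. \<Sum>b<4. cnj (bell_basis g d a j) * choi Ks a b * bell_basis g d b j)
    = (\<Sum>a<4. \<Sum>b<4. bell g d j a * bell g d j b * Re (choi Ks a b)) / 2"
proof -
  have Re_of_real_mult: "Re (of_real c * z) = c * Re z" for c z by simp
  have "cnj (bell_basis g d a j) * choi Ks a b * bell_basis g d b j
      = of_real (bell g d j a * bell g d j b / 2) * choi Ks a b" for a b
    unfolding cnj_bell_basis using bell_basis_mult [of g d a j b j] by (simp add: mult_ac)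
  then have "Re (\<Sum>a<4. \<Sum>b<4. cnj (bell_basis g d a j) * choi Ks a b * bell_basis g d b j)
      = (\<Sum>a<4. \<Sum>b<4. bell g d j a * bell g d j b / 2 * Re (choi Ks a b))"
    by (simp only: Re_sum Re_of_real_mult)
  then show ?thesis by (simp add: sum_divide_distrib)
qed

text \<open>Pinching monotonicity against the scaled Bell-diagonal state. The 0 in third position is
  \<open>R_xz\<close>; it makes the pinched reference state diagonal.\<close>

lemma key_rate_ge:
  assumes chan: "qubit_channel Ks"
    and omega: "omega_of (stokes_R Ks) (stokes_t Ks) = [m00, m01, 0, m11, 0, 0]"
    and split: "rot_refl_split m00 m01 0 m11 p q g d" and pq: "p + q \<le> 1"
  shows "1 - bin_entropy ((1 + (p + q)) / 2) - bin_entropy ((1 + (p - q)) / 2) \<le> key_rate Ks"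
proof -
  have Ks: "\<forall>K\<in>set Ks. K \<in> carrier_mat 2 2" using chan by (simp add: qubit_channel_def)
  have om: "stokes_R Ks $$ (0, 0) = m00" "stokes_R Ks $$ (0, 1) = m01" "stokes_R Ks $$ (1, 0) = 0"
    "stokes_R Ks $$ (1, 1) = m11" "stokes_t Ks $ 0 = 0"
    using omega by (simp_all add: omega_of_def)
  note norm = rot_refl_split_norm [OF split] and entries = rot_refl_split_entries [OF split]
  have diag: "Re (choi Ks 0 0) = (1 + m00) / 4" "Re (choi Ks 1 1) = (1 - m00) / 4"
    "Re (choi Ks 2 2) = (1 - m00) / 4" "Re (choi Ks 3 3) = (1 + m00) / 4"
    using choi_diag [OF chan om(5)] om(1) by simp_all
  obtain u r where rep: "spectral_rep 4 (choi Ks) u r" and r: "\<And>i. i < 4 \<Longrightarrow> r i \<ge> 0"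
    and E: "vn_entropy (rho_E Ks) = (\<Sum>i<4. eta (r i))"
    using rho_E_spectral_rep [OF Ks] by blast
  obtain u' r' where rep': "spectral_rep 4 (pinched_choi Ks) u' r'" and r': "\<And>i. i < 4 \<Longrightarrow> r' i \<ge> 0"
    and XE: "vn_entropy (rho_XE Ks) = (\<Sum>i<4. eta (r' i))"
    using rho_XE_spectral_rep [OF Ks] by blast
  have key: "key_rate Ks = (\<Sum>i<4. eta (r' i)) - (\<Sum>i<4. eta (r i)) - (\<Sum>a<4. eta (Re (choi Ks a a))) + 1"
    using key_rate_choi [OF chan om(5)] E XE by simp
  \<comment> \<open>The populations of the Choi state in the rotated Bell basis. Read as a
    distribution of two signs, they have marginals with means \<open>p + q\<close> and
    \<open>p - q\<close>, and these marginals follow from the known correlations.\<close>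
  define \<mu> where "\<mu> j = Re (\<Sum>a<4. \<Sum>b<4. cnj (bell_basis g d a j) * choi Ks a b * bell_basis g d b j)" for j
  have mu: "\<mu> 0 + \<mu> 2 = (1 + (p + q)) / 2" "\<mu> 1 + \<mu> 3 = (1 - (p + q)) / 2"
    "\<mu> 0 + \<mu> 3 = (1 + (p - q)) / 2" "\<mu> 1 + \<mu> 2 = (1 - (p - q)) / 2"
  proof -
    have sym: "Re (choi Ks b a) = Re (choi Ks a b)" for a b using choi_cnj [of Ks b a] by simp
    have m: "\<mu> j = (\<Sum>a<4. \<Sum>b<4. bell g d j a * bell g d j b * Re (choi Ks a b)) / 2" for j
      unfolding \<mu>_def by (rule choi_quadratic_bell)
    have R: "Re (choi Ks 0 2) - Re (choi Ks 1 3) = m01 / 2" "Re (choi Ks 0 1) - Re (choi Ks 2 3) = 0"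
      "Re (choi Ks 0 3) + Re (choi Ks 1 2) = m11 / 2"
      using om stokes_R_choi [OF Ks] by simp_all
    \<comment> \<open>Cosine and sine of twice the angles of \<open>g\<close> and \<open>d\<close>.
      The relation cos^2 + sin^2 = 1 isolates \<open>p\<close> and \<open>q\<close> below.\<close>
    define G1 G2 D1 D2 where "G1 = Re g * Re g - Im g * Im g" "G2 = 2 * (Re g * Im g)"
      "D1 = Re d * Re d - Im d * Im d" "D2 = 2 * (Re d * Im d)"
    note GD = G1_G2_D1_D2_def
    have "\<mu> 0 - \<mu> 1 = (G1 * (m00 + m11) + G2 * (0 - m01)) / 2"
    proof -
      have "\<mu> 0 - \<mu> 1 = (G1 * (Re (choi Ks 0 0) + Re (choi Ks 3 3) - Re (choi Ks 1 1) - Re (choi Ks 2 2)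
            + 2 * (Re (choi Ks 0 3) + Re (choi Ks 1 2)))
          + 2 * G2 * ((Re (choi Ks 0 1) - Re (choi Ks 2 3)) - (Re (choi Ks 0 2) - Re (choi Ks 1 3)))) / 2"
        unfolding m sum_lessThan_4 sym [of 1 0] sym [of 2 0] sym [of 3 0] sym [of 2 1] sym [of 3 1] sym [of 3 2]
        by (simp add: bell_def GD field_simps del: One_nat_def)
      then show ?thesis unfolding R diag by (simp add: field_simps)
    qed
    also have "\<dots> = G1 * (p * G1) + G2 * (p * G2)"
      unfolding GD entries by (simp add: field_simps)
    also have "\<dots> = p * ((Re g * Re g + Im g * Im g) * (Re g * Re g + Im g * Im g))"
      unfolding GD by (simp add: algebra_simps)
    finally have 1: "\<mu> 0 - \<mu> 1 = p" using cmod_1_sq [OF norm(1)] by simp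
    have "\<mu> 2 - \<mu> 3 = (D1 * (m00 - m11) + D2 * (0 + m01)) / 2"
    proof -
      have "\<mu> 2 - \<mu> 3 = (D1 * (Re (choi Ks 0 0) + Re (choi Ks 3 3) - Re (choi Ks 1 1) - Re (choi Ks 2 2)
            - 2 * (Re (choi Ks 0 3) + Re (choi Ks 1 2)))
          + 2 * D2 * ((Re (choi Ks 0 1) - Re (choi Ks 2 3)) + (Re (choi Ks 0 2) - Re (choi Ks 1 3)))) / 2"
        unfolding m sum_lessThan_4 sym [of 1 0] sym [of 2 0] sym [of 3 0] sym [of 2 1] sym [of 3 1] sym [of 3 2]
        by (simp add: bell_def GD field_simps del: One_nat_def)
      then show ?thesis unfolding R diag by (simp add: field_simps)
    qed
    also have "\<dots> = D1 * (q * D1) + D2 * (q * D2)"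
      unfolding GD entries by (simp add: field_simps)
    also have "\<dots> = q * ((Re d * Re d + Im d * Im d) * (Re d * Re d + Im d * Im d))"
      unfolding GD by (simp add: algebra_simps)
    finally have 2: "\<mu> 2 - \<mu> 3 = q" using cmod_1_sq [OF norm(2)] by simp
    have "\<mu> 0 + \<mu> 1 + \<mu> 2 + \<mu> 3 = Re (choi Ks 0 0) + Re (choi Ks 1 1) + Re (choi Ks 2 2) + Re (choi Ks 3 3)"
    proof -
      have "\<mu> 0 + \<mu> 1 + \<mu> 2 + \<mu> 3 = (\<Sum>j<4. \<Sum>a<4. \<Sum>b<4. bell g d j a * bell g d j b * Re (choi Ks a b)) / 2"
        unfolding m by (simp add: sum_lessThan_4 [of "\<lambda>j. \<Sum>a<4. \<Sum>b<4. bell g d j a * bell g d j b * Re (choi Ks a b)"]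
            add_divide_distrib del: One_nat_def)
      also have "(\<Sum>j<4. \<Sum>a<4. \<Sum>b<4. bell g d j a * bell g d j b * Re (choi Ks a b))
          = (\<Sum>a<4. \<Sum>b<4. (\<Sum>j<4. bell g d j a * bell g d j b) * Re (choi Ks a b))"
        unfolding sum_distrib_right by (subst sum.swap, rule sum.cong [OF refl], rule sum.swap)
      also have "\<dots> = (\<Sum>a<4. \<Sum>b<4. (if a = b then 2 else 0) * Re (choi Ks a b))"
        using bell_rows [OF norm(1,2)] by (intro sum.cong refl) simp
      finally show ?thesis by (simp add: sum_lessThan_4 del: One_nat_def)
    qed
    then have 3: "\<mu> 0 + \<mu> 1 + \<mu> 2 + \<mu> 3 = 1" unfolding diag by (simp add: field_simps)
    from 1 2 3 show "\<mu> 0 + \<mu> 2 = (1 + (p + q)) / 2" "\<mu> 1 + \<mu> 3 = (1 - (p + q)) / 2"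
      "\<mu> 0 + \<mu> 3 = (1 + (p - q)) / 2" "\<mu> 1 + \<mu> 2 = (1 - (p - q)) / 2"
      by (simp_all add: field_simps)
  qed
  have main: "(\<Sum>a<4. eta (Re (choi Ks a a))) - bin_entropy ((1 + (p + q)) / 2) - bin_entropy ((1 + (p - q)) / 2)
      + 2 * log 2 l \<le> (\<Sum>i<4. eta (r' i)) - (\<Sum>i<4. eta (r i))" if l: "0 < l" "l < 1" for l
  proof -
    define s t where "s = l * (p + q)" "t = l * (p - q)"
    have lx: "\<bar>l * x\<bar> < 1" if "\<bar>x\<bar> \<le> 1" for x
    proof -
      have "l * \<bar>x\<bar> \<le> l * 1" using l that by (intro mult_left_mono) auto
      then have "l * \<bar>x\<bar> < 1" using l by linarith
      then show ?thesis using l by (simp add: abs_mult)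
    qed
    have pq': "\<bar>p + q\<bar> \<le> 1" "\<bar>p - q\<bar> \<le> 1" "\<bar>m00\<bar> \<le> 1"
      using norm(3,4) pq rot_refl_split_bound [OF split] by auto
    have s: "\<bar>s\<bar> < 1" and t: "\<bar>t\<bar> < 1" and lm: "\<bar>l * m00\<bar> < 1"
      unfolding s_t_def using pq' by (simp_all add: lx)
    define s' where "s' a = (if a = 0 \<or> a = 3 then (1 + l * m00) / 4 else (1 - l * m00) / 4)" for a :: nat
    have wpos: "bell_weight s t j > 0" for j
      unfolding bell_weight_def using s t by (auto intro!: mult_pos_pos)
    have s'pos: "s' a > 0" for a unfolding s'_def using lm by auto
    note bs = bell_state_entries [OF split, of l, folded s_t_def]
    have core: "(\<Sum>j<4. \<mu> j * log 2 (bell_weight s t j)) - (\<Sum>a<4. Re (choi Ks a a) * log 2 (s' a))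
        \<le> (\<Sum>i<4. eta (r' i)) - (\<Sum>i<4. eta (r i))"
      unfolding \<mu>_def
    proof (rule pinching_relative_entropy [where blk = "\<lambda>a. a div 2",
          OF rep r spectral_rep_bell_state [OF norm(1,2)] wpos rep' r'])
      show "pinched_choi Ks a b = (if a div 2 = b div 2 then choi Ks a b else 0)" for a b
        by (simp add: pinched_choi_def)
      show "complex_of_real (bell_state g d s t a b) = (if a = b then of_real (s' a) else 0)"
        if "a < 4" "b < 4" "a div 2 = b div 2" for a b
        using less_4_cases [OF that(1)] less_4_cases [OF that(2)] that(3)
        by (elim disjE) (simp_all add: bs s'_def del: One_nat_def)
    qed (auto simp: s'pos)
    \<comment> \<open>Gibbs' inequality: \<open>s'\<close> comes from the scaled block and need not
      be the diagonal of the Choi state, but a cross entropy is never smaller than the entropy,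
      which is the direction required.\<close>
    have "(\<Sum>a<4. eta (Re (choi Ks a a))) \<le> (\<Sum>a<4. - Re (choi Ks a a) * log 2 (s' a) + (s' a - Re (choi Ks a a)) / ln 2)"
    proof (intro sum_mono eta_le_cross s'pos)
      fix a :: nat assume "a \<in> {..<4}"
      then show "0 \<le> Re (choi Ks a a)" using less_4_cases [of a] diag pq'(3) by auto
    qed
    also have "\<dots> = - (\<Sum>a<4. Re (choi Ks a a) * log 2 (s' a)) + ((\<Sum>a<4. s' a) - (\<Sum>a<4. Re (choi Ks a a))) / ln 2"
      by (simp add: sum.distrib sum_subtractf sum_negf flip: sum_divide_distrib)
    also have "(\<Sum>a<4. s' a) = 1" by (simp add: sum_lessThan_4 s'_def field_simps)
    also have "(\<Sum>a<4. Re (choi Ks a a)) = 1" by (rule choi_trace [OF chan])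
    finally have A: "(\<Sum>a<4. eta (Re (choi Ks a a))) \<le> - (\<Sum>a<4. Re (choi Ks a a) * log 2 (s' a))" by simp
    have lg: "log 2 (x * y / 4) = log 2 (x / 2) + log 2 (y / 2)" if "x > 0" "y > 0" for x y :: real
      using that log_mult_pos [of "x / 2" "y / 2" 2] by simp
    \<comment> \<open>The weights are products, so their logarithms split and the populations
      combine into the marginals of the two signs.\<close>
    have "(\<Sum>j<4. \<mu> j * log 2 (bell_weight s t j))
        = (\<mu> 0 + \<mu> 2) * log 2 ((1 + s) / 2) + (\<mu> 1 + \<mu> 3) * log 2 ((1 - s) / 2)
        + ((\<mu> 0 + \<mu> 3) * log 2 ((1 + t) / 2) + (\<mu> 1 + \<mu> 2) * log 2 ((1 - t) / 2))"
    proof -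
      have "log 2 (bell_weight s t 0) = log 2 ((1 + s) / 2) + log 2 ((1 + t) / 2)"
        "log 2 (bell_weight s t 1) = log 2 ((1 - s) / 2) + log 2 ((1 - t) / 2)"
        "log 2 (bell_weight s t 2) = log 2 ((1 + s) / 2) + log 2 ((1 - t) / 2)"
        "log 2 (bell_weight s t 3) = log 2 ((1 - s) / 2) + log 2 ((1 + t) / 2)"
        using s t by (simp_all add: bell_weight_def lg)
      then show ?thesis by (simp add: sum_lessThan_4 algebra_simps del: One_nat_def)
    qed
    also have "\<dots> \<ge> - bin_entropy ((1 + (p + q)) / 2) + log 2 l + (- bin_entropy ((1 + (p - q)) / 2) + log 2 l)"
      unfolding mu s_t_def by (intro add_mono bin_entropy_scaled_cross pq' l)
    finally show ?thesis using core A by simp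
  qed
  have "(\<Sum>a<4. eta (Re (choi Ks a a))) - bin_entropy ((1 + (p + q)) / 2) - bin_entropy ((1 + (p - q)) / 2)
      \<le> (\<Sum>i<4. eta (r' i)) - (\<Sum>i<4. eta (r i))"
  proof (rule field_le_epsilon)
    fix e :: real assume e: "e > 0"
    \<comment> \<open>This value of \<open>l\<close> makes the loss \<open>2 * log 2 l\<close> equal
      to \<open>- e\<close>.\<close>
    have "2 powr (- e / 2) < 1" using e by (simp add: powr_less_one)
    moreover have "log 2 (2 powr (- e / 2)) = - e / 2" by simp
    ultimately show "(\<Sum>a<4. eta (Re (choi Ks a a))) - bin_entropy ((1 + (p + q)) / 2) - bin_entropy ((1 + (p - q)) / 2)
      \<le> (\<Sum>i<4. eta (r' i)) - (\<Sum>i<4. eta (r i)) + e"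
      using main [of "2 powr (- e / 2)"] by simp
  qed
  then show ?thesis unfolding key by simp
qed

section \<open>The upper bound\<close>

lemma eta_mult:
  assumes "x \<ge> 0" "y \<ge> 0"
  shows "eta (x * y) = x * eta y + y * eta x"
proof (cases "x = 0 \<or> y = 0")
  case False
  then have "x > 0" "y > 0" using assms by auto
  then show ?thesis
    using log_mult_pos [of x y 2] by (simp add: eta_def mult_le_0_iff algebra_simps)
qed auto

text \<open>Entropy is additive for independent signs: the entropy of each factor is weighted with
  the probabilities of the other, which sum to 1.\<close>

lemma sum_eta_bell_weight:
  assumes "\<bar>s\<bar> \<le> 1" "\<bar>t\<bar> \<le> 1"
  shows "(\<Sum>j<4. eta (bell_weight s t j)) = bin_entropy ((1 + s) / 2) + bin_entropy ((1 + t) / 2)"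
proof -
  have h: "1 - (1 + x) / 2 = (1 - x) / 2" for x :: real by (simp add: field_simps)
  have m: "eta (x * y / 4) = x / 2 * eta (y / 2) + y / 2 * eta (x / 2)" if "x \<ge> 0" "y \<ge> 0" for x y
    using eta_mult [of "x / 2" "y / 2"] that by simp
  have "eta (bell_weight s t 0) = (1 + s) / 2 * eta ((1 + t) / 2) + (1 + t) / 2 * eta ((1 + s) / 2)"
    "eta (bell_weight s t 1) = (1 - s) / 2 * eta ((1 - t) / 2) + (1 - t) / 2 * eta ((1 - s) / 2)"
    "eta (bell_weight s t 2) = (1 + s) / 2 * eta ((1 - t) / 2) + (1 - t) / 2 * eta ((1 + s) / 2)"
    "eta (bell_weight s t 3) = (1 - s) / 2 * eta ((1 + t) / 2) + (1 + t) / 2 * eta ((1 - s) / 2)"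
    using assms by (simp_all add: bell_weight_def m abs_le_iff del: times_divide_eq_left)
  then show ?thesis
    unfolding sum_lessThan_4 bin_entropy_def h by (simp add: field_simps)
qed

text \<open>A mixture of rotations and reflections with weights \<open>w\<close>. The Kraus
  operators are pairwise trace-orthogonal, so \<open>rho_E\<close> is diagonal and has the entropy
  of two independent signs.\<close>

lemma bell_channel:
  assumes split: "rot_refl_split m00 m01 m10 m11 p q g d" and pq: "p + q \<le> 1"
  shows "\<exists>Ks\<in>P_ba [m00, m01, m10, m11, 0, 0].
    key_rate Ks \<le> 1 - bin_entropy ((1 + (p + q)) / 2) - bin_entropy ((1 + (p - q)) / 2)"
proof -
  note norm = rot_refl_split_norm [OF split]
  define w where "w = bell_weight (p + q) (p - q)"
  have s: "\<bar>p + q\<bar> \<le> 1" "\<bar>p - q\<bar> \<le> 1" using norm(3,4) pq by auto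
  have w: "w j \<ge> 0" for j
    unfolding w_def bell_weight_def using s by (auto simp: abs_le_iff intro!: mult_nonneg_nonneg)
  define K where "K j = mat 2 2 (\<lambda>(b, x). complex_of_real (sqrt (w j) * bell g d j (2 * x + b)))" for j
  define Ks where "Ks = map K [0..<4]"
  have Ks: "\<forall>K\<in>set Ks. K \<in> carrier_mat 2 2" by (auto simp: Ks_def K_def)
  have len: "length Ks = 4" by (simp add: Ks_def)
  have kv: "kraus_vec (Ks ! j) a = of_real (sqrt (w j) * bell g d j a)" if "j < 4" "a < 4" for j a
    using that by (simp add: Ks_def kraus_vec_def K_def less_mult_imp_div_less)
  have ww: "complex_of_real (sqrt (w j)) * complex_of_real (sqrt (w j)) = of_real (w j)" for j
    using w [of j] by (simp flip: of_real_mult)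
  have choi: "choi Ks a b = of_real (bell_state g d (p + q) (p - q) a b)" if "a < 4" "b < 4" for a b
  proof -
    have "choi Ks a b = (\<Sum>j<4. of_real (w j * (bell g d j a * bell g d j b))) / 2"
      unfolding choi_def len
    proof (intro arg_cong [where f = "\<lambda>x. x / 2"] sum.cong refl)
      fix j :: nat assume "j \<in> {..<4}"
      then have "cnj (kraus_vec (Ks ! j) a) * kraus_vec (Ks ! j) b
          = complex_of_real (sqrt (w j)) * complex_of_real (sqrt (w j)) * of_real (bell g d j a * bell g d j b)"
        using kv [of j a] kv [of j b] that by simp
      then show "cnj (kraus_vec (Ks ! j) a) * kraus_vec (Ks ! j) b = of_real (w j * (bell g d j a * bell g d j b))"
        unfolding ww by simp
    qed
    then show ?thesis by (simp add: bell_state_def w_def)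
  qed
  note bs = bell_state_entries [OF split, of 1, unfolded mult_1_left]
  \<comment> \<open>The coherences between the two inputs cancel in the partial trace over the
    output, as trace preservation demands.\<close>
  have off: "bell_state g d (p + q) (p - q) 0 2 + bell_state g d (p + q) (p - q) 1 3 = 0"
    "bell_state g d (p + q) (p - q) 2 0 + bell_state g d (p + q) (p - q) 3 1 = 0"
    by (simp_all add: bell_state_def sum_lessThan_4 bell_def field_simps)
  have chan: "qubit_channel Ks"
    unfolding qubit_channel_def
  proof (intro conjI Ks)
    show "Ks \<noteq> []" using len by auto
    have msum: "msum 2 (map (\<lambda>K. mat_adjoint K * K) Ks) \<in> carrier_mat 2 2"
      using Ks by (intro msum_map_carrier mult_carrier_mat [OF mat_adjoint_carrier]) auto
    show "msum 2 (map (\<lambda>K. mat_adjoint K * K) Ks) = 1\<^sub>m 2"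
    proof (rule eq_matI)
      fix x y :: nat assume "x < dim_row (1\<^sub>m 2 :: complex mat)" "y < dim_col (1\<^sub>m 2 :: complex mat)"
      then have xy: "x < 2" "y < 2" by auto
      have "choi Ks 0 0 + choi Ks 1 1 = 1 / 2" "choi Ks 2 2 + choi Ks 3 3 = 1 / 2"
        by (simp_all add: choi bs field_simps del: One_nat_def)
      moreover have "choi Ks 0 2 + choi Ks 1 3 = 0" "choi Ks 2 0 + choi Ks 3 1 = 0"
        using off by (simp_all add: choi del: One_nat_def flip: of_real_add)
      ultimately have "choi Ks (2 * x) (2 * y) + choi Ks (2 * x + 1) (2 * y + 1) = (if x = y then 1 / 2 else 0)"
        using xy unfolding less_2_cases_iff
        by (elim disjE) (simp_all del: One_nat_def add_2_eq_Suc add_2_eq_Suc')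
      then show "msum 2 (map (\<lambda>K. mat_adjoint K * K) Ks) $$ (x, y) = 1\<^sub>m 2 $$ (x, y)"
        unfolding index_kraus_normalization [OF Ks xy] using xy by simp
    qed (use msum in auto)
  qed
  have R: "stokes_R Ks $$ (0, 0) = m00" "stokes_R Ks $$ (0, 1) = m01" "stokes_R Ks $$ (1, 0) = m10"
    "stokes_R Ks $$ (1, 1) = m11" "stokes_t Ks $ 0 = 0" "stokes_t Ks $ 1 = 0"
    unfolding stokes_R_choi [OF Ks] stokes_t_choi [OF Ks] using bs
    by (simp_all add: choi field_simps del: One_nat_def)
  then have "Ks \<in> P_ba [m00, m01, m10, m11, 0, 0]"
    using chan by (simp add: P_ba_def omega_of_def)
  moreover have "key_rate Ks \<le> 1 - bin_entropy ((1 + (p + q)) / 2) - bin_entropy ((1 + (p - q)) / 2)"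
  proof -
    have "rho_E Ks = real_diag 4 w"
    proof (rule eq_matI)
      fix i j assume "i < dim_row (real_diag 4 w)" "j < dim_col (real_diag 4 w)"
      then have ij: "i < 4" "j < 4" by (auto simp: real_diag_def)
      have "rho_E Ks $$ (i, j) = (\<Sum>a<4. kraus_vec (Ks ! i) a * cnj (kraus_vec (Ks ! j) a) / 2)"
        using index_rho_E [OF Ks] ij len by simp
      also have "\<dots> = (\<Sum>a<4. of_real (sqrt (w i) * sqrt (w j) / 2 * (bell g d i a * bell g d j a)))"
        using kv ij by (intro sum.cong refl) simp
      also have "\<dots> = of_real (sqrt (w i) * sqrt (w j) / 2 * (\<Sum>a<4. bell g d i a * bell g d j a))"
        by (simp only: of_real_sum sum_distrib_left)
      also have "\<dots> = real_diag 4 w $$ (i, j)"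
        unfolding bell_cols [OF norm(1,2) ij] using ij by (auto simp: real_diag_def ww)
      finally show "rho_E Ks $$ (i, j) = real_diag 4 w $$ (i, j)" .
    qed (use rho_E_carrier [of Ks] len in \<open>auto simp: real_diag_def\<close>)
    then have E: "vn_entropy (rho_E Ks) = bin_entropy ((1 + (p + q)) / 2) + bin_entropy ((1 + (p - q)) / 2)"
      by (simp add: vn_entropy_real_diag w_def sum_eta_bell_weight [OF s])
    obtain u' r' where rep': "spectral_rep 4 (pinched_choi Ks) u' r'" "\<And>i. i < 4 \<Longrightarrow> r' i \<ge> 0"
      and XE: "vn_entropy (rho_XE Ks) = (\<Sum>i<4. eta (r' i))"
      using rho_XE_spectral_rep [OF Ks] by blast
    \<comment> \<open>This diagonal entropy also enters the key rate through H(X|Y) with the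
      opposite sign, so the two cancel in the bound.\<close>
    have "vn_entropy (rho_XE Ks) \<le> (\<Sum>a<4. eta (Re (choi Ks a a)))"
      unfolding XE using sum_eta_eigenvalues_le_diag [OF rep'] by (simp add: pinched_choi_def)
    then show ?thesis using key_rate_choi [OF chan R(5)] E by simp
  qed
  ultimately show ?thesis by blast
qed

section \<open>Singular values of two by two matrices\<close>

lemma bin_entropy_uminus: "bin_entropy ((1 + - s) / 2) = bin_entropy ((1 + s) / 2)"
proof -
  have a: "1 - (1 + s) / 2 = (1 + - s) / 2" "1 - (1 + - s) / 2 = (1 + s) / 2"
    by (simp_all add: field_simps)
  show ?thesis unfolding bin_entropy_def a by (rule add.commute)
qed

lemma bin_entropy_abs: "bin_entropy ((1 + \<bar>s\<bar>) / 2) = bin_entropy ((1 + s) / 2)"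
  by (cases "s \<ge> 0") (simp_all add: bin_entropy_uminus [of s, simplified])

text \<open>Gibbs' inequality with the smaller bias \<open>s\<close> as reference; the remainder is
  s' - s times a log ratio of the right sign. At s = 1 the reference has a zero probability, but
  then s' = s.\<close>

lemma bin_entropy_antimono:
  assumes "0 \<le> s" "s \<le> s'" "s' \<le> 1"
  shows "bin_entropy ((1 + s') / 2) \<le> bin_entropy ((1 + s) / 2)"
proof (cases "s = 1")
  case False
  then have s: "s < 1" using assms by simp
  have h: "1 - (1 + x) / 2 = (1 - x) / 2" for x :: real by (simp add: field_simps)
  have "eta ((1 + s') / 2) \<le> - ((1 + s') / 2) * log 2 ((1 + s) / 2) + ((1 + s) / 2 - (1 + s') / 2) / ln 2"
    using assms s by (intro eta_le_cross) auto
  moreover have "eta ((1 - s') / 2) \<le> - ((1 - s') / 2) * log 2 ((1 - s) / 2) + ((1 - s) / 2 - (1 - s') / 2) / ln 2"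
    using assms s by (intro eta_le_cross) auto
  moreover have "((1 + s) / 2 - (1 + s') / 2) / ln 2 + ((1 - s) / 2 - (1 - s') / 2) / ln 2 = 0"
    by (simp flip: add_divide_distrib) (simp add: field_simps)
  ultimately have "bin_entropy ((1 + s') / 2)
      \<le> - ((1 + s') / 2) * log 2 ((1 + s) / 2) - ((1 - s') / 2) * log 2 ((1 - s) / 2)"
    unfolding bin_entropy_def h by linarith
  also have "\<dots> = bin_entropy ((1 + s) / 2) - (s' - s) / 2 * (log 2 ((1 + s) / 2) - log 2 ((1 - s) / 2))"
    unfolding bin_entropy_def h using s assms(1) by (simp add: eta_def field_simps)
  also have "\<dots> \<le> bin_entropy ((1 + s) / 2)"
  proof -
    have "log 2 ((1 - s) / 2) \<le> log 2 ((1 + s) / 2)" using assms(1) s by (intro log_mono) auto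
    then show ?thesis using assms(2) by simp
  qed
  finally show ?thesis .
qed (use assms in simp)

section \<open>Splitting a matrix into a rotation and a reflection part\<close>

lemma exists_unit_square_root:
  obtains g where "cmod g = 1" "of_real (cmod z) * g\<^sup>2 = z"
proof (cases "z = 0")
  case True
  then show ?thesis using that [of 1] by simp
next
  case False
  then have "of_real (cmod z) * (csqrt (sgn z))\<^sup>2 = z"
    by (simp add: sgn_div_norm scaleR_conv_of_real)
  moreover have "(cmod (csqrt (sgn z)))\<^sup>2 = 1"
    using False by (simp add: norm_sgn flip: norm_power)
  then have "cmod (csqrt (sgn z)) = 1"
    by (simp add: power2_eq_1_iff)
  ultimately show ?thesis using that by blast
qed

lemma exists_rot_refl_split:
  obtains p q g d where "rot_refl_split m00 m01 m10 m11 p q g d"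
proof -
  obtain g where "cmod g = 1"
    "of_real (cmod (Complex ((m00 + m11) / 2) ((m10 - m01) / 2))) * g\<^sup>2 = Complex ((m00 + m11) / 2) ((m10 - m01) / 2)"
    using exists_unit_square_root .
  moreover obtain d where "cmod d = 1"
    "of_real (cmod (Complex ((m00 - m11) / 2) ((m10 + m01) / 2))) * d\<^sup>2 = Complex ((m00 - m11) / 2) ((m10 + m01) / 2)"
    using exists_unit_square_root .
  ultimately show ?thesis using that unfolding rot_refl_split_def by (meson norm_ge_zero)
qed

context
  fixes m00 m01 m10 m11 p q :: real and g d :: complex
  assumes split: "rot_refl_split m00 m01 m10 m11 p q g d"
begin

text \<open>With the plane viewed as the complex numbers, a real matrix is the sum of a
  complex-linear part, a scaled rotation, and an antilinear part, a scaled reflection.\<close>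

lemma rot_refl_split_apply:
  "(m00 * v0 + m01 * v1)\<^sup>2 + (m10 * v0 + m11 * v1)\<^sup>2
    = (cmod (of_real p * g\<^sup>2 * Complex v0 v1 + of_real q * d\<^sup>2 * cnj (Complex v0 v1)))\<^sup>2"
proof -
  have e: "of_real p * g\<^sup>2 = Complex ((m00 + m11) / 2) ((m10 - m01) / 2)"
    "of_real q * d\<^sup>2 = Complex ((m00 - m11) / 2) ((m10 + m01) / 2)"
    using split by (simp_all add: rot_refl_split_def)
  have "of_real p * g\<^sup>2 * Complex v0 v1 + of_real q * d\<^sup>2 * cnj (Complex v0 v1)
      = Complex (m00 * v0 + m01 * v1) (m10 * v0 + m11 * v1)"
    unfolding e by (simp add: complex_eq_iff field_simps)
  then show ?thesis by (simp add: cmod_power2)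
qed

text \<open>The triangle inequalities for two complex numbers of moduli \<open>p\<close> and
  \<open>q\<close>.\<close>

lemma rot_refl_split_apply_bounds:
  assumes "v0\<^sup>2 + v1\<^sup>2 = 1"
  shows "(p - q)\<^sup>2 \<le> (m00 * v0 + m01 * v1)\<^sup>2 + (m10 * v0 + m11 * v1)\<^sup>2"
    "(m00 * v0 + m01 * v1)\<^sup>2 + (m10 * v0 + m11 * v1)\<^sup>2 \<le> (p + q)\<^sup>2"
proof -
  note norm = rot_refl_split_norm [OF split]
  have v: "cmod (Complex v0 v1) = 1" using assms by (simp add: cmod_def)
  define A B where "A = of_real p * g\<^sup>2 * Complex v0 v1" "B = of_real q * d\<^sup>2 * cnj (Complex v0 v1)"
  have AB: "cmod A = p" "cmod B = q"
    unfolding A_B_def norm_mult complex_mod_cnj v norm_power using norm by simp_all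
  have "cmod (A + B) \<le> p + q" using norm_triangle_ineq [of A B] AB by simp
  moreover have "\<bar>p - q\<bar> \<le> cmod (A + B)" using norm_triangle_ineq3 [of A "- B"] AB by simp
  ultimately show "(p - q)\<^sup>2 \<le> (m00 * v0 + m01 * v1)\<^sup>2 + (m10 * v0 + m11 * v1)\<^sup>2"
    "(m00 * v0 + m01 * v1)\<^sup>2 + (m10 * v0 + m11 * v1)\<^sup>2 \<le> (p + q)\<^sup>2"
    unfolding rot_refl_split_apply A_B_def [symmetric]
    by (auto intro!: power_mono simp: abs_le_square_iff [symmetric])
qed

text \<open>The unit vector \<open>d * cnj g\<close> makes both parts nonnegative multiples of
  \<open>g * d\<close>, so their lengths add; after multiplication with \<i> the parts point in
  opposite directions.\<close>

lemma rot_refl_split_attained: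
  "\<exists>v0 v1. v0\<^sup>2 + v1\<^sup>2 = 1 \<and> (m00 * v0 + m01 * v1)\<^sup>2 + (m10 * v0 + m11 * v1)\<^sup>2 = (p + q)\<^sup>2"
  "\<exists>v0 v1. v0\<^sup>2 + v1\<^sup>2 = 1 \<and> (m00 * v0 + m01 * v1)\<^sup>2 + (m10 * v0 + m11 * v1)\<^sup>2 = (p - q)\<^sup>2"
proof -
  note norm = rot_refl_split_norm [OF split]
  have gg: "g * cnj g = 1" "d * cnj d = 1" using norm complex_norm_square [of g] complex_norm_square [of d] by simp_all
  have 1: "of_real p * g\<^sup>2 * (d * cnj g) + of_real q * d\<^sup>2 * cnj (d * cnj g) = of_real (p + q) * (g * d)"
  proof -
    have "of_real p * g\<^sup>2 * (d * cnj g) + of_real q * d\<^sup>2 * cnj (d * cnj g)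
        = of_real p * (g * cnj g) * (g * d) + of_real q * (d * cnj d) * (g * d)"
      by (simp add: power2_eq_square mult_ac)
    then show ?thesis unfolding gg by (simp add: algebra_simps)
  qed
  have 2: "of_real p * g\<^sup>2 * (\<i> * (d * cnj g)) + of_real q * d\<^sup>2 * cnj (\<i> * (d * cnj g)) = of_real (p - q) * (\<i> * (g * d))"
  proof -
    have "of_real p * g\<^sup>2 * (\<i> * (d * cnj g)) + of_real q * d\<^sup>2 * cnj (\<i> * (d * cnj g))
        = of_real p * (g * cnj g) * (\<i> * (g * d)) - of_real q * (d * cnj d) * (\<i> * (g * d))"
      by (simp add: power2_eq_square mult_ac)
    then show ?thesis unfolding gg by (simp add: algebra_simps)
  qed
  have "(Re z)\<^sup>2 + (Im z)\<^sup>2 = 1" if "cmod z = 1" for z using that cmod_power2 [of z] by simp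
  note unit = this
  show "\<exists>v0 v1. v0\<^sup>2 + v1\<^sup>2 = 1 \<and> (m00 * v0 + m01 * v1)\<^sup>2 + (m10 * v0 + m11 * v1)\<^sup>2 = (p + q)\<^sup>2"
  proof (intro exI conjI)
    show "(Re (d * cnj g))\<^sup>2 + (Im (d * cnj g))\<^sup>2 = 1" by (rule unit) (simp add: norm_mult norm)
    show "(m00 * Re (d * cnj g) + m01 * Im (d * cnj g))\<^sup>2 + (m10 * Re (d * cnj g) + m11 * Im (d * cnj g))\<^sup>2 = (p + q)\<^sup>2"
      unfolding rot_refl_split_apply complex_surj 1 norm_mult norm_of_real norm by simp
  qed
  show "\<exists>v0 v1. v0\<^sup>2 + v1\<^sup>2 = 1 \<and> (m00 * v0 + m01 * v1)\<^sup>2 + (m10 * v0 + m11 * v1)\<^sup>2 = (p - q)\<^sup>2"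
  proof (intro exI conjI)
    let ?z = "\<i> * (d * cnj g)"
    show "(Re ?z)\<^sup>2 + (Im ?z)\<^sup>2 = 1" by (rule unit) (simp add: norm_mult norm)
    show "(m00 * Re ?z + m01 * Im ?z)\<^sup>2 + (m10 * Re ?z + m11 * Im ?z)\<^sup>2 = (p - q)\<^sup>2"
      unfolding rot_refl_split_apply complex_surj 2 norm_mult norm_of_real norm by simp
  qed
qed

lemma rot_refl_split_squares:
  "p\<^sup>2 = ((m00 + m11)\<^sup>2 + (m10 - m01)\<^sup>2) / 4" "q\<^sup>2 = ((m00 - m11)\<^sup>2 + (m10 + m01)\<^sup>2) / 4"
proof -
  note norm = rot_refl_split_norm [OF split]
  have "cmod (of_real p * g\<^sup>2) = p" "cmod (of_real q * d\<^sup>2) = q"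
    by (simp_all add: norm_mult norm_power norm)
  then have "p = cmod (Complex ((m00 + m11) / 2) ((m10 - m01) / 2))" "q = cmod (Complex ((m00 - m11) / 2) ((m10 + m01) / 2))"
    using split by (simp_all add: rot_refl_split_def)
  then show "p\<^sup>2 = ((m00 + m11)\<^sup>2 + (m10 - m01)\<^sup>2) / 4" "q\<^sup>2 = ((m00 - m11)\<^sup>2 + (m10 + m01)\<^sup>2) / 4"
    by (simp_all only: cmod_power2 complex.sel) (simp_all add: power2_eq_square field_simps)
qed

end

lemma det_mat_2:
  fixes A :: "'a :: comm_ring_1 mat"
  assumes A: "A \<in> carrier_mat 2 2"
  shows "det A = A $$ (0, 0) * A $$ (1, 1) - A $$ (0, 1) * A $$ (1, 0)"
proof -
  have "det A = (\<Sum>i<2. A $$ (i, 0) * cofactor A i 0)"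
    using laplace_expansion_column [OF A, of 0] by simp
  moreover have det1: "det (mat_delete A i 0) = mat_delete A i 0 $$ (0, 0)" for i
    by (rule det_single) (use A in \<open>auto simp: mat_delete_def\<close>)
  have "det (mat_delete A 0 0) = A $$ (1, 1)" "det (mat_delete A 1 0) = A $$ (0, 1)"
    unfolding det1 using A by (simp_all add: mat_delete_def)
  ultimately show ?thesis by (simp add: sum_lessThan_2 cofactor_def algebra_simps)
qed

text \<open>The product of the transpose of \<open>M\<close> with \<open>M\<close> has trace 2 (p^2
  + q^2) and determinant (p^2 - q^2)^2, hence the eigenvalues (p + q)^2 and (p - q)^2.\<close>

lemma singular_values_2:
  assumes M: "M \<in> carrier_mat 2 2"
    and split: "rot_refl_split (M $$ (0, 0)) (M $$ (0, 1)) (M $$ (1, 0)) (M $$ (1, 1)) p q g d"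
  shows "sing_max M = p + q" "sing_min M = \<bar>p - q\<bar>"
proof -
  note norm = rot_refl_split_norm [OF split] and sq = rot_refl_split_squares [OF split]
  define B where "B = transpose_mat M * M"
  have B: "B \<in> carrier_mat 2 2" using M by (simp add: B_def)
  have Bi: "B $$ (i, j) = M $$ (0, i) * M $$ (0, j) + M $$ (1, i) * M $$ (1, j)" if "i < 2" "j < 2" for i j
    unfolding B_def using index_mult_mat_2 [of "transpose_mat M" M i j] M that by simp
  have "eigenvalue B k \<longleftrightarrow> k = (p + q)\<^sup>2 \<or> k = (p - q)\<^sup>2" for k
  proof -
    have ck: "char_matrix B k \<in> carrier_mat 2 2" using B by simp
    have "det (char_matrix B k) = (B $$ (0, 0) - k) * (B $$ (1, 1) - k) - B $$ (0, 1) * B $$ (1, 0)"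
      unfolding det_mat_2 [OF ck] using B by (simp add: char_matrix_def)
    also have "\<dots> = k\<^sup>2 - 2 * (p\<^sup>2 + q\<^sup>2) * k + (p\<^sup>2 - q\<^sup>2)\<^sup>2"
      unfolding sq by (simp add: Bi field_simps power2_eq_square)
    also have "\<dots> = (k - (p + q)\<^sup>2) * (k - (p - q)\<^sup>2)"
      by (simp add: algebra_simps power2_eq_square)
    finally show ?thesis unfolding eigenvalue_det [OF B] by auto
  qed
  then have ev: "{k. eigenvalue B k} = {(p + q)\<^sup>2, (p - q)\<^sup>2}" by auto
  have le: "(p - q)\<^sup>2 \<le> (p + q)\<^sup>2" using norm(3,4) by (simp add: power2_eq_square algebra_simps)
  show "sing_max M = p + q" "sing_min M = \<bar>p - q\<bar>"
    unfolding sing_max_def sing_min_def B_def [symmetric] ev using le norm(3,4)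
    by (simp_all add: max_def min_def)
qed

text \<open>Singular values are extreme stretch factors. The larger ones are compared at the
  maximizer of the first matrix, the smaller ones at the minimizer of the second.\<close>

lemma rot_refl_split_mono:
  assumes split: "rot_refl_split m00 m01 m10 m11 p q g d"
    and split': "rot_refl_split n00 n01 n10 n11 p' q' g' d'"
    and le: "\<And>v0 v1. (m00 * v0 + m01 * v1)\<^sup>2 + (m10 * v0 + m11 * v1)\<^sup>2
      \<le> (n00 * v0 + n01 * v1)\<^sup>2 + (n10 * v0 + n11 * v1)\<^sup>2"
  shows "p + q \<le> p' + q'" "\<bar>p - q\<bar> \<le> \<bar>p' - q'\<bar>"
proof -
  obtain v0 v1 where v: "v0\<^sup>2 + v1\<^sup>2 = 1" "(m00 * v0 + m01 * v1)\<^sup>2 + (m10 * v0 + m11 * v1)\<^sup>2 = (p + q)\<^sup>2"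
    using rot_refl_split_attained(1) [OF split] by blast
  have "(p + q)\<^sup>2 \<le> (p' + q')\<^sup>2"
    using le [of v0 v1] v(2) rot_refl_split_apply_bounds(2) [OF split' v(1)] by linarith
  then show "p + q \<le> p' + q'"
    using rot_refl_split_norm(3,4) [OF split'] by (meson add_nonneg_nonneg power2_le_imp_le)
  obtain v0 v1 where v: "v0\<^sup>2 + v1\<^sup>2 = 1" "(n00 * v0 + n01 * v1)\<^sup>2 + (n10 * v0 + n11 * v1)\<^sup>2 = (p' - q')\<^sup>2"
    using rot_refl_split_attained(2) [OF split'] by blast
  have "(p - q)\<^sup>2 \<le> (p' - q')\<^sup>2"
    using le [of v0 v1] v(2) rot_refl_split_apply_bounds(1) [OF split v(1)] by linarith
  then show "\<bar>p - q\<bar> \<le> \<bar>p' - q'\<bar>" by (simp add: abs_le_square_iff)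
qed

lemma rot_refl_split_le_1:
  assumes split: "rot_refl_split m00 m01 m10 m11 p q g d"
    and le: "\<And>v0 v1. v0\<^sup>2 + v1\<^sup>2 = 1 \<Longrightarrow> (m00 * v0 + m01 * v1)\<^sup>2 + (m10 * v0 + m11 * v1)\<^sup>2 \<le> 1"
  shows "p + q \<le> 1"
proof -
  obtain v0 v1 where "v0\<^sup>2 + v1\<^sup>2 = 1" "(m00 * v0 + m01 * v1)\<^sup>2 + (m10 * v0 + m11 * v1)\<^sup>2 = (p + q)\<^sup>2"
    using rot_refl_split_attained(1) [OF split] by blast
  then have "(p + q)\<^sup>2 \<le> 1\<^sup>2" using le [of v0 v1] by simp
  then show ?thesis by (rule power2_le_imp_le) simp
qed

section \<open>Contractivity of the Stokes matrix\<close>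

text \<open>\<open>choi\<close> is a sum of rank-one terms given by the Kraus vectors, so the bound
  on the form can be applied to each term.\<close>

lemma Re_choi_form_le_trace:
  assumes "\<And>k :: nat \<Rightarrow> complex. Re (\<Sum>a<4. cnj (k a) * (\<Sum>b<4. n a b * k b)) \<le> (\<Sum>a<4. (cmod (k a))\<^sup>2)"
  shows "Re (\<Sum>a<4. \<Sum>b<4. n a b * choi Ks a b) \<le> (\<Sum>a<4. Re (choi Ks a a))"
proof -
  define k where "k i = kraus_vec (Ks ! i)" for i
  define m where "m = length Ks"
  have c: "choi Ks a b = (\<Sum>i<m. cnj (k i a) * k i b) / 2" for a b by (simp add: choi_def k_def m_def)
  have "(\<Sum>a<4. \<Sum>b<4. n a b * choi Ks a b) = (\<Sum>a<4. \<Sum>b<4. \<Sum>i<m. cnj (k i a) * (n a b * k i b) / 2)"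
    by (simp add: c sum_distrib_left sum_divide_distrib mult_ac)
  also have "\<dots> = (\<Sum>a<4. \<Sum>i<m. \<Sum>b<4. cnj (k i a) * (n a b * k i b) / 2)"
    by (rule sum.cong [OF refl], rule sum.swap)
  also have "\<dots> = (\<Sum>i<m. \<Sum>a<4. \<Sum>b<4. cnj (k i a) * (n a b * k i b) / 2)" by (rule sum.swap)
  also have "\<dots> = (\<Sum>i<m. (\<Sum>a<4. cnj (k i a) * (\<Sum>b<4. n a b * k i b)) / 2)"
    by (simp only: sum_distrib_left sum_divide_distrib)
  finally have "Re (\<Sum>a<4. \<Sum>b<4. n a b * choi Ks a b) = (\<Sum>i<m. Re (\<Sum>a<4. cnj (k i a) * (\<Sum>b<4. n a b * k i b)) / 2)"
    by (simp only: Re_sum Re_divide_numeral)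
  also have "\<dots> \<le> (\<Sum>i<m. (\<Sum>a<4. (cmod (k i a))\<^sup>2) / 2)"
    by (intro sum_mono divide_right_mono assms) simp
  also have "\<dots> = (\<Sum>a<4. (\<Sum>i<m. (cmod (k i a))\<^sup>2) / 2)"
    unfolding sum_divide_distrib by (rule sum.swap)
  also have "\<dots> = (\<Sum>a<4. Re (choi Ks a a))"
  proof (rule sum.cong [OF refl])
    fix a
    have "choi Ks a a = of_real ((\<Sum>i<m. (cmod (k i a))\<^sup>2) / 2)"
      unfolding c of_real_divide of_real_sum complex_norm_square by (simp add: mult.commute)
    then show "(\<Sum>i<m. (cmod (k i a))\<^sup>2) / 2 = Re (choi Ks a a)" by (simp only: Re_complex_of_real)
  qed
  finally show ?thesis .
qed

text \<open>The Hermitian matrix with rows c, e and cnj e, -c has square (c^2 + |e|^2) times the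
  identity.\<close>

lemma cmod_reflect_pair:
  fixes e x y :: complex and c :: real
  shows "(cmod (of_real c * x + e * y))\<^sup>2 + (cmod (cnj e * x - of_real c * y))\<^sup>2
    = (c\<^sup>2 + (cmod e)\<^sup>2) * ((cmod x)\<^sup>2 + (cmod y)\<^sup>2)"
  by (simp add: cmod_power2) (simp add: power2_eq_square algebra_simps)

lemma Re_cnj_mult_le: "Re (cnj x * y) \<le> ((cmod x)\<^sup>2 + (cmod y)\<^sup>2) / 2"
proof -
  have "2 * Re x * Re y \<le> (Re x)\<^sup>2 + (Re y)\<^sup>2" "2 * Im x * Im y \<le> (Im x)\<^sup>2 + (Im y)\<^sup>2"
    by (rule sum_squares_bound)+
  then show ?thesis by (simp add: cmod_power2)
qed

text \<open>The left-hand side is the expectation of a product of two spin reflections in the Choi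
  state. A reflection preserves norms, so its form is at most the squared norm.\<close>

lemma stokes_R_bilinear_bound:
  assumes chan: "qubit_channel Ks" and u: "u0\<^sup>2 + u1\<^sup>2 + u2\<^sup>2 = 1" and v: "v0\<^sup>2 + v1\<^sup>2 = 1"
  shows "u0 * (stokes_R Ks $$ (0, 0) * v0 + stokes_R Ks $$ (0, 1) * v1)
    + u1 * (stokes_R Ks $$ (1, 0) * v0 + stokes_R Ks $$ (1, 1) * v1)
    + u2 * (stokes_R Ks $$ (2, 0) * v0 + stokes_R Ks $$ (2, 1) * v1) \<le> 1"
proof -
  have Ks: "\<forall>K\<in>set Ks. K \<in> carrier_mat 2 2" using chan by (simp add: qubit_channel_def)
  define e where "e = Complex u1 (- u2)"
  define U where "U x y = (if x = 0 then (if y = 0 then complex_of_real u0 else e)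
    else (if y = 0 then cnj e else - of_real u0))" for x y :: nat
  define V where "V x y = (if x = 0 then (if y = 0 then complex_of_real v0 else of_real v1)
    else (if y = 0 then of_real v1 else - of_real v0))" for x y :: nat
  \<comment> \<open>\<open>n\<close> is the reflection \<open>(v \<cdot> \<sigma>) \<otimes> (u \<cdot> \<sigma>)\<close>.\<close>
  define n where "n a b = V (a div 2) (b div 2) * U (a mod 2) (b mod 2)" for a b
  have e: "u0\<^sup>2 + (cmod e)\<^sup>2 = 1" using u by (simp add: e_def cmod_power2)
  have form: "Re (\<Sum>a<4. cnj (k a) * (\<Sum>b<4. n a b * k b)) \<le> (\<Sum>a<4. (cmod (k a))\<^sup>2)" for k :: "nat \<Rightarrow> complex"
  proof -
    \<comment> \<open>The two tensor factors act one after the other: \<open>V\<close> on the input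
      index gives these four numbers, then \<open>U\<close> acts on the output index.\<close>
    define x0 x1 y0 y1 where "x0 = of_real v0 * k 0 + of_real v1 * k 2" "x1 = of_real v0 * k 1 + of_real v1 * k 3"
      "y0 = cnj (of_real v1) * k 0 - of_real v0 * k 2" "y1 = cnj (of_real v1) * k 1 - of_real v0 * k 3"
    note xy = x0_x1_y0_y1_def
    define l where "l a = (\<Sum>b<4. n a b * k b)" for a
    have l: "l 0 = of_real u0 * x0 + e * x1" "l 1 = cnj e * x0 - of_real u0 * x1"
      "l 2 = of_real u0 * y0 + e * y1" "l 3 = cnj e * y0 - of_real u0 * y1"
      by (simp_all add: l_def n_def U_def V_def sum_lessThan_4 xy algebra_simps)
    have "(\<Sum>a<4. (cmod (l a))\<^sup>2) = ((cmod (l 0))\<^sup>2 + (cmod (l 1))\<^sup>2) + ((cmod (l 2))\<^sup>2 + (cmod (l 3))\<^sup>2)"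
      by (simp add: sum_lessThan_4)
    also have "\<dots> = ((cmod x0)\<^sup>2 + (cmod y0)\<^sup>2) + ((cmod x1)\<^sup>2 + (cmod y1)\<^sup>2)"
      unfolding l cmod_reflect_pair e by simp
    also have "\<dots> = (\<Sum>a<4. (cmod (k a))\<^sup>2)"
      unfolding xy cmod_reflect_pair using v by (simp add: sum_lessThan_4)
    finally have eq: "(\<Sum>a<4. (cmod (l a))\<^sup>2) = (\<Sum>a<4. (cmod (k a))\<^sup>2)" .
    have "Re (\<Sum>a<4. cnj (k a) * l a) \<le> (\<Sum>a<4. ((cmod (k a))\<^sup>2 + (cmod (l a))\<^sup>2) / 2)"
      unfolding Re_sum by (intro sum_mono Re_cnj_mult_le)
    also have "\<dots> = (\<Sum>a<4. (cmod (k a))\<^sup>2)"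
      unfolding sum_divide_distrib [symmetric] sum.distrib eq by simp
    finally show ?thesis by (simp only: l_def)
  qed
  have "Re (\<Sum>a<4. \<Sum>b<4. n a b * choi Ks a b) \<le> 1"
    using Re_choi_form_le_trace [OF form, of Ks] unfolding choi_trace [OF chan] .
  moreover have "Re (\<Sum>a<4. \<Sum>b<4. n a b * choi Ks a b)
      = u0 * (stokes_R Ks $$ (0, 0) * v0 + stokes_R Ks $$ (0, 1) * v1)
    + u1 * (stokes_R Ks $$ (1, 0) * v0 + stokes_R Ks $$ (1, 1) * v1)
    + u2 * (stokes_R Ks $$ (2, 0) * v0 + stokes_R Ks $$ (2, 1) * v1)"
    unfolding stokes_R_choi [OF Ks]
    using choi_cnj [of Ks 1 0] choi_cnj [of Ks 2 0] choi_cnj [of Ks 3 0] choi_cnj [of Ks 2 1]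
      choi_cnj [of Ks 3 1] choi_cnj [of Ks 3 2]
    by (simp add: n_def U_def V_def e_def sum_lessThan_4 algebra_simps del: One_nat_def)
  ultimately show ?thesis by simp
qed

text \<open>Take \<open>u\<close> in the bilinear bound to be the normalized image of
  \<open>v\<close>; the bound then reads N^2 / N \<le> 1.\<close>

lemma stokes_R_contraction:
  assumes chan: "qubit_channel Ks" and v: "v0\<^sup>2 + v1\<^sup>2 = 1"
  shows "(\<Sum>k<3. (stokes_R Ks $$ (k, 0) * v0 + stokes_R Ks $$ (k, 1) * v1)\<^sup>2) \<le> 1"
proof -
  define x where "x k = stokes_R Ks $$ (k, 0) * v0 + stokes_R Ks $$ (k, 1) * v1" for k
  define N where "N = sqrt ((x 0)\<^sup>2 + (x 1)\<^sup>2 + (x 2)\<^sup>2)"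
  have N2: "N\<^sup>2 = (x 0)\<^sup>2 + (x 1)\<^sup>2 + (x 2)\<^sup>2" by (simp add: N_def)
  have N0: "N \<ge> 0" by (simp add: N_def)
  have "N \<le> 1"
  proof (cases "N = 0")
    case False
    have "(x 0 / N)\<^sup>2 + (x 1 / N)\<^sup>2 + (x 2 / N)\<^sup>2 = 1"
    proof -
      have "(x 0 / N)\<^sup>2 + (x 1 / N)\<^sup>2 + (x 2 / N)\<^sup>2 = N\<^sup>2 / N\<^sup>2"
        by (simp only: power_divide N2 add_divide_distrib)
      then show ?thesis using False by simp
    qed
    from stokes_R_bilinear_bound [OF chan this v]
    have "x 0 / N * x 0 + x 1 / N * x 1 + x 2 / N * x 2 \<le> 1" by (simp only: x_def)
    moreover have "x 0 / N * x 0 + x 1 / N * x 1 + x 2 / N * x 2 = N\<^sup>2 / N"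
      unfolding N2 by (simp add: power2_eq_square add_divide_distrib)
    ultimately show ?thesis by (simp add: power2_eq_square)
  qed simp
  then have "N\<^sup>2 \<le> 1" using N0 by (simp add: power_le_one)
  then show ?thesis unfolding N2 by (simp add: x_def eval_nat_numeral)
qed

section \<open>Orthogonality relations of rotations\<close>

lemma SO3_orthogonal:
  assumes "Q \<in> SO3"
  shows "i < 3 \<Longrightarrow> j < 3 \<Longrightarrow> (\<Sum>k<3. Q $$ (i, k) * Q $$ (j, k)) = (if i = j then 1 else 0)"
    "k < 3 \<Longrightarrow> l < 3 \<Longrightarrow> (\<Sum>i<3. Q $$ (i, k) * Q $$ (i, l)) = (if k = l then 1 else 0)"
proof -
  have Q: "Q \<in> carrier_mat 3 3" and QQ: "Q * transpose_mat Q = 1\<^sub>m 3" using assms by (auto simp: SO3_def)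
  have QQ': "transpose_mat Q * Q = 1\<^sub>m 3"
    by (rule mat_mult_left_right_inverse [OF Q _ QQ]) (use Q in simp)
  show "(\<Sum>k<3. Q $$ (i, k) * Q $$ (j, k)) = (if i = j then 1 else 0)" if "i < 3" "j < 3"
  proof -
    have "(Q * transpose_mat Q) $$ (i, j) = (\<Sum>k<3. Q $$ (i, k) * Q $$ (j, k))"
      using Q that by (simp add: scalar_prod_def atLeast0LessThan)
    then show ?thesis using that by (simp add: QQ)
  qed
  show "(\<Sum>i<3. Q $$ (i, k) * Q $$ (i, l)) = (if k = l then 1 else 0)" if "k < 3" "l < 3"
  proof -
    have "(transpose_mat Q * Q) $$ (k, l) = (\<Sum>i<3. Q $$ (i, k) * Q $$ (i, l))"
      using Q that by (simp add: scalar_prod_def atLeast0LessThan)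
    then show ?thesis using that by (simp add: QQ')
  qed
qed

lemma SO3_norm:
  assumes "Q \<in> SO3"
  shows "(\<Sum>i<3. (\<Sum>k<3. Q $$ (i, k) * x k)\<^sup>2) = (\<Sum>k<3. (x k)\<^sup>2)"
proof -
  have "(\<Sum>i<3. (\<Sum>k<3. Q $$ (i, k) * x k)\<^sup>2) = (\<Sum>i<3. \<Sum>k<3. \<Sum>l<3. x k * x l * (Q $$ (i, k) * Q $$ (i, l)))"
    by (simp add: power2_eq_square sum_product mult_ac)
  also have "\<dots> = (\<Sum>k<3. \<Sum>l<3. \<Sum>i<3. x k * x l * (Q $$ (i, k) * Q $$ (i, l)))"
    by (subst sum.swap, rule sum.cong [OF refl], rule sum.swap)
  also have "\<dots> = (\<Sum>k<3. \<Sum>l<3. x k * x l * (if k = l then 1 else 0))"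
    by (intro sum.cong refl) (simp add: SO3_orthogonal(2) [OF assms] flip: sum_distrib_left)
  also have "\<dots> = (\<Sum>k<3. (x k)\<^sup>2)"
    by (intro sum.cong refl) (simp add: mult_if_zero power2_eq_square)
  finally show ?thesis .
qed

section \<open>The optimal rotation\<close>

lemma stokes_R_carrier [simp]: "stokes_R Ks \<in> carrier_mat 3 3"
  by (simp add: stokes_R_def)

text \<open>\<open>p - q\<close> stands in for the singular value |p - q|, since the binary entropy
  is even in the bias.\<close>

abbreviation rate :: "real \<Rightarrow> real \<Rightarrow> real" where
  "rate p q \<equiv> 1 - bin_entropy ((1 + (p + q)) / 2) - bin_entropy ((1 + (p - q)) / 2)"

lemma rate_mono:
  assumes "0 \<le> p" "0 \<le> q" "p + q \<le> p' + q'" "\<bar>p - q\<bar> \<le> \<bar>p' - q'\<bar>" "p' + q' \<le> 1" "0 \<le> p'" "0 \<le> q'"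
  shows "rate p q \<le> rate p' q'"
proof -
  have "bin_entropy ((1 + (p' + q')) / 2) \<le> bin_entropy ((1 + (p + q)) / 2)"
    using assms by (intro bin_entropy_antimono) auto
  moreover have "bin_entropy ((1 + \<bar>p' - q'\<bar>) / 2) \<le> bin_entropy ((1 + \<bar>p - q\<bar>) / 2)"
    using assms by (intro bin_entropy_antimono) auto
  ultimately show ?thesis unfolding bin_entropy_abs by simp
qed

text \<open>The diagonal of the Choi state is the same throughout this set, so the crude estimate is
  uniform. Boundedness is what allows comparing the infimum with single channels over the
  reals.\<close>

lemma bdd_below_key_rate: "bdd_below (key_rate ` P_ba [m00, m01, m10, m11, 0, 0])"
proof (rule bdd_belowI2)
  fix Ks assume "Ks \<in> P_ba [m00, m01, m10, m11, 0, 0]"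
  then have chan: "qubit_channel Ks" and t: "stokes_t Ks $ 0 = 0" and R: "stokes_R Ks $$ (0, 0) = m00"
    by (auto simp: P_ba_def omega_of_def)
  have "(\<Sum>a<4. eta (Re (choi Ks a a))) = 2 * eta ((1 + m00) / 4) + 2 * eta ((1 - m00) / 4)"
    unfolding sum_lessThan_4 choi_diag [OF chan t] R by simp
  then show "1 - 2 * (2 * eta ((1 + m00) / 4) + 2 * eta ((1 - m00) / 4)) \<le> key_rate Ks"
    using key_rate_lower_bound [OF chan t] by simp
qed

theorem theorem6:
  fixes E :: "complex mat list" and Ob :: "real mat"
  assumes chan: "qubit_channel E"
    and unit: "unital E"
    and rot: "Ob \<in> SO3"
    and span: "{a \<cdot>\<^sub>v row Ob 0 + b \<cdot>\<^sub>v row Ob 1 | a b. True}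
             = {a \<cdot>\<^sub>v col (stokes_R E) 0 + b \<cdot>\<^sub>v col (stokes_R E) 1 | a b. True}"
    and first: "\<exists>c. row Ob 0 = c \<cdot>\<^sub>v col (stokes_R E) 0"
  shows "J1 E = (INF F\<in>P_ba (omega_of (Ob * stokes_R E) (Ob *\<^sub>v stokes_t E)). key_rate F)
       \<and> (INF F\<in>P_ba (omega_of (Ob * stokes_R E) (Ob *\<^sub>v stokes_t E)). key_rate F)
           = 1 - bin_entropy ((1 + sing_max (upper_left2 (Ob * stokes_R E))) / 2)
               - bin_entropy ((1 + sing_min (upper_left2 (Ob * stokes_R E))) / 2)
       \<and> (\<exists>F\<in>P_ba (omega_of (Ob * stokes_R E) (Ob *\<^sub>v stokes_t E)).
           key_rate F = 1 - bin_entropy ((1 + sing_max (upper_left2 (Ob * stokes_R E))) / 2)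
               - bin_entropy ((1 + sing_min (upper_left2 (Ob * stokes_R E))) / 2))"
proof -
  define R where "R = stokes_R E"
  define \<Omega> where "\<Omega> Q = omega_of (Q * R) (Q *\<^sub>v stokes_t E)" for Q
  have R: "R \<in> carrier_mat 3 3" by (simp add: R_def)
  have entry: "(Q * R) $$ (i, j) = (\<Sum>k<3. Q $$ (i, k) * R $$ (k, j))"
    if "Q \<in> SO3" "i < 3" "j < 3" for Q i j
    using that R by (auto simp: SO3_def scalar_prod_def atLeast0LessThan)
  have omega: "\<Omega> Q = [(Q * R) $$ (0, 0), (Q * R) $$ (0, 1), (Q * R) $$ (1, 0), (Q * R) $$ (1, 1), 0, 0]"
    if "Q \<in> SO3" for Q
  proof -
    have "Q *\<^sub>v stokes_t E = 0\<^sub>v 3"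
      by (rule eq_vecI) (use that unit in \<open>auto simp: SO3_def unital_def scalar_prod_def\<close>)
    then show ?thesis by (simp add: \<Omega>_def omega_of_def)
  qed
  \<comment> \<open>For a vector v in the z-x plane, \<open>S Q\<close> is the squared length of the
    first two components of Q R v, while \<open>T\<close> is the full squared length of R v and does
    not depend on Q.\<close>
  define S where "S Q v0 v1 = ((Q * R) $$ (0, 0) * v0 + (Q * R) $$ (0, 1) * v1)\<^sup>2
      + ((Q * R) $$ (1, 0) * v0 + (Q * R) $$ (1, 1) * v1)\<^sup>2" for Q v0 v1
  define T where "T v0 v1 = (\<Sum>k<3. (R $$ (k, 0) * v0 + R $$ (k, 1) * v1)\<^sup>2)" for v0 v1
  have ST: "S Q v0 v1 + ((Q * R) $$ (2, 0) * v0 + (Q * R) $$ (2, 1) * v1)\<^sup>2 = T v0 v1"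
    if Q: "Q \<in> SO3" for Q v0 v1
  proof -
    have "(Q * R) $$ (i, 0) * v0 + (Q * R) $$ (i, 1) * v1
        = (\<Sum>k<3. Q $$ (i, k) * (R $$ (k, 0) * v0 + R $$ (k, 1) * v1))" if "i < 3" for i
    proof -
      have 0: "(Q * R) $$ (i, 0) = (\<Sum>k<3. Q $$ (i, k) * R $$ (k, 0))"
        and 1: "(Q * R) $$ (i, 1) = (\<Sum>k<3. Q $$ (i, k) * R $$ (k, 1))"
        by (rule entry [OF Q that]; simp)+
      show ?thesis
        unfolding 0 1 sum_distrib_right sum.distrib [symmetric]
        by (intro sum.cong refl) (simp add: algebra_simps)
    qed
    moreover have "T v0 v1 = (\<Sum>i<3. (\<Sum>k<3. Q $$ (i, k) * (R $$ (k, 0) * v0 + R $$ (k, 1) * v1))\<^sup>2)"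
      unfolding T_def by (rule SO3_norm [OF Q, symmetric])
    ultimately show ?thesis
      unfolding S_def by (simp add: sum_lessThan_3 [of "\<lambda>i. (\<Sum>k<3. Q $$ (i, k) * _ k)\<^sup>2"])
  qed
  have S_le: "S Q v0 v1 \<le> T v0 v1" if "Q \<in> SO3" for Q v0 v1
    unfolding ST [OF that, symmetric] by simp
  have T_le: "T v0 v1 \<le> 1" if "v0\<^sup>2 + v1\<^sup>2 = 1" for v0 v1
    unfolding T_def R_def by (rule stokes_R_contraction [OF chan that])
  have row_Ob: "row Ob i \<in> carrier_vec 3" for i using rot by (auto simp: SO3_def intro!: carrier_vecI)
  have rowi: "row Ob i $ k = Ob $$ (i, k)" if "i < 3" "k < 3" for i k
    using rot that by (auto simp: SO3_def)
  have coli: "col R j $ k = R $$ (k, j)" if "j < 3" "k < 3" for j k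
    using R that by simp
  \<comment> \<open>The first two columns of \<open>R\<close> lie in the span of the first two rows
    of \<open>Ob\<close>, to which the third row is orthogonal.\<close>
  have Ob2: "(Ob * R) $$ (2, j) = 0" if j: "j < 2" for j
  proof -
    have "col R j \<in> {a \<cdot>\<^sub>v col R 0 + b \<cdot>\<^sub>v col R 1 | a b. True}"
    proof -
      have "col R j = (if j = 0 then 1 else 0) \<cdot>\<^sub>v col R 0 + (if j = 0 then 0 else 1) \<cdot>\<^sub>v col R 1"
        by (rule eq_vecI) (use R j in \<open>auto simp: less_2_cases_iff\<close>)
      then show ?thesis by blast
    qed
    then have "col R j \<in> {a \<cdot>\<^sub>v row Ob 0 + b \<cdot>\<^sub>v row Ob 1 | a b. True}"
      by (simp only: span [folded R_def])
    then obtain a b where "col R j = a \<cdot>\<^sub>v row Ob 0 + b \<cdot>\<^sub>v row Ob 1" by blast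
    then have "R $$ (k, j) = a * Ob $$ (0, k) + b * Ob $$ (1, k)" if "k < 3" for k
      using coli [of j k] rowi [of 0 k] rowi [of 1 k] carrier_vecD [OF row_Ob, of 0] carrier_vecD [OF row_Ob, of 1] that j
      by (simp del: index_row row_def)
    then have "(Ob * R) $$ (2, j) = a * (\<Sum>k<3. Ob $$ (2, k) * Ob $$ (0, k)) + b * (\<Sum>k<3. Ob $$ (2, k) * Ob $$ (1, k))"
      using j by (simp add: entry [OF rot] sum_distrib_left sum.distrib algebra_simps)
    then show ?thesis using SO3_orthogonal(1) [OF rot, of 2 0] SO3_orthogonal(1) [OF rot, of 2 1] by simp
  qed
  have S_Ob: "S Ob v0 v1 = T v0 v1" for v0 v1
    using ST [OF rot, of v0 v1] Ob2 [of 0] Ob2 [of 1] by simp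
  \<comment> \<open>The second row of \<open>Ob\<close> is orthogonal to the first, which is a
    multiple of column 0 of \<open>R\<close>. The factor is nonzero because rows have length
    1.\<close>
  have Ob10: "(Ob * R) $$ (1, 0) = 0"
  proof -
    obtain c where c: "row Ob 0 = c \<cdot>\<^sub>v col R 0" using first by (auto simp: R_def)
    have ck: "Ob $$ (0, k) = c * R $$ (k, 0)" if "k < 3" for k
      using arg_cong [OF c, of "\<lambda>v. v $ k"] rowi [of 0 k] coli [of 0 k] R that by simp
    have "c * (Ob * R) $$ (1, 0) = (\<Sum>k<3. Ob $$ (1, k) * Ob $$ (0, k))"
      by (simp add: entry [OF rot] sum_distrib_left ck mult_ac)
    then have "c * (Ob * R) $$ (1, 0) = 0" using SO3_orthogonal(1) [OF rot, of 1 0] by simp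
    moreover have "c \<noteq> 0"
    proof
      assume "c = 0"
      then show False using SO3_orthogonal(1) [OF rot, of 0 0] ck by simp
    qed
    ultimately show ?thesis by simp
  qed
  obtain p q g d where split: "rot_refl_split ((Ob * R) $$ (0, 0)) ((Ob * R) $$ (0, 1)) ((Ob * R) $$ (1, 0))
      ((Ob * R) $$ (1, 1)) p q g d"
    using exists_rot_refl_split .
  note norm = rot_refl_split_norm [OF split]
  have pq: "p + q \<le> 1"
    by (rule rot_refl_split_le_1 [OF split]) (use S_Ob T_le in \<open>simp add: S_def\<close>)
  have sing: "sing_max (upper_left2 (Ob * R)) = p + q" "sing_min (upper_left2 (Ob * R)) = \<bar>p - q\<bar>"
    by (rule singular_values_2 [of _ p q g d]; use split in \<open>simp add: upper_left2_def\<close>)+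
  have ge: "rate p q \<le> key_rate F" if "F \<in> P_ba (\<Omega> Ob)" for F
    using that split unfolding omega [OF rot] Ob10
    by (intro key_rate_ge [OF _ _ _ pq]) (auto simp: P_ba_def)
  have le: "\<exists>F\<in>P_ba (\<Omega> Q). key_rate F \<le> rate p q" if Q: "Q \<in> SO3" for Q
  proof -
    obtain p' q' g' d' where split': "rot_refl_split ((Q * R) $$ (0, 0)) ((Q * R) $$ (0, 1)) ((Q * R) $$ (1, 0))
        ((Q * R) $$ (1, 1)) p' q' g' d'"
      using exists_rot_refl_split .
    \<comment> \<open>No rotation retains more of the length of R v in the first two components than
      \<open>Ob\<close>, which retains all of it. Hence both singular values are largest for
      \<open>Ob\<close>.\<close>
    have "S Q v0 v1 \<le> S Ob v0 v1" for v0 v1 using S_le [OF Q] S_Ob by simp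
    then have sv: "p' + q' \<le> p + q" "\<bar>p' - q'\<bar> \<le> \<bar>p - q\<bar>"
      unfolding S_def by (rule rot_refl_split_mono [OF split' split])+
    have pq': "p' + q' \<le> 1" using sv(1) pq by linarith
    have "rate p' q' \<le> rate p q"
      using sv pq norm(3,4) rot_refl_split_norm(3,4) [OF split'] by (intro rate_mono)
    then show ?thesis
      using bell_channel [OF split' pq'] unfolding omega [OF Q] by (meson order_trans)
  qed
  \<comment> \<open>The Bell-diagonal channel for \<open>Ob\<close> itself meets the lower bound, so
    the infimum is a minimum.\<close>
  obtain F where F: "F \<in> P_ba (\<Omega> Ob)" "key_rate F = rate p q"
    using le [OF rot] ge by (meson order_antisym)
  have INF: "(INF F\<in>P_ba (\<Omega> Ob). key_rate F) = rate p q"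
    by (rule cInf_eq_minimum) (use F ge in force)+
  have "J1 E = rate p q"
    unfolding J1_def R_def [symmetric] \<Omega>_def [symmetric]
  proof (rule cSup_eq_maximum)
    show "rate p q \<in> (\<lambda>Q. INF F\<in>P_ba (\<Omega> Q). key_rate F) ` SO3" using rot INF by (metis imageI)
    fix y assume "y \<in> (\<lambda>Q. INF F\<in>P_ba (\<Omega> Q). key_rate F) ` SO3"
    then obtain Q where Q: "Q \<in> SO3" and y: "y = (INF F\<in>P_ba (\<Omega> Q). key_rate F)" by blast
    obtain F where "F \<in> P_ba (\<Omega> Q)" "key_rate F \<le> rate p q" using le [OF Q] by blast
    moreover have "bdd_below (key_rate ` P_ba (\<Omega> Q))" unfolding omega [OF Q] by (rule bdd_below_key_rate)
    ultimately show "y \<le> rate p q" unfolding y by (meson cINF_lower order_trans)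
  qed
  then show ?thesis
    using F INF unfolding R_def [symmetric] \<Omega>_def [symmetric] sing bin_entropy_abs by auto
qed

end
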